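(* For every $\varepsilon>0$ there exists a constant $\delta>0$ such that for all sufficiently large $n$ and $t=(\sqrt2+\varepsilon)\sqrt{n\log n}$ we have \[g(n;3,t)\ge\delta\,\frac{nt}{2}.\]
   Context: A red/blue/purple colouring of $K_n$ is a partition $R\cup B\cup P$ of its edge set. For integers $s,t\ge2$ and $n<R(s,t)$, $g(n;s,t)$ is the largest integer $g$ such that some red/blue/purple colouring of $K_n$ has $|P|=g$, $R\cup P$ is $K_s$-free and $B\cup P$ is $K_t$-free; for non-integer arguments $g(n;s,t):=g(n;\lceil s\rceil,\lceil t\rceil)$. Logarithms are base 2. *)

theory Defs
  imports Complex_Main "HOL-Library.Ramsey"
begin

text \<open>The vertex set of \<open>K\<^sub>n\<close> is \<open>{..<n}\<close> and its edge set is \<open>nsets {..<n} 2\<close>.\<close>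

definition clique_free :: "nat \<Rightarrow> nat \<Rightarrow> nat set set \<Rightarrow> bool" where
  "clique_free n s E \<longleftrightarrow> \<not> (\<exists>V \<subseteq> {..<n}. card V = s \<and> clique V E)"

text \<open>The colour classes of a partition are allowed to be empty.\<close>

definition rbp_colouring :: "nat \<Rightarrow> nat set set \<Rightarrow> nat set set \<Rightarrow> nat set set \<Rightarrow> bool" where
  "rbp_colouring n R B P \<longleftrightarrow>
     R \<union> B \<union> P = nsets {..<n} 2 \<and> R \<inter> B = {} \<and> R \<inter> P = {} \<and> B \<inter> P = {}"

definition ramsey_number :: "nat \<Rightarrow> nat \<Rightarrow> nat" where
  "ramsey_number s t = (LEAST N. partn_lst {..<N} [s, t] 2)"

definition purple_sizes :: "nat \<Rightarrow> nat \<Rightarrow> nat \<Rightarrow> nat set" where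
  "purple_sizes n s t =
     {card P | R B P. rbp_colouring n R B P \<and> clique_free n s (R \<union> P) \<and> clique_free n t (B \<union> P)}"

text \<open>Only meaningful for \<open>s, t \<ge> 2\<close> and \<open>n < ramsey_number s t\<close>; by
  \<open>finite_purple_sizes\<close> and \<open>purple_sizes_nonempty\<close> below, the maximum then exists.\<close>

definition g_nat :: "nat \<Rightarrow> nat \<Rightarrow> nat \<Rightarrow> nat" where
  "g_nat n s t = Max (purple_sizes n s t)"

definition g :: "nat \<Rightarrow> real \<Rightarrow> real \<Rightarrow> nat" where
  "g n s t = g_nat n (nat \<lceil>s\<rceil>) (nat \<lceil>t\<rceil>)"

lemma finite_purple_sizes: "finite (purple_sizes n s t)"
proof -
  have "purple_sizes n s t \<subseteq> card ` Pow (nsets {..<n} 2)"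
    by (auto simp: purple_sizes_def rbp_colouring_def)
  then show ?thesis
    by (rule finite_subset) (simp add: finite_imp_finite_nsets)
qed

lemma purple_sizes_nonempty:
  assumes "n < ramsey_number s t"
  shows "purple_sizes n s t \<noteq> {}"
proof -
  have "\<not> partn_lst {..<n} [s, t] 2"
    using assms not_less_Least unfolding ramsey_number_def by blast
  then obtain f where f: "f \<in> nsets {..<n} 2 \<rightarrow> {..<2::nat}"
    and nm: "\<And>i. i < 2 \<Longrightarrow> \<not> monochromatic {..<n} ([s, t] ! i) 2 f i"
    by (auto simp: partn_lst_def numeral_2_eq_2)
  define C where "C i = {e \<in> nsets {..<n} 2. f e = i}" for i
  have free: "clique_free n ([s, t] ! i) (C i)" if "i < 2" for i
    unfolding clique_free_def
  proof
    assume "\<exists>V\<subseteq>{..<n}. card V = [s, t] ! i \<and> clique V (C i)"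
    then obtain V where V: "V \<subseteq> {..<n}" "card V = [s, t] ! i" "clique V (C i)"
      by blast
    have "f ` nsets V 2 \<subseteq> {i}"
      using V(3) by (auto simp: C_def clique_def nsets_2_eq)
    moreover have "V \<in> nsets {..<n} ([s, t] ! i)"
      using V finite_subset by (auto simp: nsets_def)
    ultimately show False
      using nm[OF that] unfolding monochromatic_def by blast
  qed
  have "rbp_colouring n (C 0) (C 1) {}"
    using f by (fastforce simp: rbp_colouring_def C_def Pi_def)
  moreover have "clique_free n s (C 0 \<union> {})" "clique_free n t (C 1 \<union> {})"
    using free[of 0] free[of 1] by simp_all
  ultimately have "card ({} :: nat set set) \<in> purple_sizes n s t"
    unfolding purple_sizes_def by blast
  then show ?thesis by blast
qed

end

theory Submission
  imports Defs "HOL-Library.Disjoint_Sets" "HOL-Real_Asymp.Real_Asymp"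
begin

text \<open>
  The graph \<open>R \<union> P\<close> is the overlay of two blow-ups, in the manner of Hefty, Horn, King and Pfender.
  Two independent random maps \<open>\<phi>, \<psi>\<close> send the \<open>n\<close> vertices to \<open>m \<approx> n / (ln n)\<^sup>2\<close> base vertices, and each
  set of base vertices carries a random graph of density \<open>\<Theta>(sqrt (ln n / n))\<close>. A base graph has few
  triangles, and the fraction of pairs with a common neighbour in it is only \<open>O(1 / ln n)\<close>. Hence one
  may delete a maximal family of edge-disjoint triangles from each base graph, and drop a pulled back
  edge whenever its ends are joined by a path of two edges of the other colour, at little cost; what
  remains is triangle-free. A \<open>k\<close>-set has two images, and the number of \<open>k\<close>-sets with images of sizes
  \<open>a\<close> and \<open>b\<close> is about \<open>n\<close> to the power \<open>(a + b - k) / 2\<close>. A union bound, using for each \<open>k\<close>-set only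
  the colour with the larger image, shows that every \<open>k\<close>-set, \<open>k \<approx> sqrt (2 n log\<^sub>2 n)\<close>, spans
  \<open>\<Omega>(k ln n)\<close> edges. Averaging over the \<open>k\<close>-sets gives \<open>\<Omega>(n k)\<close> edges in all, and since each
  \<open>k\<close>-set has so many of them, a constant fraction of the edges can be made purple without any
  \<open>k\<close>-set having only purple edges.
\<close>

section \<open>Random subsets\<close>

text \<open>In a random graph of density c sqrt(ln n / n) on all n vertices a pair has about c^2 ln
  n common neighbours, so almost every edge lies in a triangle. Keeping the density but shrinking
  the vertex set by (ln n)^2 lowers this number to O(1 / ln n). The price is that a
  \<open>k\<close>-set made of whole fibres has an image of size about k / (ln n)^2 and sees hardly
  any edge of that colour. A second, independent map repairs this, since sets collapsed by both maps
  are very rare: with weight n^(-1/2) for each point of either image, all \<open>k\<close>-sets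
  together have weight n^(-k/2 + o(k)). The main loss comes from large neighbourhoods of the other
  colour, inside which all pairs are linked. Such a neighbourhood consists of o(k) fibres, so a
  \<open>k\<close>-set can lie in it only by losing image size, hence by being rare. Balancing edge
  density against this loss fixes the constants. Having order k ln n edges in each
  \<open>k\<close>-set, not just one, is what the last step consumes: there are exp(O(k ln n)) such
  sets, so a bounded number of labels suffices to leave none of them monochromatic.\<close>

text \<open>Expectation over the random subset of \<open>E\<close> that contains each element independently with
  probability \<open>p\<close>.\<close>

definition rs_exp :: "real \<Rightarrow> 'a set \<Rightarrow> ('a set \<Rightarrow> real) \<Rightarrow> real" where
  "rs_exp p E f = (\<Sum>X\<in>Pow E. p ^ card X * (1 - p) ^ card (E - X) * f X)"

lemma rs_exp_empty [simp]: "rs_exp p {} f = f {}"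
  by (simp add: rs_exp_def)

text \<open>Conditioning on whether \<open>e\<close> is chosen; \<open>rs_exp_const\<close> and
  \<open>rs_exp_Un\<close> are inductions over this recursion.\<close>

lemma rs_exp_insert:
  assumes "finite E" "e \<notin> E"
  shows "rs_exp p (insert e E) f = (1 - p) * rs_exp p E f + p * rs_exp p E (\<lambda>X. f (insert e X))"
proof -
  have inj: "inj_on (insert e) (Pow E)"
    using assms(2) by (auto simp: inj_on_def)
  have disj: "Pow E \<inter> insert e ` Pow E = {}"
    using assms(2) by auto
  have 1: "(1 - p) ^ card (insert e E - X) = (1 - p) * (1 - p) ^ card (E - X)" if "X \<in> Pow E" for X
  proof -
    have "insert e E - X = insert e (E - X)" "e \<notin> E - X" "finite (E - X)"
      using that assms by auto
    then show ?thesis by simp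
  qed
  have 2: "card (insert e X) = Suc (card X)" "insert e E - insert e X = E - X" if "X \<in> Pow E" for X
  proof -
    have "finite X" "e \<notin> X"
      using that assms finite_subset by auto
    then show "card (insert e X) = Suc (card X)" "insert e E - insert e X = E - X"
      using that assms by auto
  qed
  have "rs_exp p (insert e E) f
      = (\<Sum>X\<in>Pow E. p ^ card X * (1 - p) ^ card (insert e E - X) * f X)
        + (\<Sum>X\<in>insert e ` Pow E. p ^ card X * (1 - p) ^ card (insert e E - X) * f X)"
    unfolding rs_exp_def Pow_insert using assms(1) disj by (intro sum.union_disjoint) auto
  also have "(\<Sum>X\<in>Pow E. p ^ card X * (1 - p) ^ card (insert e E - X) * f X) = (1 - p) * rs_exp p E f"
    unfolding rs_exp_def sum_distrib_left by (intro sum.cong refl) (simp add: 1)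
  also have "(\<Sum>X\<in>insert e ` Pow E. p ^ card X * (1 - p) ^ card (insert e E - X) * f X)
      = p * rs_exp p E (\<lambda>X. f (insert e X))"
    unfolding rs_exp_def sum_distrib_left sum.reindex[OF inj]
    by (intro sum.cong refl) (simp only: o_def 2 power_Suc mult.assoc)
  finally show ?thesis .
qed

lemma rs_exp_cong: "(\<And>X. X \<subseteq> E \<Longrightarrow> f X = v X) \<Longrightarrow> rs_exp p E f = rs_exp p E v"
  unfolding rs_exp_def by (intro sum.cong) auto

lemma rs_exp_mono:
  assumes "0 \<le> p" "p \<le> 1" "\<And>X. X \<subseteq> E \<Longrightarrow> f X \<le> v X"
  shows "rs_exp p E f \<le> rs_exp p E v"
  unfolding rs_exp_def using assms by (intro sum_mono mult_left_mono) auto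

lemma rs_exp_cmult: "rs_exp p E (\<lambda>X. c * f X) = c * rs_exp p E f"
  unfolding rs_exp_def sum_distrib_left by (intro sum.cong) auto

lemma rs_exp_add: "rs_exp p E (\<lambda>X. f X + v X) = rs_exp p E f + rs_exp p E v"
  unfolding rs_exp_def by (simp add: distrib_left sum.distrib)

lemma rs_exp_sum: "rs_exp p E (\<lambda>X. \<Sum>i\<in>I. f i X) = (\<Sum>i\<in>I. rs_exp p E (f i))"
  unfolding rs_exp_def sum_distrib_left by (rule sum.swap)

lemma rs_exp_const [simp]: "finite E \<Longrightarrow> rs_exp p E (\<lambda>X. c) = c"
  by (induction E rule: finite_induct) (simp_all add: rs_exp_insert algebra_simps)

lemma rs_exp_nonneg:
  assumes "0 \<le> p" "p \<le> 1" "\<And>X. X \<subseteq> E \<Longrightarrow> 0 \<le> f X"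
  shows "0 \<le> rs_exp p E f"
  unfolding rs_exp_def using assms by (intro sum_nonneg) auto

lemma rs_exp_less_imp_ex:
  assumes "finite E" "0 \<le> p" "p \<le> 1" "rs_exp p E f < c"
  shows "\<exists>X\<subseteq>E. f X < c"
proof (rule ccontr)
  assume "\<not> (\<exists>X\<subseteq>E. f X < c)"
  then have "rs_exp p E (\<lambda>X. c) \<le> rs_exp p E f"
    using assms by (intro rs_exp_mono) auto
  then show False using assms by simp
qed

text \<open>Independence in general form: disjoint parts of the ground set may be sampled one after
  the other. The function need not factor, so the rule yields both restriction to a part and
  products over blocks.\<close>

lemma rs_exp_Un:
  assumes "finite A" "finite B" "A \<inter> B = {}"
  shows "rs_exp p (A \<union> B) f = rs_exp p A (\<lambda>X. rs_exp p B (\<lambda>Y. f (X \<union> Y)))"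
  using assms
proof (induction A arbitrary: f rule: finite_induct)
  case (insert e A)
  then have "rs_exp p (insert e A \<union> B) f
      = (1 - p) * rs_exp p (A \<union> B) f + p * rs_exp p (A \<union> B) (\<lambda>X. f (insert e X))"
    by (simp add: rs_exp_insert)
  then show ?case
    using insert by (simp add: rs_exp_insert)
qed simp

lemma rs_exp_restrict:
  assumes "finite E" "A \<subseteq> E"
  shows "rs_exp p E (\<lambda>X. f (X \<inter> A)) = rs_exp p A f"
proof -
  have "rs_exp p (A \<union> (E - A)) (\<lambda>X. f (X \<inter> A))
      = rs_exp p A (\<lambda>X. rs_exp p (E - A) (\<lambda>Y. f ((X \<union> Y) \<inter> A)))"
    using assms finite_subset by (intro rs_exp_Un) auto
  also have "\<dots> = rs_exp p A (\<lambda>X. rs_exp p (E - A) (\<lambda>Y. f X))"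
  proof (intro rs_exp_cong)
    fix X Y assume "X \<subseteq> A" "Y \<subseteq> E - A"
    then have "(X \<union> Y) \<inter> A = X" by auto
    then show "f ((X \<union> Y) \<inter> A) = f X" by simp
  qed
  finally show ?thesis
    using assms by (simp add: Un_absorb1)
qed

text \<open>Writing a factor as a function of \<open>X \<inter> A i\<close> expresses that it sees
  only its own block; disjointness of the blocks then makes the expectation multiplicative.\<close>

lemma rs_exp_prod_blocks:
  assumes "finite I" "\<And>i. i \<in> I \<Longrightarrow> finite (A i)" "disjoint_family_on A I"
  shows "rs_exp p (\<Union>i\<in>I. A i) (\<lambda>X. \<Prod>i\<in>I. f i (X \<inter> A i)) = (\<Prod>i\<in>I. rs_exp p (A i) (f i))"
  using assms
proof (induction I rule: finite_induct)
  case (insert i I)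
  have disj: "A i \<inter> (\<Union>j\<in>I. A j) = {}"
    using insert.prems(2) insert.hyps by (fastforce simp: disjoint_family_on_def)
  have dI: "disjoint_family_on A I"
    using insert.prems(2) by (auto simp: disjoint_family_on_def)
  have "rs_exp p (\<Union>j\<in>insert i I. A j) (\<lambda>X. \<Prod>j\<in>insert i I. f j (X \<inter> A j))
      = rs_exp p (A i \<union> (\<Union>j\<in>I. A j)) (\<lambda>X. f i (X \<inter> A i) * (\<Prod>j\<in>I. f j (X \<inter> A j)))"
    using insert.hyps by simp
  also have "\<dots> = rs_exp p (A i) (\<lambda>X. rs_exp p (\<Union>j\<in>I. A j)
      (\<lambda>Y. f i ((X \<union> Y) \<inter> A i) * (\<Prod>j\<in>I. f j ((X \<union> Y) \<inter> A j))))"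
    using insert disj by (intro rs_exp_Un) auto
  also have "\<dots> = rs_exp p (A i) (\<lambda>X. rs_exp p (\<Union>j\<in>I. A j) (\<lambda>Y. f i X * (\<Prod>j\<in>I. f j (Y \<inter> A j))))"
  proof (intro rs_exp_cong)
    fix X Y assume XY: "X \<subseteq> A i" "Y \<subseteq> (\<Union>j\<in>I. A j)"
    have "(X \<union> Y) \<inter> A i = X" using XY disj by auto
    moreover have "(\<Prod>j\<in>I. f j ((X \<union> Y) \<inter> A j)) = (\<Prod>j\<in>I. f j (Y \<inter> A j))"
    proof (rule prod.cong[OF refl])
      fix j assume "j \<in> I"
      then have "(X \<union> Y) \<inter> A j = Y \<inter> A j" using XY disj by auto
      then show "f j ((X \<union> Y) \<inter> A j) = f j (Y \<inter> A j)" by simp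
    qed
    ultimately show "f i ((X \<union> Y) \<inter> A i) * (\<Prod>j\<in>I. f j ((X \<union> Y) \<inter> A j))
        = f i X * (\<Prod>j\<in>I. f j (Y \<inter> A j))" by simp
  qed
  also have "\<dots> = rs_exp p (A i) (\<lambda>X. (\<Prod>j\<in>I. rs_exp p (A j) (f j)) * f i X)"
    using insert dI by (simp add: rs_exp_cmult mult.commute)
  also have "\<dots> = (\<Prod>j\<in>I. rs_exp p (A j) (f j)) * rs_exp p (A i) (f i)"
    by (rule rs_exp_cmult)
  also have "\<dots> = (\<Prod>j\<in>insert i I. rs_exp p (A j) (f j))"
    using insert.hyps by (simp add: mult.commute)
  finally show ?case .
qed simp

text \<open>The index map \<open>e\<close> allows the edges at a vertex to be indexed by their other
  ends. A value 0 of \<open>h\<close> encodes that an edge must be present, so indicators and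
  exponential moments are both instances.\<close>

lemma rs_exp_prod_inj:
  assumes "finite E" "inj_on e U" "e ` U \<subseteq> E"
  shows "rs_exp p E (\<lambda>X. \<Prod>u\<in>U. if e u \<in> X then v u else h u) = (\<Prod>u\<in>U. p * v u + (1 - p) * h u)"
proof -
  have fin: "finite U"
    using assms by (meson finite_imageD finite_subset)
  have "rs_exp p E (\<lambda>X. \<Prod>u\<in>U. if e u \<in> X then v u else h u)
      = rs_exp p E (\<lambda>X. (\<lambda>Y. \<Prod>u\<in>U. if e u \<in> Y \<inter> {e u} then v u else h u) (X \<inter> e ` U))"
    by (intro rs_exp_cong prod.cong) auto
  also have "\<dots> = rs_exp p (e ` U) (\<lambda>Y. \<Prod>u\<in>U. if e u \<in> Y \<inter> {e u} then v u else h u)"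
    using assms by (rule_tac rs_exp_restrict) auto
  also have "e ` U = (\<Union>u\<in>U. {e u})" by auto
  also have "rs_exp p (\<Union>u\<in>U. {e u}) (\<lambda>Y. \<Prod>u\<in>U. if e u \<in> Y \<inter> {e u} then v u else h u)
      = (\<Prod>u\<in>U. rs_exp p {e u} (\<lambda>Y. if e u \<in> Y then v u else h u))"
  proof (rule rs_exp_prod_blocks[where f = "\<lambda>u Y. if e u \<in> Y then v u else h u"])
    show "disjoint_family_on (\<lambda>u. {e u}) U"
      using assms(2) by (auto simp: disjoint_family_on_def inj_on_def)
  qed (use fin in auto)
  also have "\<dots> = (\<Prod>u\<in>U. p * v u + (1 - p) * h u)"
    by (intro prod.cong refl) (simp add: rs_exp_insert algebra_simps)
  finally show ?thesis .
qed

lemma rs_exp_superset: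
  assumes "finite E" "F \<subseteq> E"
  shows "rs_exp p E (\<lambda>X. of_bool (F \<subseteq> X)) = p ^ card F"
proof -
  have fin: "finite F" using assms finite_subset by auto
  have "rs_exp p E (\<lambda>X. of_bool (F \<subseteq> X)) = rs_exp p E (\<lambda>X. \<Prod>u\<in>F. if id u \<in> X then 1 else 0)"
  proof (intro rs_exp_cong)
    fix X
    show "of_bool (F \<subseteq> X) = (\<Prod>u\<in>F. if id u \<in> X then 1 else (0::real))"
    proof (cases "F \<subseteq> X")
      case True
      then have "(\<Prod>u\<in>F. if id u \<in> X then 1 else (0::real)) = 1"
        by (intro prod.neutral) auto
      then show ?thesis using True by simp
    next
      case False
      then show ?thesis using fin by (auto simp: subset_eq)
    qed
  qed
  also have "\<dots> = (\<Prod>u\<in>F. p * 1 + (1 - p) * 0)"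
    using assms by (intro rs_exp_prod_inj) auto
  finally show ?thesis by simp
qed

section \<open>Markov, union and Chernoff bounds\<close>

lemma rs_exp_markov:
  assumes "0 \<le> p" "p \<le> 1" "0 \<le> l"
  shows "rs_exp p E (\<lambda>X. of_bool (c \<le> Y X)) \<le> exp (- l * c) * rs_exp p E (\<lambda>X. exp (l * Y X))"
proof -
  have "rs_exp p E (\<lambda>X. of_bool (c \<le> Y X)) \<le> rs_exp p E (\<lambda>X. exp (- l * c) * exp (l * Y X))"
  proof (rule rs_exp_mono)
    fix X
    have "1 \<le> exp (l * (Y X - c))" if "c \<le> Y X"
      using that assms(3) by simp
    then show "of_bool (c \<le> Y X) \<le> exp (- l * c) * exp (l * Y X)"
      by (simp add: mult_exp_exp algebra_simps)
  qed (use assms in auto)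
  then show ?thesis by (simp add: rs_exp_cmult)
qed

lemma rs_exp_union_bound:
  assumes "0 \<le> p" "p \<le> 1" "finite I"
    and "\<And>X. X \<subseteq> E \<Longrightarrow> Q X \<Longrightarrow> \<exists>i\<in>I. P i X"
    and "\<And>i. i \<in> I \<Longrightarrow> rs_exp p E (\<lambda>X. of_bool (P i X)) \<le> b i"
  shows "rs_exp p E (\<lambda>X. of_bool (Q X)) \<le> sum b I"
proof -
  have "rs_exp p E (\<lambda>X. of_bool (Q X)) \<le> rs_exp p E (\<lambda>X. \<Sum>i\<in>I. of_bool (P i X))"
  proof (rule rs_exp_mono)
    fix X assume X: "X \<subseteq> E"
    show "of_bool (Q X) \<le> (\<Sum>i\<in>I. of_bool (P i X) :: real)"
    proof (cases "Q X")
      case True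
      then obtain i where i: "i \<in> I" "P i X" using assms(4) X by blast
      have "of_bool (P i X) \<le> (\<Sum>i\<in>I. of_bool (P i X) :: real)"
        using i assms(3) by (intro member_le_sum) auto
      then show ?thesis using i True by simp
    qed (simp add: sum_nonneg)
  qed (use assms in auto)
  also have "\<dots> \<le> sum b I"
    unfolding rs_exp_sum using assms(5) by (rule sum_mono)
  finally show ?thesis .
qed

lemma rs_exp_union_bound_const:
  assumes "0 \<le> p" "p \<le> 1" "finite I"
    and "\<And>X. X \<subseteq> E \<Longrightarrow> Q X \<Longrightarrow> \<exists>i\<in>I. P i X"
    and "\<And>i. i \<in> I \<Longrightarrow> rs_exp p E (\<lambda>X. of_bool (P i X)) \<le> b"
    and "real (card I) \<le> N" "0 \<le> b"
  shows "rs_exp p E (\<lambda>X. of_bool (Q X)) \<le> N * b"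
proof -
  have "rs_exp p E (\<lambda>X. of_bool (Q X)) \<le> (\<Sum>i\<in>I. b)"
    using assms by (intro rs_exp_union_bound[where P = P]) auto
  also have "\<dots> \<le> N * b"
    using assms by (simp add: mult_right_mono)
  finally show ?thesis .
qed

lemma prod_le_exp_sum:
  fixes f :: "'a \<Rightarrow> real"
  assumes "\<And>u. u \<in> U \<Longrightarrow> 0 \<le> f u" "\<And>u. u \<in> U \<Longrightarrow> f u \<le> 1 + v u"
  shows "prod f U \<le> exp (sum v U)"
proof (cases "finite U")
  case True
  have "prod f U \<le> (\<Prod>u\<in>U. exp (v u))"
  proof (intro prod_mono conjI)
    fix u assume u: "u \<in> U"
    show "f u \<le> exp (v u)"
      using assms(2)[OF u] exp_ge_add_one_self[of "v u"] by linarith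
  qed (use assms in auto)
  then show ?thesis using True by (simp add: exp_sum)
qed simp

text \<open>Chernoff bound before the choice of \<open>l\<close>: each factor 1 + p (exp (l f) - 1)
  of the exponential moment is at most exp (p (exp (l f) - 1)). The weights will be fibre sizes, or
  1.\<close>

lemma rs_exp_weight_ge:
  fixes f :: "'b \<Rightarrow> real"
  assumes "0 \<le> p" "p \<le> 1" "0 \<le> l" "finite E" "inj_on e U" "e ` U \<subseteq> E"
  shows "rs_exp p E (\<lambda>X. of_bool (c \<le> (\<Sum>u\<in>U. if e u \<in> X then f u else 0)))
      \<le> exp (p * (\<Sum>u\<in>U. exp (l * f u) - 1) - l * c)"
proof -
  have fin: "finite U"
    using assms by (meson finite_imageD finite_subset)
  have "rs_exp p E (\<lambda>X. of_bool (c \<le> (\<Sum>u\<in>U. if e u \<in> X then f u else 0)))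
      \<le> exp (- l * c) * rs_exp p E (\<lambda>X. exp (l * (\<Sum>u\<in>U. if e u \<in> X then f u else 0)))"
    by (rule rs_exp_markov) fact+
  also have "rs_exp p E (\<lambda>X. exp (l * (\<Sum>u\<in>U. if e u \<in> X then f u else 0)))
      = rs_exp p E (\<lambda>X. \<Prod>u\<in>U. if e u \<in> X then exp (l * f u) else 1)"
    using fin by (auto intro!: rs_exp_cong prod.cong simp: sum_distrib_left exp_sum)
  also have "\<dots> = (\<Prod>u\<in>U. p * exp (l * f u) + (1 - p) * 1)"
    using assms by (intro rs_exp_prod_inj) auto
  also have "\<dots> \<le> exp (\<Sum>u\<in>U. p * (exp (l * f u) - 1))"
    using assms(1,2) by (intro prod_le_exp_sum add_nonneg_nonneg mult_nonneg_nonneg)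
      (auto simp: algebra_simps)
  finally show ?thesis
    by (simp add: sum_distrib_left exp_diff exp_minus field_simps)
qed

section \<open>Pairs with a common neighbour in the base graph\<close>

text \<open>This is the neighbourhood of the base vertex \<open>w\<close> in the blow-up of
  \<open>X\<close> along \<psi>, cut down to \<open>Q\<close>.\<close>

definition hits :: "(nat \<Rightarrow> nat) \<Rightarrow> nat set set \<Rightarrow> nat set \<Rightarrow> nat \<Rightarrow> nat set" where
  "hits \<psi> X Q w = {x \<in> Q. {w, \<psi> x} \<in> X}"

definition hit_pairs :: "(nat \<Rightarrow> nat) \<Rightarrow> nat set set \<Rightarrow> nat set \<Rightarrow> nat \<Rightarrow> (nat \<times> nat) set" where
  "hit_pairs \<psi> X Q w = {(x, y). x \<in> hits \<psi> X Q w \<and> y \<in> hits \<psi> X Q w \<and> \<psi> x \<noteq> \<psi> y}"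

text \<open>Base vertices with \<open>T\<close> or more hits contribute 0; their pairs are bounded
  deterministically, through small codegrees.\<close>

definition light_pairs :: "real \<Rightarrow> (nat \<Rightarrow> nat) \<Rightarrow> nat set set \<Rightarrow> nat set \<Rightarrow> nat \<Rightarrow> real" where
  "light_pairs T \<psi> X Q w =
     (if real (card (hits \<psi> X Q w)) < T then real (card (hit_pairs \<psi> X Q w)) else 0)"

text \<open>For \<open>u = v\<close> this only asks for a neighbour of \<open>u\<close>, so pairs
  inside one fibre have to be counted separately.\<close>

definition linked :: "nat set set \<Rightarrow> nat \<Rightarrow> nat \<Rightarrow> bool" where
  "linked X u v \<longleftrightarrow> (\<exists>w. {u, w} \<in> X \<and> {v, w} \<in> X)"

text \<open>Bonferroni's inequality, with every pairwise intersection replaced by its bound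
  \<open>c\<close>.\<close>

lemma sum_card_le_card_UN:
  fixes c :: real
  assumes "finite W" "\<And>w. w \<in> W \<Longrightarrow> finite (A w)" "0 \<le> c"
    and "\<And>w w'. w \<in> W \<Longrightarrow> w' \<in> W \<Longrightarrow> w \<noteq> w' \<Longrightarrow> real (card (A w \<inter> A w')) \<le> c"
  shows "(\<Sum>w\<in>W. real (card (A w))) \<le> real (card (\<Union>w\<in>W. A w)) + c * (real (card W))\<^sup>2"
  using assms
proof (induction W rule: finite_induct)
  case (insert w W)
  let ?U = "\<Union>v\<in>W. A v"
  have fin: "finite (A w)" "finite ?U" using insert by auto
  have "card (A w) + card ?U = card (A w \<union> ?U) + card (A w \<inter> ?U)"
    using fin by (rule card_Un_Int)
  then have "real (card (A w)) + real (card ?U) = real (card (A w \<union> ?U)) + real (card (A w \<inter> ?U))"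
    by linarith
  moreover have "real (card (A w \<inter> ?U)) \<le> c * card W"
  proof -
    have "A w \<inter> ?U = (\<Union>v\<in>W. A w \<inter> A v)" by auto
    then have "card (A w \<inter> ?U) \<le> (\<Sum>v\<in>W. card (A w \<inter> A v))"
      using card_UN_le[OF insert.hyps(1), of "\<lambda>v. A w \<inter> A v"] by simp
    then have "real (card (A w \<inter> ?U)) \<le> real (\<Sum>v\<in>W. card (A w \<inter> A v))"
      by (rule of_nat_mono)
    also have "\<dots> = (\<Sum>v\<in>W. real (card (A w \<inter> A v)))" by simp
    also have "\<dots> \<le> (\<Sum>v\<in>W. c)"
      using insert by (intro sum_mono) auto
    finally show ?thesis by (simp add: mult.commute)
  qed
  moreover have "(\<Sum>w\<in>W. real (card (A w))) \<le> real (card ?U) + c * (real (card W))\<^sup>2"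
    using insert by auto
  moreover have 1: "real (card (\<Union>v\<in>insert w W. A v)) = real (card (A w \<union> ?U))" by simp
  moreover have 2: "(\<Sum>v\<in>insert w W. real (card (A v))) = real (card (A w)) + (\<Sum>v\<in>W. real (card (A v)))"
    "real (card (insert w W)) = real (card W) + 1"
    using insert.hyps by simp_all
  moreover have "c * (real (card W))\<^sup>2 + c * card W \<le> c * (real (card W) + 1)\<^sup>2"
    using insert.prems by (simp add: power2_eq_square algebra_simps)
  ultimately show ?case unfolding 1 2 by linarith
qed simp

text \<open>Large, almost disjoint sets do not fit into \<open>Q\<close>. Bonferroni is applied to
  just over 2 k / T of them, since for the whole of \<open>W\<close> the quadratic error term would
  not be under control.\<close>

lemma card_heavy_le:
  fixes c k T :: real
  assumes "finite W" "finite Q" "\<And>w. w \<in> W \<Longrightarrow> A w \<subseteq> Q" "0 \<le> c" "0 < T" "real (card Q) \<le> k"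
    and inter: "\<And>w w'. w \<in> W \<Longrightarrow> w' \<in> W \<Longrightarrow> w \<noteq> w' \<Longrightarrow> real (card (A w \<inter> A w')) \<le> c"
    and heavy: "\<And>w. w \<in> W \<Longrightarrow> T \<le> real (card (A w))"
    and small: "c * (2 * k / T + 1)\<^sup>2 \<le> k"
  shows "real (card W) \<le> 2 * k / T"
proof (rule ccontr)
  assume nle: "\<not> ?thesis"
  define h where "h = nat \<lfloor>2 * k / T\<rfloor> + 1"
  have k0: "0 \<le> k" using assms(6) by linarith
  then have pos: "0 \<le> 2 * k / T" using assms(5) by simp
  then have h: "2 * k / T < real h" "real h \<le> 2 * k / T + 1"
    unfolding h_def by linarith+
  have "h \<le> card W"
    using nle pos unfolding h_def by linarith
  then obtain V where V: "V \<subseteq> W" "card V = h"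
    by (meson obtain_subset_with_card_n)
  have fA: "finite (A w)" if "w \<in> W" for w using assms that finite_subset by metis
  have "real h * T \<le> (\<Sum>w\<in>V. real (card (A w)))"
    using V heavy sum_mono[of V "\<lambda>_. T" "\<lambda>w. real (card (A w))"] by auto
  also have "\<dots> \<le> real (card (\<Union>w\<in>V. A w)) + c * (real (card V))\<^sup>2"
    using V(1) fA inter assms(4) finite_subset[OF V(1) assms(1)]
    by (intro sum_card_le_card_UN) (auto simp: subset_iff)
  also have "real (card (\<Union>w\<in>V. A w)) \<le> k"
  proof -
    have "card (\<Union>w\<in>V. A w) \<le> card Q"
      using V assms by (intro card_mono) auto
    then show ?thesis using assms(6) by linarith
  qed
  also have "c * (real (card V))\<^sup>2 \<le> c * (2 * k / T + 1)\<^sup>2"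
    using V h assms(4) by (intro mult_left_mono power_mono) auto
  finally have "real h * T \<le> 2 * k" using small by linarith
  moreover have "2 * k < real h * T"
    using h(1) assms(5) by (simp add: field_simps)
  ultimately show False by linarith
qed

lemma card_fibres_le:
  fixes F :: real
  assumes "finite U" "finite Q" "\<And>u. u \<in> U \<Longrightarrow> real (card {x \<in> Q. \<psi> x = u}) \<le> F"
  shows "real (card {x \<in> Q. \<psi> x \<in> U}) \<le> F * real (card U)"
proof -
  have "{x \<in> Q. \<psi> x \<in> U} = (\<Union>u\<in>U. {x \<in> Q. \<psi> x = u})" by auto
  then have "card {x \<in> Q. \<psi> x \<in> U} \<le> (\<Sum>u\<in>U. card {x \<in> Q. \<psi> x = u})"
    using card_UN_le[OF assms(1)] by simp
  then have "real (card {x \<in> Q. \<psi> x \<in> U}) \<le> real (\<Sum>u\<in>U. card {x \<in> Q. \<psi> x = u})"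
    by (rule of_nat_mono)
  also have "\<dots> = (\<Sum>u\<in>U. real (card {x \<in> Q. \<psi> x = u}))" by simp
  also have "\<dots> \<le> (\<Sum>u\<in>U. F)" using assms by (intro sum_mono) auto
  finally show ?thesis by (simp add: mult.commute)
qed

lemma finite_hits: "finite Q \<Longrightarrow> finite (hits \<psi> X Q w)"
  by (simp add: hits_def)

lemma hit_pairs_subset: "hit_pairs \<psi> X Q w \<subseteq> hits \<psi> X Q w \<times> hits \<psi> X Q w"
  by (auto simp: hit_pairs_def)

lemma card_hit_pairs_le:
  assumes "finite Q"
  shows "real (card (hit_pairs \<psi> X Q w)) \<le> real (card (hits \<psi> X Q w)) * real (card (hits \<psi> X Q w))"
proof -
  have "card (hit_pairs \<psi> X Q w) \<le> card (hits \<psi> X Q w \<times> hits \<psi> X Q w)"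
    by (rule card_mono) (use hit_pairs_subset finite_hits[OF assms] in auto)
  then show ?thesis by (simp add: card_cartesian_product flip: of_nat_mult)
qed

text \<open>The vertices \<open>w\<close> are split by the number \<open>d w\<close> of elements of \<open>Q\<close> they hit: few have
  \<open>d w \<ge> \<eta> k\<close>, and these together see only few fibres, whence the term with \<open>\<psi> ` K\<close>; those with
  \<open>T \<le> d w < \<eta> k\<close> hit almost disjoint sets; the rest is controlled by \<open>light\<close> and, inside
  \<open>\<psi> ` Q\<close>, by \<open>inner\<close>.\<close>

lemma card_linked_pairs_le:
  fixes k F D \<Delta> s T \<eta> L :: real
  assumes K: "finite K" "Q \<subseteq> K" "real (card K) = k"
    and M: "finite M" "\<psi> ` K \<subseteq> M" "X \<subseteq> nsets M 2"
    and fibre: "\<And>u. real (card {x \<in> K. \<psi> x = u}) \<le> F"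
    and deg: "\<And>w. w \<in> M \<Longrightarrow> real (card {u. {w, u} \<in> X}) \<le> \<Delta>"
    and wdeg: "\<And>w. w \<in> M \<Longrightarrow> real (card (hits \<psi> X K w)) \<le> D"
    and codeg: "\<And>w w'. w \<in> M \<Longrightarrow> w' \<in> M \<Longrightarrow> w \<noteq> w' \<Longrightarrow>
          real (card {u. {w, u} \<in> X \<and> {w', u} \<in> X}) \<le> s"
    and inner: "(\<Sum>w\<in>\<psi> ` Q. real (card {u \<in> \<psi> ` Q. {w, u} \<in> X})) \<le> 8 * k * L"
    and light: "(\<Sum>w\<in>M - \<psi> ` Q. light_pairs T \<psi> X Q w) \<le> \<eta> * k\<^sup>2"
    and par: "0 < \<eta>" "\<eta> \<le> 1" "0 < T" "T \<le> \<eta> * k" "8 * L * F * T \<le> \<eta> * k" "0 \<le> s" "0 \<le> F"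
      "D \<le> k" "F \<le> \<eta> * k" "2 / \<eta> * \<Delta> \<le> \<eta> * k" "s * F * (2 * k / T + 1)\<^sup>2 \<le> \<eta> * k"
  shows "real (card {(x, y) \<in> Q \<times> Q. linked X (\<psi> x) (\<psi> y)})
      \<le> D * (k - real (card (\<psi> ` K))) + 7 * \<eta> * k\<^sup>2"
proof -
  define d where "d w = real (card (hits \<psi> X Q w))" for w
  define e where "e w = real (card (hit_pairs \<psi> X Q w))" for w
  have finQ: "finite Q" using K finite_subset by auto
  have "0 < \<eta> * k" using par by linarith
  then have k0: "0 < k" using par by (simp add: zero_less_mult_iff)
  have cQ: "real (card Q) \<le> k" using K card_mono by fastforce
  have d0: "0 \<le> d w" for w by (simp add: d_def)
  have e_le: "e w \<le> d w * d w" for w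
    unfolding e_def d_def by (rule card_hit_pairs_le[OF finQ])
  have finX: "finite {u. {w, u} \<in> X}" for w
  proof (rule finite_subset)
    show "{u. {w, u} \<in> X} \<subseteq> M" using M(3) by auto
  qed (fact M(1))
  have fibQ: "real (card {x \<in> Q. \<psi> x \<in> U}) \<le> F * real (card U)" if "finite U" for U
  proof (rule card_fibres_le[OF that finQ])
    fix u
    have "card {x \<in> Q. \<psi> x = u} \<le> card {x \<in> K. \<psi> x = u}"
      using K by (intro card_mono) auto
    then show "real (card {x \<in> Q. \<psi> x = u}) \<le> F" using fibre[of u] by linarith
  qed
  have dD: "d w \<le> D" if "w \<in> M" for w
  proof -
    have "card (hits \<psi> X Q w) \<le> card (hits \<psi> X K w)"
      using K by (intro card_mono finite_hits) (auto simp: hits_def)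
    then show ?thesis using wdeg[OF that] by (simp add: d_def)
  qed
  have inter: "real (card (hits \<psi> X Q w \<inter> hits \<psi> X Q w')) \<le> s * F"
    if "w \<in> M" "w' \<in> M" "w \<noteq> w'" for w w'
  proof -
    have fin: "finite {u. {w, u} \<in> X \<and> {w', u} \<in> X}"
      by (rule finite_subset[OF _ finX[of w]]) auto
    have "hits \<psi> X Q w \<inter> hits \<psi> X Q w' = {x \<in> Q. \<psi> x \<in> {u. {w, u} \<in> X \<and> {w', u} \<in> X}}"
      by (auto simp: hits_def)
    then have "real (card (hits \<psi> X Q w \<inter> hits \<psi> X Q w'))
        \<le> F * real (card {u. {w, u} \<in> X \<and> {w', u} \<in> X})"
      using fibQ[OF fin] by simp
    also have "\<dots> \<le> F * s" using codeg[OF that] par by (intro mult_left_mono) auto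
    finally show ?thesis by (simp add: mult.commute)
  qed
  have sF: "0 \<le> s * F" using par by simp
  have ek: "\<eta> * k \<le> k" using par k0 by simp
  \<comment> \<open>The threshold \<open>t\<close> is kept variable: \<open>T\<close> is used for
    the middle class \<open>I\<close> and \<eta> k for the heavy class \<open>H\<close>.\<close>
  have heavy: "real (card W) \<le> 2 * k / t \<and> (\<Sum>w\<in>W. d w) \<le> real (card (\<Union>w\<in>W. hits \<psi> X Q w)) + \<eta> * k"
    if W: "W \<subseteq> M" "\<And>w. w \<in> W \<Longrightarrow> t \<le> d w" and t: "T \<le> t" for W t
  proof -
    have fW: "finite W" using W M finite_subset by auto
    have t0: "0 < t" using t par by linarith
    have "s * F * (2 * k / t + 1)\<^sup>2 \<le> s * F * (2 * k / T + 1)\<^sup>2"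
      using sF t t0 k0 par by (intro mult_left_mono power_mono add_right_mono divide_left_mono) auto
    then have small: "s * F * (2 * k / t + 1)\<^sup>2 \<le> \<eta> * k" using par by linarith
    have 1: "real (card W) \<le> 2 * k / t"
    proof (rule card_heavy_le[where Q = Q and A = "hits \<psi> X Q" and c = "s * F"])
      show "s * F * (2 * k / t + 1)\<^sup>2 \<le> k" using small ek by linarith
    qed (use fW finQ cQ sF t0 inter W in \<open>auto simp: hits_def d_def\<close>)
    have "(\<Sum>w\<in>W. d w) \<le> real (card (\<Union>w\<in>W. hits \<psi> X Q w)) + s * F * (real (card W))\<^sup>2"
      unfolding d_def using fW finQ sF inter W
      by (intro sum_card_le_card_UN finite_hits) auto
    also have "s * F * (real (card W))\<^sup>2 \<le> s * F * (2 * k / t + 1)\<^sup>2"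
      using sF 1 by (intro mult_left_mono power_mono) auto
    finally show ?thesis using 1 small by linarith
  qed
  define H where "H = {w \<in> M. \<eta> * k \<le> d w}"
  define I where "I = {w \<in> M. T \<le> d w \<and> d w < \<eta> * k}"
  define J where "J = {w \<in> M. d w < T}"
  define S where "S = \<psi> ` Q"
  have fin: "finite H" "finite I" "finite J" "finite S"
    using M finQ by (auto simp: H_def I_def J_def S_def)
  \<comment> \<open>In units of \<eta> k^2 the error 7 is made up of 1 for pairs in a common fibre
    and 2 for each of \<open>H\<close>, \<open>I\<close> and \<open>J\<close>.\<close>
  have "{(x, y) \<in> Q \<times> Q. linked X (\<psi> x) (\<psi> y)}
      \<subseteq> (SIGMA x:Q. {y \<in> Q. \<psi> y = \<psi> x}) \<union> (\<Union>w\<in>H \<union> I \<union> J. hit_pairs \<psi> X Q w)"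
  proof
    fix z assume "z \<in> {(x, y) \<in> Q \<times> Q. linked X (\<psi> x) (\<psi> y)}"
    then obtain x y w where a: "z = (x, y)" "x \<in> Q" "y \<in> Q" "{\<psi> x, w} \<in> X" "{\<psi> y, w} \<in> X"
      by (auto simp: linked_def)
    have "w \<in> M" using a M(3) by auto
    then have "w \<in> H \<union> I \<union> J" by (auto simp: H_def I_def J_def)
    moreover have "(x, y) \<in> hit_pairs \<psi> X Q w" if "\<psi> y \<noteq> \<psi> x"
      using a that by (auto simp: hit_pairs_def hits_def insert_commute)
    ultimately show "z \<in> (SIGMA x:Q. {y \<in> Q. \<psi> y = \<psi> x}) \<union> (\<Union>w\<in>H \<union> I \<union> J. hit_pairs \<psi> X Q w)"
      using a by blast
  qed
  moreover have finp: "finite (hit_pairs \<psi> X Q w)" for w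
    using hit_pairs_subset finite_hits[OF finQ] by (meson finite_SigmaI finite_subset)
  ultimately have "card {(x, y) \<in> Q \<times> Q. linked X (\<psi> x) (\<psi> y)}
      \<le> card ((SIGMA x:Q. {y \<in> Q. \<psi> y = \<psi> x}) \<union> (\<Union>w\<in>H \<union> I \<union> J. hit_pairs \<psi> X Q w))"
    using finQ fin by (intro card_mono) auto
  also have "\<dots> \<le> card (SIGMA x:Q. {y \<in> Q. \<psi> y = \<psi> x}) + card (\<Union>w\<in>H \<union> I \<union> J. hit_pairs \<psi> X Q w)"
    by (rule card_Un_le)
  also have "card (\<Union>w\<in>H \<union> I \<union> J. hit_pairs \<psi> X Q w) \<le> (\<Sum>w\<in>H \<union> I \<union> J. card (hit_pairs \<psi> X Q w))"
    using fin by (intro card_UN_le) auto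
  finally have "card {(x, y) \<in> Q \<times> Q. linked X (\<psi> x) (\<psi> y)}
      \<le> card (SIGMA x:Q. {y \<in> Q. \<psi> y = \<psi> x}) + (\<Sum>w\<in>H \<union> I \<union> J. card (hit_pairs \<psi> X Q w))"
    by simp
  then have "real (card {(x, y) \<in> Q \<times> Q. linked X (\<psi> x) (\<psi> y)})
      \<le> real (card (SIGMA x:Q. {y \<in> Q. \<psi> y = \<psi> x})) + (\<Sum>w\<in>H \<union> I \<union> J. e w)"
    unfolding e_def by (simp flip: of_nat_sum of_nat_add del: card_SigmaI)
  moreover have "real (card (SIGMA x:Q. {y \<in> Q. \<psi> y = \<psi> x})) \<le> \<eta> * k\<^sup>2"
  proof -
    have "real (card (SIGMA x:Q. {y \<in> Q. \<psi> y = \<psi> x})) = (\<Sum>x\<in>Q. real (card {y \<in> Q. \<psi> y = \<psi> x}))"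
      using finQ by simp
    also have "\<dots> \<le> (\<Sum>x\<in>Q. F)"
    proof (rule sum_mono)
      fix x
      show "real (card {y \<in> Q. \<psi> y = \<psi> x}) \<le> F"
        using fibQ[of "{\<psi> x}"] by simp
    qed
    also have "\<dots> \<le> k * F" using cQ par by (simp add: mult_right_mono)
    also have "\<dots> \<le> k * (\<eta> * k)" using par k0 by (intro mult_left_mono) auto
    finally show ?thesis by (simp add: power2_eq_square algebra_simps)
  qed
  moreover have "(\<Sum>w\<in>H \<union> I \<union> J. e w) = (\<Sum>w\<in>H. e w) + (\<Sum>w\<in>I. e w) + (\<Sum>w\<in>J. e w)"
  proof -
    have "H \<inter> I = {}" "(H \<union> I) \<inter> J = {}"
      using par by (auto simp: H_def I_def J_def)
    then show ?thesis using fin by (simp add: sum.union_disjoint)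
  qed
  moreover have "(\<Sum>w\<in>I. e w) \<le> 2 * \<eta> * k\<^sup>2"
  proof -
    have "(\<Sum>w\<in>I. e w) \<le> (\<Sum>w\<in>I. \<eta> * k * d w)"
    proof (rule sum_mono)
      fix w assume "w \<in> I"
      then have "d w * d w \<le> \<eta> * k * d w" using d0 by (intro mult_right_mono) (auto simp: I_def)
      then show "e w \<le> \<eta> * k * d w" using e_le[of w] by linarith
    qed
    also have "\<dots> = \<eta> * k * (\<Sum>w\<in>I. d w)" by (simp add: sum_distrib_left)
    also have "\<dots> \<le> \<eta> * k * (2 * k)"
    proof (rule mult_left_mono)
      have "card (\<Union>w\<in>I. hits \<psi> X Q w) \<le> card Q"
        using finQ by (intro card_mono) (auto simp: hits_def)
      then show "(\<Sum>w\<in>I. d w) \<le> 2 * k"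
        using heavy[of I T] ek cQ unfolding I_def by fastforce
    qed (use par k0 in auto)
    finally show ?thesis by (simp add: power2_eq_square)
  qed
  moreover have "(\<Sum>w\<in>J. e w) \<le> 2 * \<eta> * k\<^sup>2"
  proof -
    \<comment> \<open>For \<open>w\<close> inside \<open>S\<close> the stars from \<open>w\<close>
      into \<open>S\<close> overlap in edges and are not independent, so the number of edges inside
      \<open>S\<close> is used there; the moment bound covers the \<open>w\<close> outside
      \<open>S\<close>.\<close>
    have "(\<Sum>w\<in>J. e w) = (\<Sum>w\<in>J \<inter> S. e w) + (\<Sum>w\<in>J - S. e w)"
      using fin by (simp add: sum.Int_Diff)
    moreover have "(\<Sum>w\<in>J - S. e w) \<le> \<eta> * k\<^sup>2"
    proof -
      have "(\<Sum>w\<in>J - S. e w) = (\<Sum>w\<in>J - S. light_pairs T \<psi> X Q w)"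
        by (intro sum.cong) (auto simp: J_def light_pairs_def d_def e_def)
      also have "\<dots> \<le> (\<Sum>w\<in>M - S. light_pairs T \<psi> X Q w)"
        using M(1) by (intro sum_mono2) (auto simp: J_def light_pairs_def)
      finally show ?thesis using light by (simp add: S_def)
    qed
    moreover have "(\<Sum>w\<in>J \<inter> S. e w) \<le> \<eta> * k\<^sup>2"
    proof -
      have "(\<Sum>w\<in>J \<inter> S. e w) \<le> (\<Sum>w\<in>J \<inter> S. T * (F * real (card {u \<in> S. {w, u} \<in> X})))"
      proof (rule sum_mono)
        fix w assume w: "w \<in> J \<inter> S"
        have "hits \<psi> X Q w = {x \<in> Q. \<psi> x \<in> {u \<in> S. {w, u} \<in> X}}"
          by (auto simp: hits_def S_def)
        then have "d w \<le> F * real (card {u \<in> S. {w, u} \<in> X})"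
          using fibQ[of "{u \<in> S. {w, u} \<in> X}"] fin by (simp add: d_def)
        then have "T * d w \<le> T * (F * real (card {u \<in> S. {w, u} \<in> X}))"
          using par by (intro mult_left_mono) auto
        moreover have "d w * d w \<le> T * d w"
          using w d0 by (intro mult_right_mono) (auto simp: J_def)
        ultimately show "e w \<le> T * (F * real (card {u \<in> S. {w, u} \<in> X}))"
          using e_le[of w] by linarith
      qed
      also have "\<dots> \<le> (\<Sum>w\<in>S. T * (F * real (card {u \<in> S. {w, u} \<in> X})))"
        using fin par by (intro sum_mono2) auto
      also have "\<dots> = T * F * (\<Sum>w\<in>S. real (card {u \<in> S. {w, u} \<in> X}))"
        by (simp add: sum_distrib_left mult.assoc)
      also have "\<dots> \<le> T * F * (8 * k * L)"
        using inner par by (intro mult_left_mono) (auto simp: S_def)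
      also have "\<dots> = k * (8 * L * F * T)" by simp
      also have "\<dots> \<le> k * (\<eta> * k)" using par k0 by (intro mult_left_mono) auto
      finally show ?thesis by (simp add: power2_eq_square algebra_simps)
    qed
    ultimately show ?thesis by linarith
  qed
  moreover have "(\<Sum>w\<in>H. e w) \<le> D * (k - real (card (\<psi> ` K))) + 2 * \<eta> * k\<^sup>2"
  proof (cases "H = {}")
    case True
    have "card (\<psi> ` K) \<le> card K" using K by (intro card_image_le)
    moreover have "0 \<le> D"
    proof (cases "K = {}")
      case True then show ?thesis using K k0 by simp
    next
      case False
      then obtain x where "x \<in> K" by auto
      then have "\<psi> x \<in> M" using M by auto
      then show ?thesis using wdeg[of "\<psi> x"] by linarith
    qed
    ultimately show ?thesis using True K(3) par by simp
  next
    case False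
    then obtain w0 where "w0 \<in> M" by (auto simp: H_def)
    then have D0: "0 \<le> D" using wdeg[of w0] by linarith
    have h: "real (card H) \<le> 2 / \<eta>"
      "(\<Sum>w\<in>H. d w) \<le> real (card (\<Union>w\<in>H. hits \<psi> X Q w)) + \<eta> * k"
    proof -
      have H: "H \<subseteq> M" "\<And>w. w \<in> H \<Longrightarrow> \<eta> * k \<le> d w" by (auto simp: H_def)
      have "2 * k / (\<eta> * k) = 2 / \<eta>" using k0 by simp
      then show "real (card H) \<le> 2 / \<eta>"
        "(\<Sum>w\<in>H. d w) \<le> real (card (\<Union>w\<in>H. hits \<psi> X Q w)) + \<eta> * k"
        using heavy[of H "\<eta> * k", OF H par(4)] by simp_all
    qed
    \<comment> \<open>The elements of \<open>K\<close> over \<open>Z\<close> have at most \<eta> k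
      images altogether. Hence all but \<eta> k of them are paid for by the deficit of the image of
      \<open>K\<close>, which bounds the total number of hits of \<open>H\<close>.\<close>
    define Z where "Z = (\<Union>w\<in>H. {u. {w, u} \<in> X})"
    have finZ: "finite Z" using fin finX by (auto simp: Z_def)
    have "real (card Z) \<le> (\<Sum>w\<in>H. real (card {u. {w, u} \<in> X}))"
      unfolding Z_def of_nat_sum[symmetric] by (intro of_nat_mono card_UN_le fin)
    also have "\<dots> \<le> (\<Sum>w\<in>H. \<Delta>)" using deg by (intro sum_mono) (auto simp: H_def)
    also have "\<dots> \<le> 2 / \<eta> * \<Delta>"
    proof -
      have "0 \<le> \<Delta>" using deg[OF \<open>w0 \<in> M\<close>] by linarith
      then show ?thesis using mult_right_mono[OF h(1)] by simp
    qed
    finally have cZ: "real (card Z) \<le> \<eta> * k" using par by linarith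
    have "card (\<Union>w\<in>H. hits \<psi> X Q w) \<le> card {x \<in> K. \<psi> x \<in> Z}"
      using K by (intro card_mono) (auto simp: hits_def Z_def)
    moreover have "card K = card {x \<in> K. \<psi> x \<in> Z} + card {x \<in> K. \<psi> x \<notin> Z}"
    proof -
      have "K = {x \<in> K. \<psi> x \<in> Z} \<union> {x \<in> K. \<psi> x \<notin> Z}" by auto
      then show ?thesis
        using K(1) card_Un_disjoint[of "{x \<in> K. \<psi> x \<in> Z}" "{x \<in> K. \<psi> x \<notin> Z}"] by auto
    qed
    moreover have "card (\<psi> ` K) \<le> card Z + card {x \<in> K. \<psi> x \<notin> Z}"
    proof -
      have "\<psi> ` K \<subseteq> Z \<union> \<psi> ` {x \<in> K. \<psi> x \<notin> Z}" by auto
      then have "card (\<psi> ` K) \<le> card (Z \<union> \<psi> ` {x \<in> K. \<psi> x \<notin> Z})"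
        using K finZ by (intro card_mono) auto
      also have "\<dots> \<le> card Z + card (\<psi> ` {x \<in> K. \<psi> x \<notin> Z})" by (rule card_Un_le)
      also have "card (\<psi> ` {x \<in> K. \<psi> x \<notin> Z}) \<le> card {x \<in> K. \<psi> x \<notin> Z}"
        using K by (intro card_image_le) auto
      finally show ?thesis by simp
    qed
    ultimately have y: "(\<Sum>w\<in>H. d w) \<le> k - real (card (\<psi> ` K)) + 2 * \<eta> * k"
      using h(2) cZ K(3) by linarith
    have "(\<Sum>w\<in>H. e w) \<le> (\<Sum>w\<in>H. D * d w)"
    proof (rule sum_mono)
      fix w assume "w \<in> H"
      then have "d w * d w \<le> D * d w" using d0 dD by (intro mult_right_mono) (auto simp: H_def)
      then show "e w \<le> D * d w" using e_le[of w] by linarith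
    qed
    also have "\<dots> = D * (\<Sum>w\<in>H. d w)" by (simp add: sum_distrib_left)
    also have "\<dots> \<le> D * (k - real (card (\<psi> ` K)) + 2 * \<eta> * k)"
      using y D0 by (rule mult_left_mono)
    also have "\<dots> = D * (k - real (card (\<psi> ` K))) + D * (2 * \<eta> * k)" by (simp add: algebra_simps)
    also have "D * (2 * \<eta> * k) \<le> k * (2 * \<eta> * k)"
      using par k0 by (intro mult_right_mono) auto
    finally show ?thesis by (simp add: power2_eq_square algebra_simps)
  qed
  ultimately show ?thesis by linarith
qed

section \<open>Tail bounds for random base graphs\<close>

lemma binomial_le_power: "n choose r \<le> n ^ r"
proof -
  have "(n choose r) * 1 \<le> (n choose r) * fact r"
    by (intro mult_le_mono2) (simp add: Suc_leI)
  then show ?thesis using binomial_fact_pow[of n r] by linarith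
qed

text \<open>Term by term comparison with the binomial expansion of the right-hand side, whose j-th
  term has the additional factor \<open>k choose j\<close>.\<close>

lemma card_small_subsets_le:
  assumes "finite A"
  shows "card {S. S \<subseteq> A \<and> card S \<le> k} \<le> (card A + 1) ^ k"
proof -
  have "{S. S \<subseteq> A \<and> card S \<le> k} = (\<Union>j\<in>{..k}. nsets A j)"
    using assms finite_subset by (auto simp: nsets_def)
  then have "card {S. S \<subseteq> A \<and> card S \<le> k} \<le> (\<Sum>j\<le>k. card (nsets A j))"
    using card_UN_le[of "{..k}" "nsets A"] by simp
  also have "\<dots> \<le> (\<Sum>j\<le>k. (k choose j) * card A ^ j * 1 ^ (k - j))"
  proof (rule sum_mono)
    fix j assume "j \<in> {..k}"
    then have "1 \<le> k choose j" by (simp add: Suc_leI)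
    then have "card A ^ j \<le> (k choose j) * card A ^ j" by simp
    then show "card (nsets A j) \<le> (k choose j) * card A ^ j * 1 ^ (k - j)"
      using binomial_le_power[of "card A" j] unfolding card_nsets power_one mult_1_right by (rule le_trans[rotated])
  qed
  also have "\<dots> = (card A + 1) ^ k"
    using binomial[of "card A" 1 k] by simp
  finally show ?thesis .
qed

lemma inj_doubleton: "inj_on (\<lambda>u. {w, u}) A"
  by (auto simp: inj_on_def doubleton_eq_iff)

text \<open>First moment over the ordered pairs and \<open>s\<close> common neighbours. Neither
  \<open>w\<close> nor \<open>w'\<close> lies in the chosen set \<open>U\<close>, so the 2 s edges
  are distinct.\<close>

lemma codegree_tail:
  assumes "finite M" "0 \<le> p" "p \<le> 1"
  shows "rs_exp p (nsets M 2)
      (\<lambda>X. of_bool (\<exists>w\<in>M. \<exists>w'\<in>M. w \<noteq> w' \<and> s \<le> card {u. {w, u} \<in> X \<and> {w', u} \<in> X}))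
    \<le> real (card M) ^ 2 * (real (card M) * p\<^sup>2) ^ s"
proof -
  define I where "I = (SIGMA w:M. SIGMA w':M - {w}. nsets (M - {w, w'}) s)"
  define F where "F = (\<lambda>(w, w', U). (\<lambda>u. {w, u}) ` U \<union> (\<lambda>u. {w', u}) ` U :: 'a set set)"
  have finI: "finite I"
    unfolding I_def using assms by (intro finite_SigmaI finite_imp_finite_nsets) auto
  have "I \<subseteq> M \<times> M \<times> nsets M s"
    unfolding I_def by (auto simp: nsets_def)
  then have "card I \<le> card (M \<times> M \<times> nsets M s)"
    using assms by (intro card_mono) (auto simp: finite_imp_finite_nsets)
  also have "\<dots> \<le> card M * (card M * card M ^ s)"
    using binomial_le_power[of "card M" s] by (simp add: card_cartesian_product)
  finally have cI: "real (card I) \<le> real (card M) ^ 2 * real (card M) ^ s"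
    by (simp add: power2_eq_square mult.assoc flip: of_nat_mult of_nat_power)
  have "rs_exp p (nsets M 2)
      (\<lambda>X. of_bool (\<exists>w\<in>M. \<exists>w'\<in>M. w \<noteq> w' \<and> s \<le> card {u. {w, u} \<in> X \<and> {w', u} \<in> X}))
    \<le> (real (card M) ^ 2 * real (card M) ^ s) * p ^ (2 * s)"
  proof (rule rs_exp_union_bound_const[where I = I and P = "\<lambda>i X. F i \<subseteq> X"])
    fix X assume X: "X \<subseteq> nsets M 2"
      and "\<exists>w\<in>M. \<exists>w'\<in>M. w \<noteq> w' \<and> s \<le> card {u. {w, u} \<in> X \<and> {w', u} \<in> X}"
    then obtain w w' where w: "w \<in> M" "w' \<in> M" "w \<noteq> w'" "s \<le> card {u. {w, u} \<in> X \<and> {w', u} \<in> X}"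
      by blast
    then obtain U where U: "U \<subseteq> {u. {w, u} \<in> X \<and> {w', u} \<in> X}" "card U = s"
      by (meson obtain_subset_with_card_n)
    have "U \<subseteq> M - {w, w'}"
    proof
      fix u assume "u \<in> U"
      then have "{w, u} \<in> nsets M 2" "{w', u} \<in> nsets M 2" using U X by blast+
      then show "u \<in> M - {w, w'}" unfolding doubleton_in_nsets_2 by blast
    qed
    moreover from this have "finite U" using assms finite_subset by (meson finite_Diff)
    ultimately have "(w, w', U) \<in> I" using w U by (auto simp: I_def nsets_def)
    moreover have "F (w, w', U) \<subseteq> X" using U by (auto simp: F_def)
    ultimately show "\<exists>i\<in>I. F i \<subseteq> X" by blast
  next
    fix i assume "i \<in> I"
    then obtain w w' U where i: "i = (w, w', U)" "w \<in> M" "w' \<in> M" "w' \<noteq> w"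
      "U \<subseteq> M - {w, w'}" "finite U" "card U = s"
      by (auto simp: I_def nsets_def)
    have "F i \<subseteq> nsets M 2"
      using i by (auto simp: F_def)
    moreover have "card (F i) = 2 * s"
    proof -
      have "(\<lambda>u. {w, u}) ` U \<inter> (\<lambda>u. {w', u}) ` U = {}"
        using i by (auto simp: doubleton_eq_iff)
      then have "card (F i) = card ((\<lambda>u. {w, u}) ` U) + card ((\<lambda>u. {w', u}) ` U)"
        using i by (simp add: F_def card_Un_disjoint)
      then show ?thesis using i by (simp add: card_image inj_doubleton)
    qed
    ultimately show "rs_exp p (nsets M 2) (\<lambda>X. of_bool (F i \<subseteq> X)) \<le> p ^ (2 * s)"
      using rs_exp_superset[of "nsets M 2" "F i" p] assms by (simp add: finite_imp_finite_nsets)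
  qed (use assms finI cI in auto)
  then show ?thesis by (simp add: power_mult_distrib power_mult mult.assoc)
qed

text \<open>Chernoff bound with exponent \<eta> / F: no weight exceeds \<open>F\<close>, so each
  exponent y is at most \<eta>, where exp y <= 1 + (1 + \<eta>) y. Constant weights give degrees in
  the base graph, fibre sizes give degrees in the blow-up.\<close>

lemma weighted_degree_tail:
  fixes f :: "'a \<Rightarrow> real"
  assumes "finite M" "w \<in> M" "0 \<le> p" "p \<le> 1" "0 < F" "0 < \<eta>" "\<eta> \<le> 1"
    and f: "\<And>u. u \<in> M \<Longrightarrow> 0 \<le> f u" "\<And>u. u \<in> M \<Longrightarrow> f u \<le> F" "sum f M \<le> N"
  shows "rs_exp p (nsets M 2)
      (\<lambda>X. of_bool ((1 + 2 * \<eta>) * (p * N) \<le> (\<Sum>u\<in>M - {w}. if {w, u} \<in> X then f u else 0)))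
    \<le> exp (- (\<eta>\<^sup>2 * p * N / F))"
proof -
  have "rs_exp p (nsets M 2)
      (\<lambda>X. of_bool ((1 + 2 * \<eta>) * (p * N) \<le> (\<Sum>u\<in>M - {w}. if {w, u} \<in> X then f u else 0)))
    \<le> exp (p * (\<Sum>u\<in>M - {w}. exp (\<eta> / F * f u) - 1) - \<eta> / F * ((1 + 2 * \<eta>) * (p * N)))"
    using assms by (intro rs_exp_weight_ge) (auto simp: finite_imp_finite_nsets inj_doubleton)
  also have "\<dots> \<le> exp (- (\<eta>\<^sup>2 * p * N / F))"
  proof -
    have "(\<Sum>u\<in>M - {w}. exp (\<eta> / F * f u) - 1) \<le> (\<Sum>u\<in>M - {w}. \<eta> / F * (1 + \<eta>) * f u)"
    proof (rule sum_mono)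
      fix u assume u: "u \<in> M - {w}"
      define y where "y = \<eta> / F * f u"
      have y: "0 \<le> y" "y \<le> \<eta>"
        using u assms f(1,2)[of u] by (auto simp: y_def field_simps intro!: mult_left_mono)
      then have "exp y \<le> 1 + y + y\<^sup>2" using assms by (intro exp_bound) auto
      also have "y\<^sup>2 \<le> \<eta> * y" using y by (simp add: power2_eq_square mult_right_mono)
      finally show "exp (\<eta> / F * f u) - 1 \<le> \<eta> / F * (1 + \<eta>) * f u"
        by (simp add: y_def algebra_simps add_divide_distrib)
    qed
    also have "\<dots> = \<eta> / F * (1 + \<eta>) * sum f (M - {w})" by (simp add: sum_distrib_left)
    also have "\<dots> \<le> \<eta> / F * (1 + \<eta>) * N"
    proof (rule mult_left_mono)
      have "sum f (M - {w}) \<le> sum f M" using assms by (intro sum_mono2) auto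
      then show "sum f (M - {w}) \<le> N" using f(3) by linarith
    qed (use assms in auto)
    finally have "p * (\<Sum>u\<in>M - {w}. exp (\<eta> / F * f u) - 1) \<le> p * (\<eta> / F * (1 + \<eta>) * N)"
      using assms by (intro mult_left_mono) auto
    moreover have "p * (\<eta> / F * (1 + \<eta>) * N) - \<eta> / F * ((1 + 2 * \<eta>) * (p * N)) = - (\<eta>\<^sup>2 * p * N / F)"
      using assms by (simp add: field_simps power2_eq_square)
    ultimately show ?thesis unfolding exp_le_cancel_iff by linarith
  qed
  finally show ?thesis .
qed

text \<open>Handshake count: ordered adjacent pairs are split by orientation, and each half injects
  into the edges.\<close>

lemma sum_inner_degree_le:
  fixes S :: "nat set"
  assumes "finite S" "X \<subseteq> nsets M 2"
  shows "(\<Sum>w\<in>S. card {u \<in> S. {w, u} \<in> X}) \<le> 2 * card (X \<inter> nsets S 2)"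
proof -
  define P where "P = (SIGMA w:S. {u \<in> S. {w, u} \<in> X})"
  have fin: "finite (X \<inter> nsets S 2)" using assms by (simp add: finite_imp_finite_nsets)
  have neq: "w \<noteq> u" if "(w, u) \<in> P" for w u
  proof -
    have "{w, u} \<in> X" using that by (simp add: P_def)
    then have "{w, u} \<in> nsets M 2" using assms(2) by blast
    then show ?thesis unfolding doubleton_in_nsets_2 by blast
  qed
  have "card {z \<in> P. fst z < snd z} \<le> card (X \<inter> nsets S 2)"
  proof (rule card_inj_on_le[OF _ _ fin])
    show "inj_on (\<lambda>(w, u). {w, u}) {z \<in> P. fst z < snd z}"
      by (auto simp: inj_on_def doubleton_eq_iff)
    show "(\<lambda>(w, u). {w, u}) ` {z \<in> P. fst z < snd z} \<subseteq> X \<inter> nsets S 2"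
      by (auto simp: P_def)
  qed
  moreover have "card {z \<in> P. snd z < fst z} \<le> card (X \<inter> nsets S 2)"
  proof (rule card_inj_on_le[OF _ _ fin])
    show "inj_on (\<lambda>(w, u). {w, u}) {z \<in> P. snd z < fst z}"
      by (auto simp: inj_on_def doubleton_eq_iff)
    show "(\<lambda>(w, u). {w, u}) ` {z \<in> P. snd z < fst z} \<subseteq> X \<inter> nsets S 2"
      by (auto simp: P_def)
  qed
  moreover have "P = {z \<in> P. fst z < snd z} \<union> {z \<in> P. snd z < fst z}"
    by (force dest: neq simp: neq_iff)
  then have "card P \<le> card {z \<in> P. fst z < snd z} + card {z \<in> P. snd z < fst z}"
    by (metis (lifting) card_Un_le)
  moreover have "card P = (\<Sum>w\<in>S. card {u \<in> S. {w, u} \<in> X})"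
    unfolding P_def using assms by simp
  ultimately show ?thesis by linarith
qed

text \<open>Chernoff bound with exponent 1: since exp 1 - 1 <= 2, a set of at most \<open>k\<close>
  vertices contributes at most p k^2. The degree sum counts edges twice, whence 8 c against 4
  c.\<close>

lemma inner_edges_tail:
  fixes S M :: "nat set"
  assumes "finite M" "S \<subseteq> M" "0 \<le> p" "p \<le> 1" "real (card S) \<le> k"
  shows "rs_exp p (nsets M 2) (\<lambda>X. of_bool (8 * c < (\<Sum>w\<in>S. real (card {u \<in> S. {w, u} \<in> X}))))
    \<le> exp (p * k\<^sup>2 - 4 * c)"
proof -
  have finS: "finite S" using assms finite_subset by auto
  have fin: "finite (nsets S 2)" using finS by (rule finite_imp_finite_nsets)
  have "rs_exp p (nsets M 2) (\<lambda>X. of_bool (8 * c < (\<Sum>w\<in>S. real (card {u \<in> S. {w, u} \<in> X}))))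
    \<le> rs_exp p (nsets M 2) (\<lambda>X. of_bool (4 * c \<le> (\<Sum>u\<in>nsets S 2. if id u \<in> X then 1 else 0)))"
  proof (rule rs_exp_mono)
    fix X assume X: "X \<subseteq> nsets M 2"
    have "real (\<Sum>w\<in>S. card {u \<in> S. {w, u} \<in> X}) \<le> real (2 * card (X \<inter> nsets S 2))"
      using sum_inner_degree_le[OF finS X] by (rule of_nat_mono)
    moreover have "(\<Sum>u\<in>nsets S 2. if id u \<in> X then 1 else 0) = real (card (X \<inter> nsets S 2))"
      using fin by (simp add: sum.If_cases Int_commute)
    ultimately show "of_bool (8 * c < (\<Sum>w\<in>S. real (card {u \<in> S. {w, u} \<in> X})))
        \<le> (of_bool (4 * c \<le> (\<Sum>u\<in>nsets S 2. if id u \<in> X then 1 else 0)) :: real)"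
      by simp
  qed (use assms in auto)
  also have "\<dots> \<le> exp (p * (\<Sum>u\<in>nsets S 2. exp (1 * 1) - 1) - 1 * (4 * c))"
    using assms by (intro rs_exp_weight_ge) (auto simp: finite_imp_finite_nsets nsets_mono)
  also have "\<dots> \<le> exp (p * k\<^sup>2 - 4 * c)"
  proof -
    have "real (card S choose 2) * 2 \<le> (real (card S))\<^sup>2"
      using binomial_fact_pow[of "card S" 2] by (simp flip: of_nat_mult of_nat_power)
    also have "\<dots> \<le> k\<^sup>2" using assms by (intro power_mono) auto
    finally have "real (card S choose 2) * 2 \<le> k\<^sup>2" .
    moreover have "real (card S choose 2) * (exp 1 - 1) \<le> real (card S choose 2) * 2"
      using exp_le by (intro mult_left_mono) auto
    ultimately have "p * (real (card S choose 2) * (exp 1 - 1)) \<le> p * k\<^sup>2"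
      using assms by (intro mult_left_mono) auto
    then show ?thesis by simp
  qed
  finally show ?thesis .
qed

text \<open>Turns the number of hits into a sum of edge indicators weighted by fibre sizes, the form
  to which the Chernoff and moment bounds apply.\<close>

lemma card_hits_eq_sum:
  assumes "finite Q" "finite S" "\<psi> ` Q \<subseteq> S"
  shows "real (card (hits \<psi> X Q w)) = (\<Sum>u\<in>S. if {w, u} \<in> X then real (card {x \<in> Q. \<psi> x = u}) else 0)"
proof -
  have "hits \<psi> X Q w = (\<Union>u\<in>{u \<in> S. {w, u} \<in> X}. {x \<in> Q. \<psi> x = u})"
    using assms by (auto simp: hits_def)
  moreover have "card (\<Union>u\<in>{u \<in> S. {w, u} \<in> X}. {x \<in> Q. \<psi> x = u})
      = (\<Sum>u\<in>{u \<in> S. {w, u} \<in> X}. card {x \<in> Q. \<psi> x = u})"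
    using assms by (intro card_UN_disjoint) auto
  ultimately show ?thesis using assms by (simp add: sum.If_cases Collect_conj_eq Int_commute)
qed

lemma sum_card_fibres:
  assumes "finite Q" "finite S" "\<psi> ` Q \<subseteq> S"
  shows "(\<Sum>u\<in>S. real (card {x \<in> Q. \<psi> x = u})) = real (card Q)"
proof -
  have "(\<Union>u\<in>S. {x \<in> Q. \<psi> x = u}) = Q" using assms by auto
  moreover have "card (\<Union>u\<in>S. {x \<in> Q. \<psi> x = u}) = (\<Sum>u\<in>S. card {x \<in> Q. \<psi> x = u})"
    using assms by (intro card_UN_disjoint) auto
  ultimately show ?thesis by (simp flip: of_nat_sum)
qed

text \<open>Below the threshold \<open>T\<close> the number of pairs, quadratic in the number of hits, is at most \<open>T\<close>
  times that number, so its exponential moment is that of a sum of independent variables.\<close>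

lemma light_pairs_block:
  fixes p \<mu> T F k :: real and \<psi> :: "nat \<Rightarrow> nat"
  assumes fin: "finite Q" and S: "S = \<psi> ` Q" and p: "0 \<le> p" "p \<le> 1"
    and fibre: "\<And>u. real (card {x \<in> Q. \<psi> x = u}) \<le> F"
    and par: "0 \<le> \<mu>" "0 \<le> T" "\<mu> * T * F \<le> 1" "p * \<mu> * T * k \<le> 1" "real (card Q) \<le> k"
  shows "rs_exp p ((\<lambda>u. {w, u}) ` S) (\<lambda>X. exp (\<mu> * light_pairs T \<psi> X Q w)) \<le> 1 + \<mu> * k\<^sup>2 * p\<^sup>2 * exp 4"
proof -
  define E where "E = (\<lambda>u. {w, u}) ` S"
  define I where "I = {(x, y). x \<in> Q \<and> y \<in> Q \<and> \<psi> x \<noteq> \<psi> y}"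
  define f where "f u = real (card {x \<in> Q. \<psi> x = u})" for u
  define t where "t = \<mu> * T"
  define d where "d X = real (card (hits \<psi> X Q w))" for X
  have finS: "finite S" using fin S by simp
  have t0: "0 \<le> t" using par by (simp add: t_def)
  have tf: "t * f u \<le> 1" for u
    using mult_left_mono[OF fibre[of u] t0] par by (simp add: f_def t_def)
  have I_sub: "I \<subseteq> Q \<times> Q" by (auto simp: I_def)
  then have finI: "finite I" using fin finite_subset by auto
  have cI: "real (card I) \<le> k\<^sup>2"
  proof -
    have "real (card I) \<le> real (card Q) * real (card Q)"
      using card_mono[OF _ I_sub] fin by (simp add: card_cartesian_product flip: of_nat_mult)
    also have "\<dots> \<le> k * k" using par by (intro mult_mono) auto
    finally show ?thesis by (simp add: power2_eq_square)
  qed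
  have main: "exp (\<mu> * light_pairs T \<psi> X Q w)
      \<le> 1 + (\<Sum>(x, y)\<in>I. \<mu> * (of_bool ({w, \<psi> x} \<in> X \<and> {w, \<psi> y} \<in> X) * exp (t * d X)))" for X
  proof (cases "d X < T")
    case True
    define N where "N = real (card (hit_pairs \<psi> X Q w))"
    have "N \<le> d X * d X" unfolding N_def d_def by (rule card_hit_pairs_le[OF fin])
    also have "\<dots> \<le> T * d X" using True by (intro mult_right_mono) (auto simp: d_def)
    finally have muN: "\<mu> * N \<le> t * d X" using par by (simp add: t_def mult_left_mono mult.assoc)
    have N0: "0 \<le> \<mu> * N" using par by (simp add: N_def)
    \<comment> \<open>From exp y <= 1 + y exp y the number of pairs becomes a linear factor: the
      expectation then splits over pairs, and what stays in the exponent is linear in the edge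
      indicators.\<close>
    have "exp (\<mu> * N) \<le> 1 + \<mu> * N * exp (\<mu> * N)"
    proof -
      have "(1 - \<mu> * N) * exp (\<mu> * N) \<le> exp (- (\<mu> * N)) * exp (\<mu> * N)"
        using exp_ge_add_one_self[of "- (\<mu> * N)"] by (intro mult_right_mono) auto
      then show ?thesis by (simp add: algebra_simps flip: exp_add)
    qed
    also have "\<mu> * N * exp (\<mu> * N) \<le> \<mu> * N * exp (t * d X)"
      using muN N0 by (intro mult_left_mono) auto
    also have "\<mu> * N * exp (t * d X)
        = (\<Sum>(x, y)\<in>I. \<mu> * (of_bool ({w, \<psi> x} \<in> X \<and> {w, \<psi> y} \<in> X) * exp (t * d X)))"
    proof -
      have "hit_pairs \<psi> X Q w = {z \<in> I. {w, \<psi> (fst z)} \<in> X \<and> {w, \<psi> (snd z)} \<in> X}"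
        by (auto simp: hit_pairs_def hits_def I_def)
      then have "N = (\<Sum>z\<in>I. of_bool ({w, \<psi> (fst z)} \<in> X \<and> {w, \<psi> (snd z)} \<in> X))"
        using finI by (simp add: N_def of_bool_def sum.If_cases Collect_conj_eq Int_commute Int_assoc)
      then show ?thesis
        by (simp add: sum_distrib_left sum_distrib_right case_prod_beta mult.assoc)
    qed
    finally show ?thesis using True by (simp add: light_pairs_def d_def N_def)
  next
    case False
    have "0 \<le> (\<Sum>(x, y)\<in>I. \<mu> * (of_bool ({w, \<psi> x} \<in> X \<and> {w, \<psi> y} \<in> X) * exp (t * d X)))"
      using par by (intro sum_nonneg) auto
    then show ?thesis using False by (simp add: light_pairs_def d_def)
  qed
  have pair: "rs_exp p E (\<lambda>X. of_bool ({w, \<psi> x} \<in> X \<and> {w, \<psi> y} \<in> X) * exp (t * d X)) \<le> p\<^sup>2 * exp 4"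
    if xy: "(x, y) \<in> I" for x y
  proof -
    \<comment> \<open>The zeros of \<open>h\<close> make the product vanish unless both edges of the
      pair are present, so the indicator is absorbed into the product.\<close>
    define h :: "nat \<Rightarrow> real" where "h u = (if u = \<psi> x \<or> u = \<psi> y then 0 else 1)" for u
    have xS: "\<psi> x \<in> S" "\<psi> y \<in> S" "\<psi> x \<noteq> \<psi> y" using xy S by (auto simp: I_def)
    have "rs_exp p E (\<lambda>X. of_bool ({w, \<psi> x} \<in> X \<and> {w, \<psi> y} \<in> X) * exp (t * d X))
        = rs_exp p E (\<lambda>X. \<Prod>u\<in>S. if {w, u} \<in> X then exp (t * f u) else h u)"
    proof (rule rs_exp_cong)
      fix X
      have "exp (t * d X) = (\<Prod>u\<in>S. if {w, u} \<in> X then exp (t * f u) else 1)"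
        unfolding d_def card_hits_eq_sum[OF fin finS equalityD1[OF S[symmetric]]] f_def
        using finS by (simp add: sum_distrib_left exp_sum if_distrib cong: if_cong)
      moreover have "(\<Prod>u\<in>S. if {w, u} \<in> X then exp (t * f u) else h u) = 0"
        if "{w, \<psi> x} \<notin> X \<or> {w, \<psi> y} \<notin> X"
      proof (rule prod_zero[OF finS])
        show "\<exists>u\<in>S. (if {w, u} \<in> X then exp (t * f u) else h u) = 0"
          using that
        proof
          assume "{w, \<psi> x} \<notin> X"
          then show ?thesis using xS by (intro bexI[of _ "\<psi> x"]) (auto simp: h_def)
        next
          assume "{w, \<psi> y} \<notin> X"
          then show ?thesis using xS by (intro bexI[of _ "\<psi> y"]) (auto simp: h_def)
        qed
      qed
      moreover have "(\<Prod>u\<in>S. if {w, u} \<in> X then exp (t * f u) else h u)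
          = (\<Prod>u\<in>S. if {w, u} \<in> X then exp (t * f u) else 1)"
        if "{w, \<psi> x} \<in> X" "{w, \<psi> y} \<in> X"
        using that by (intro prod.cong) (auto simp: h_def)
      ultimately show "of_bool ({w, \<psi> x} \<in> X \<and> {w, \<psi> y} \<in> X) * exp (t * d X)
          = (\<Prod>u\<in>S. if {w, u} \<in> X then exp (t * f u) else h u)"
        by auto
    qed
    also have "\<dots> = (\<Prod>u\<in>S. p * exp (t * f u) + (1 - p) * h u)"
      unfolding E_def using finS by (intro rs_exp_prod_inj inj_doubleton) auto
    \<comment> \<open>The two required edges give a factor p exp 1 each, and the second factors
      multiply to at most exp 2; this is the origin of p^2 exp 4.\<close>
    also have "\<dots> \<le> (\<Prod>u\<in>S. (if u = \<psi> x \<or> u = \<psi> y then p * exp 1 else 1) * exp (2 * p * t * f u))"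
    proof (rule prod_mono)
      fix u assume "u \<in> S"
      have y0: "0 \<le> t * f u" using t0 by (simp add: f_def)
      have e1: "1 \<le> exp (2 * p * t * f u)" using y0 p by (simp add: mult.assoc)
      show "0 \<le> p * exp (t * f u) + (1 - p) * h u \<and>
          p * exp (t * f u) + (1 - p) * h u
          \<le> (if u = \<psi> x \<or> u = \<psi> y then p * exp 1 else 1) * exp (2 * p * t * f u)"
      proof (cases "u = \<psi> x \<or> u = \<psi> y")
        case True
        have "p * exp (t * f u) \<le> p * exp 1 * 1"
          using tf[of u] p by (simp add: mult_left_mono)
        also have "\<dots> \<le> p * exp 1 * exp (2 * p * t * f u)"
          using e1 p by (intro mult_left_mono) auto
        finally show ?thesis using True p by (simp add: h_def)
      next
        case False
        have "exp (t * f u) \<le> 1 + t * f u + (t * f u)\<^sup>2"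
          using y0 tf by (intro exp_bound)
        also have "(t * f u)\<^sup>2 \<le> t * f u"
          using mult_right_mono[OF tf y0] by (simp add: power2_eq_square)
        finally have "exp (t * f u) - 1 \<le> 2 * (t * f u)" by simp
        then have "p * (exp (t * f u) - 1) \<le> p * (2 * (t * f u))" using p by (intro mult_left_mono)
        also have "1 + p * (2 * (t * f u)) \<le> exp (2 * p * t * f u)"
          using exp_ge_add_one_self[of "2 * p * t * f u"] by (simp add: algebra_simps)
        finally have "1 + p * (exp (t * f u) - 1) \<le> exp (2 * p * t * f u)" by simp
        moreover have "p * exp (t * f u) + (1 - p) * h u = 1 + p * (exp (t * f u) - 1)"
          using False by (simp add: h_def algebra_simps)
        moreover have "0 \<le> p * exp (t * f u) + (1 - p) * h u" using p by (simp add: h_def)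
        ultimately show ?thesis using False by simp
      qed
    qed
    also have "\<dots> = (\<Prod>u\<in>S. if u = \<psi> x \<or> u = \<psi> y then p * exp 1 else 1) * exp (2 * p * t * (\<Sum>u\<in>S. f u))"
      using finS by (simp add: prod.distrib exp_sum sum_distrib_left)
    also have "(\<Prod>u\<in>S. if u = \<psi> x \<or> u = \<psi> y then p * exp 1 else 1) = (p * exp 1)\<^sup>2"
    proof -
      have "S \<inter> {u. u = \<psi> x \<or> u = \<psi> y} = {\<psi> x, \<psi> y}" using xS by auto
      then show ?thesis using finS xS by (simp add: prod.If_cases power2_eq_square)
    qed
    also have "(\<Sum>u\<in>S. f u) = real (card Q)"
      unfolding f_def by (rule sum_card_fibres[OF fin finS]) (simp add: S)
    also have "(p * exp 1)\<^sup>2 * exp (2 * p * t * real (card Q)) \<le> (p * exp 1)\<^sup>2 * exp 2"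
    proof (rule mult_left_mono)
      have "p * t * real (card Q) \<le> p * t * k" using p t0 par by (intro mult_left_mono) auto
      then show "exp (2 * p * t * real (card Q)) \<le> exp 2"
        using par(4) by (simp add: t_def mult.assoc)
    qed auto
    also have "(p * exp 1)\<^sup>2 * exp 2 = p\<^sup>2 * exp 4"
      by (simp add: power_mult_distrib power2_eq_square flip: exp_add)
    finally show ?thesis .
  qed
  have finE: "finite E" using finS by (simp add: E_def)
  have "rs_exp p E (\<lambda>X. exp (\<mu> * light_pairs T \<psi> X Q w))
      \<le> rs_exp p E (\<lambda>X. 1 + (\<Sum>(x, y)\<in>I. \<mu> * (of_bool ({w, \<psi> x} \<in> X \<and> {w, \<psi> y} \<in> X) * exp (t * d X))))"
    using p main by (intro rs_exp_mono) auto
  also have "\<dots> = 1 + (\<Sum>(x, y)\<in>I. \<mu> * rs_exp p E (\<lambda>X. of_bool ({w, \<psi> x} \<in> X \<and> {w, \<psi> y} \<in> X) * exp (t * d X)))"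
    using finE by (simp add: rs_exp_add rs_exp_sum rs_exp_cmult case_prod_beta)
  also have "\<dots> \<le> 1 + (\<Sum>(x, y)\<in>I. \<mu> * (p\<^sup>2 * exp 4))"
    using pair par by (intro add_left_mono sum_mono) (auto intro!: mult_left_mono)
  also have "\<dots> = 1 + real (card I) * (\<mu> * (p\<^sup>2 * exp 4))" by simp
  also have "\<dots> \<le> 1 + k\<^sup>2 * (\<mu> * (p\<^sup>2 * exp 4))"
    using cI par by (intro add_left_mono mult_right_mono) auto
  finally show ?thesis by (simp add: E_def mult_ac)
qed

text \<open>For different \<open>w\<close> outside \<open>S\<close> the stars from \<open>w\<close>
  to \<open>S\<close> are disjoint sets of edges, so the moments from
  \<open>light_pairs_block\<close> multiply.\<close>

lemma light_pairs_tail: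
  fixes p \<mu> T F k :: real and \<psi> :: "nat \<Rightarrow> nat"
  assumes "finite M" and fin: "finite Q" and S: "S = \<psi> ` Q" "S \<subseteq> M" and p: "0 \<le> p" "p \<le> 1"
    and fibre: "\<And>u. real (card {x \<in> Q. \<psi> x = u}) \<le> F"
    and par: "0 \<le> \<mu>" "0 \<le> T" "\<mu> * T * F \<le> 1" "p * \<mu> * T * k \<le> 1" "real (card Q) \<le> k"
  shows "rs_exp p (nsets M 2) (\<lambda>X. of_bool (c < (\<Sum>w\<in>M - S. light_pairs T \<psi> X Q w)))
    \<le> exp (\<mu> * (k\<^sup>2 * p\<^sup>2 * real (card M) * exp 4 - c))"
proof -
  define A where "A w = (\<lambda>u. {w, u}) ` S" for w
  define U where "U = (\<Union>w\<in>M - S. A w)"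
  have finS: "finite S" using fin S by simp
  have finA: "finite (A w)" for w using finS by (simp add: A_def)
  have disj: "disjoint_family_on A (M - S)"
    by (auto simp: disjoint_family_on_def A_def doubleton_eq_iff)
  have U: "U \<subseteq> nsets M 2" using S(2) by (auto simp: U_def A_def)
  have loc: "light_pairs T \<psi> X Q w = light_pairs T \<psi> (X \<inter> A w) Q w" for X w
  proof -
    have "hits \<psi> X Q w = hits \<psi> (X \<inter> A w) Q w"
      using S by (auto simp: hits_def A_def)
    then show ?thesis by (simp add: light_pairs_def hit_pairs_def)
  qed
  have "rs_exp p (nsets M 2) (\<lambda>X. of_bool (c < (\<Sum>w\<in>M - S. light_pairs T \<psi> X Q w)))
      \<le> rs_exp p (nsets M 2) (\<lambda>X. of_bool (c \<le> (\<Sum>w\<in>M - S. light_pairs T \<psi> X Q w)))"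
    using p by (intro rs_exp_mono) auto
  also have "\<dots> \<le> exp (- \<mu> * c) * rs_exp p (nsets M 2) (\<lambda>X. exp (\<mu> * (\<Sum>w\<in>M - S. light_pairs T \<psi> X Q w)))"
    using p par by (intro rs_exp_markov)
  also have "rs_exp p (nsets M 2) (\<lambda>X. exp (\<mu> * (\<Sum>w\<in>M - S. light_pairs T \<psi> X Q w)))
      = rs_exp p (nsets M 2) (\<lambda>X. (\<lambda>Y. \<Prod>w\<in>M - S. exp (\<mu> * light_pairs T \<psi> (Y \<inter> A w) Q w)) (X \<inter> U))"
  proof (rule rs_exp_cong)
    fix X
    have "exp (\<mu> * (\<Sum>w\<in>M - S. light_pairs T \<psi> X Q w)) = (\<Prod>w\<in>M - S. exp (\<mu> * light_pairs T \<psi> X Q w))"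
      using assms(1) by (simp add: sum_distrib_left exp_sum)
    also have "\<dots> = (\<Prod>w\<in>M - S. exp (\<mu> * light_pairs T \<psi> (X \<inter> U \<inter> A w) Q w))"
    proof (rule prod.cong[OF refl])
      fix w assume "w \<in> M - S"
      then have "X \<inter> U \<inter> A w = X \<inter> A w" by (auto simp: U_def)
      then show "exp (\<mu> * light_pairs T \<psi> X Q w) = exp (\<mu> * light_pairs T \<psi> (X \<inter> U \<inter> A w) Q w)"
        using loc by metis
    qed
    finally show "exp (\<mu> * (\<Sum>w\<in>M - S. light_pairs T \<psi> X Q w))
        = (\<lambda>Y. \<Prod>w\<in>M - S. exp (\<mu> * light_pairs T \<psi> (Y \<inter> A w) Q w)) (X \<inter> U)" .
  qed
  also have "\<dots> = rs_exp p U (\<lambda>Y. \<Prod>w\<in>M - S. exp (\<mu> * light_pairs T \<psi> (Y \<inter> A w) Q w))"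
    using U assms(1) by (intro rs_exp_restrict) (auto simp: finite_imp_finite_nsets)
  also have "\<dots> = (\<Prod>w\<in>M - S. rs_exp p (A w) (\<lambda>Y. exp (\<mu> * light_pairs T \<psi> Y Q w)))"
    unfolding U_def
    by (rule rs_exp_prod_blocks[where f = "\<lambda>w Y. exp (\<mu> * light_pairs T \<psi> Y Q w)"])
      (use assms(1) finA disj in auto)
  also have "\<dots> \<le> exp (\<Sum>w\<in>M - S. \<mu> * k\<^sup>2 * p\<^sup>2 * exp 4)"
  proof (rule prod_le_exp_sum)
    fix w
    show "rs_exp p (A w) (\<lambda>Y. exp (\<mu> * light_pairs T \<psi> Y Q w)) \<le> 1 + \<mu> * k\<^sup>2 * p\<^sup>2 * exp 4"
      unfolding A_def by (rule light_pairs_block[OF fin S(1) p fibre par])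
  qed (use p in \<open>auto intro: rs_exp_nonneg\<close>)
  also have "\<dots> \<le> exp (real (card M) * (\<mu> * k\<^sup>2 * p\<^sup>2 * exp 4))"
  proof -
    have "card (M - S) \<le> card M" using assms(1) by (intro card_mono) auto
    then show ?thesis using par by (simp add: mult_right_mono)
  qed
  finally show ?thesis
    by (simp add: mult_exp_exp algebra_simps)
qed

section \<open>Edge-disjoint triangles in a random base graph\<close>

definition disjoint_triangles :: "nat set set \<Rightarrow> nat set set \<Rightarrow> bool" where
  "disjoint_triangles X \<F> \<longleftrightarrow> (\<forall>t\<in>\<F>. finite t \<and> card t = 3 \<and> nsets t 2 \<subseteq> X) \<and>
     (\<forall>t\<in>\<F>. \<forall>t'\<in>\<F>. t \<noteq> t' \<longrightarrow> nsets t 2 \<inter> nsets t' 2 = {})"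

lemma disjoint_triangles_vertices:
  assumes "disjoint_triangles X \<F>" "t \<in> \<F>" "X \<subseteq> nsets M 2"
  shows "t \<subseteq> M"
proof
  fix a assume a: "a \<in> t"
  have t: "finite t" "card t = 3" "nsets t 2 \<subseteq> X" using assms by (auto simp: disjoint_triangles_def)
  then have "card (t - {a}) = 2" using a by simp
  then have "t - {a} \<noteq> {}" by (metis card.empty zero_neq_numeral)
  then obtain b where "b \<in> t - {a}" by blast
  then have "{a, b} \<in> nsets t 2" using a by auto
  then have "{a, b} \<in> nsets M 2" using t assms(3) by blast
  then show "a \<in> M" by simp
qed

text \<open>First moment: a triangle with an edge inside \<open>A\<close> can be chosen in at most
  k^2 m ways, a family is unordered, whence the factorial, and edge-disjointness makes its 3 x edges
  distinct.\<close>

lemma disjoint_triangles_tail: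
  fixes M A :: "nat set"
  assumes "finite M" "A \<subseteq> M" "card A \<le> k" "0 \<le> p" "p \<le> 1"
  shows "rs_exp p (nsets M 2)
      (\<lambda>X. of_bool (\<exists>\<F>. disjoint_triangles X \<F> \<and> card \<F> = x \<and> (\<forall>t\<in>\<F>. nsets (t \<inter> A) 2 \<noteq> {})))
    \<le> (real k ^ 2 * real (card M) * p ^ 3) ^ x / fact x"
\<comment> \<open>An infinite family also has \<open>card\<close> 0, so the counting below is
  confined to positive \<open>x\<close>.\<close>
proof (cases "x = 0")
  case True
  have "rs_exp p (nsets M 2)
      (\<lambda>X. of_bool (\<exists>\<F>. disjoint_triangles X \<F> \<and> card \<F> = x \<and> (\<forall>t\<in>\<F>. nsets (t \<inter> A) 2 \<noteq> {})))
    \<le> rs_exp p (nsets M 2) (\<lambda>X. 1)"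
    using assms by (intro rs_exp_mono) auto
  then show ?thesis using True assms(1) by (simp add: finite_imp_finite_nsets)
next
  case False
  define T where "T = {t \<in> nsets M 3. nsets (t \<inter> A) 2 \<noteq> {}}"
  define I where "I = {\<F> \<in> nsets T x. \<forall>t\<in>\<F>. \<forall>t'\<in>\<F>. t \<noteq> t' \<longrightarrow> nsets t 2 \<inter> nsets t' 2 = {}}"
  have finA: "finite A" using assms finite_subset by auto
  have finT: "finite T" unfolding T_def using assms(1) by (simp add: finite_imp_finite_nsets)
  have cT: "card T \<le> k ^ 2 * card M"
  proof -
    have "T \<subseteq> (\<lambda>(a, b, c). {a, b, c}) ` (A \<times> A \<times> M)"
    proof
      fix t assume t: "t \<in> T"
      then obtain e where "e \<in> nsets (t \<inter> A) 2" by (auto simp: T_def)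
      then obtain a b where ab: "a \<in> t" "b \<in> t" "a \<in> A" "b \<in> A" "a \<noteq> b"
        by (auto elim!: nsets2_E)
      have ct: "card t = 3" "t \<subseteq> M" "finite t" using t by (auto simp: T_def nsets_def)
      then have "card (t - {a, b}) = 1" using ab by (simp add: card_Diff_subset)
      then obtain c where "t - {a, b} = {c}" by (auto simp: card_1_singleton_iff)
      then have "t = {a, b, c}" "c \<in> M" using ab ct by auto
      then show "t \<in> (\<lambda>(a, b, c). {a, b, c}) ` (A \<times> A \<times> M)" using ab by force
    qed
    then have "card T \<le> card (A \<times> A \<times> M)"
      using finA assms(1) by (intro surj_card_le) auto
    also have "\<dots> \<le> k * (k * card M)"
      using assms(3) by (simp add: card_cartesian_product mult_le_mono)
    finally show ?thesis by (simp add: power2_eq_square mult.assoc)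
  qed
  have finI: "finite I" unfolding I_def using finT by (simp add: finite_imp_finite_nsets)
  have cI: "real (card I) \<le> (real k ^ 2 * real (card M)) ^ x / fact x"
  proof -
    have "card I \<le> card (nsets T x)"
      unfolding I_def using finT by (intro card_mono) (auto simp: finite_imp_finite_nsets)
    then have "card I * fact x \<le> (card T choose x) * fact x" by simp
    also have "\<dots> \<le> card T ^ x" by (rule binomial_fact_pow)
    also have "\<dots> \<le> (k ^ 2 * card M) ^ x" using cT by (rule power_mono) simp
    finally have "real (card I * fact x) \<le> real ((k ^ 2 * card M) ^ x)" by (rule of_nat_mono)
    then show ?thesis by (simp add: field_simps)
  qed
  have "rs_exp p (nsets M 2)
      (\<lambda>X. of_bool (\<exists>\<F>. disjoint_triangles X \<F> \<and> card \<F> = x \<and> (\<forall>t\<in>\<F>. nsets (t \<inter> A) 2 \<noteq> {})))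
    \<le> (real k ^ 2 * real (card M)) ^ x / fact x * p ^ (3 * x)"
  proof (rule rs_exp_union_bound_const[where I = I and P = "\<lambda>\<F> X. (\<Union>t\<in>\<F>. nsets t 2) \<subseteq> X"])
    fix X assume X: "X \<subseteq> nsets M 2"
      and "\<exists>\<F>. disjoint_triangles X \<F> \<and> card \<F> = x \<and> (\<forall>t\<in>\<F>. nsets (t \<inter> A) 2 \<noteq> {})"
    then obtain \<F> where F: "disjoint_triangles X \<F>" "card \<F> = x" "\<forall>t\<in>\<F>. nsets (t \<inter> A) 2 \<noteq> {}"
      by blast
    have "t \<subseteq> M" if "t \<in> \<F>" for t
      by (rule disjoint_triangles_vertices[OF F(1) that X])
    then have "\<F> \<in> I"
      using F False card_ge_0_finite[of \<F>] unfolding I_def T_def disjoint_triangles_def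
      by (auto simp: nsets_def)
    moreover have "(\<Union>t\<in>\<F>. nsets t 2) \<subseteq> X" using F by (auto simp: disjoint_triangles_def)
    ultimately show "\<exists>\<F>\<in>I. (\<Union>t\<in>\<F>. nsets t 2) \<subseteq> X" by blast
  next
    fix \<F> assume F: "\<F> \<in> I"
    then have *: "finite \<F>" "card \<F> = x" "\<And>t. t \<in> \<F> \<Longrightarrow> t \<subseteq> M \<and> finite t \<and> card t = 3"
      by (auto simp: I_def T_def nsets_def)
    have "card (\<Union>t\<in>\<F>. nsets t 2) = (\<Sum>t\<in>\<F>. card (nsets t 2))"
      using F * by (intro card_UN_disjoint) (auto simp: I_def finite_imp_finite_nsets)
    also have "\<dots> = (\<Sum>t\<in>\<F>. 3)"
      using * by (intro sum.cong) (auto simp: numeral_eq_Suc)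
    finally have "card (\<Union>t\<in>\<F>. nsets t 2) = 3 * x" using * by simp
    moreover have "(\<Union>t\<in>\<F>. nsets t 2) \<subseteq> nsets M 2"
      using * by (auto simp: nsets_def)
    ultimately show "rs_exp p (nsets M 2) (\<lambda>X. of_bool ((\<Union>t\<in>\<F>. nsets t 2) \<subseteq> X)) \<le> p ^ (3 * x)"
      using rs_exp_superset[of "nsets M 2" "\<Union>t\<in>\<F>. nsets t 2" p] assms(1)
      by (simp add: finite_imp_finite_nsets)
  qed (use assms finI cI in auto)
  then show ?thesis by (simp add: power_mult_distrib power_mult)
qed

section \<open>The overlay of two blow-ups\<close>

definition has_triangle :: "'a set set \<Rightarrow> bool" where
  "has_triangle E \<longleftrightarrow> (\<exists>a b c. a \<noteq> b \<and> a \<noteq> c \<and> b \<noteq> c \<and> {a, b} \<in> E \<and> {b, c} \<in> E \<and> {a, c} \<in> E)"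

lemma nsets_triangle: "a \<noteq> b \<Longrightarrow> a \<noteq> c \<Longrightarrow> b \<noteq> c \<Longrightarrow> nsets {a, b, c} 2 = {{a, b}, {b, c}, {a, c}}"
  by (auto simp: nsets_2_eq)

text \<open>Delete the edges of an edge-disjoint family of triangles of maximum size. A deleted edge
  inside \<open>A\<close> belongs to a family member with an edge inside \<open>A\<close>;
  \<open>x\<close> such members would contradict \<open>sparse\<close>, and each accounts for three
  edges.\<close>

lemma exists_triangle_free_subgraph:
  fixes X :: "nat set set"
  assumes "finite M" "X \<subseteq> nsets M 2"
    and sparse: "\<And>A \<F>. A \<subseteq> M \<Longrightarrow> card A \<le> k \<Longrightarrow> disjoint_triangles X \<F> \<Longrightarrow> card \<F> = x \<Longrightarrow>
        \<exists>t\<in>\<F>. nsets (t \<inter> A) 2 = {}"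
  shows "\<exists>Y\<subseteq>X. \<not> has_triangle Y \<and> (\<forall>A\<subseteq>M. card A \<le> k \<longrightarrow> card {e \<in> X - Y. e \<subseteq> A} \<le> 3 * x)"
proof -
  note inM = disjoint_triangles_vertices[OF _ _ assms(2)]
  have "finite (Collect (disjoint_triangles X))"
    by (rule finite_subset[of _ "Pow (Pow M)"]) (use inM assms(1) in auto)
  moreover have "disjoint_triangles X {}" by (simp add: disjoint_triangles_def)
  ultimately obtain \<F> where F: "disjoint_triangles X \<F>"
    and max: "\<And>\<G>. disjoint_triangles X \<G> \<Longrightarrow> card \<G> \<le> card \<F>"
    using finite_has_maximal[of "card ` Collect (disjoint_triangles X)"]
    by (smt (verit, best) empty_Collect_eq empty_is_image finite_imageI image_iff mem_Collect_eq nle_le)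
  have finF: "finite \<F>"
    by (rule finite_subset[of _ "Pow M"]) (use inM F assms(1) in auto)
  define Y where "Y = X - (\<Union>t\<in>\<F>. nsets t 2)"
  have "\<not> has_triangle Y"
  proof
    assume "has_triangle Y"
    then obtain a b c where abc: "a \<noteq> b" "a \<noteq> c" "b \<noteq> c" "{a, b} \<in> Y" "{b, c} \<in> Y" "{a, c} \<in> Y"
      unfolding has_triangle_def by blast
    define t where "t = {a, b, c}"
    have t: "nsets t 2 = {{a, b}, {b, c}, {a, c}}" "card t = 3" "finite t"
      using abc by (auto simp: t_def nsets_triangle)
    then have tY: "nsets t 2 \<subseteq> Y" using abc by simp
    have "t \<notin> \<F>"
    proof
      assume "t \<in> \<F>"
      moreover have "{a, b} \<in> nsets t 2" using t(1) by blast
      ultimately show False using abc(4) unfolding Y_def by blast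
    qed
    moreover have "disjoint_triangles X (insert t \<F>)"
      using F t tY unfolding disjoint_triangles_def Y_def by blast
    ultimately show False using max[of "insert t \<F>"] finF by simp
  qed
  moreover have "card {e \<in> X - Y. e \<subseteq> A} \<le> 3 * x" if A: "A \<subseteq> M" "card A \<le> k" for A
  proof -
    define \<G> where "\<G> = {t \<in> \<F>. nsets (t \<inter> A) 2 \<noteq> {}}"
    have finG: "finite \<G>" using finF by (simp add: \<G>_def)
    have "card \<G> < x"
    proof (rule ccontr)
      assume "\<not> card \<G> < x"
      then obtain \<H> where H: "\<H> \<subseteq> \<G>" "card \<H> = x" by (meson not_less obtain_subset_with_card_n)
      then have "disjoint_triangles X \<H>" using F unfolding disjoint_triangles_def \<G>_def by blast
      then show False using sparse[OF A _ H(2)] H unfolding \<G>_def by blast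
    qed
    have "{e \<in> X - Y. e \<subseteq> A} \<subseteq> (\<Union>t\<in>\<G>. nsets t 2)"
    proof
      fix e assume "e \<in> {e \<in> X - Y. e \<subseteq> A}"
      then obtain t where t: "t \<in> \<F>" "e \<in> nsets t 2" "e \<subseteq> A" by (auto simp: Y_def)
      then have "e \<in> nsets (t \<inter> A) 2" by (auto simp: nsets_def)
      then show "e \<in> (\<Union>t\<in>\<G>. nsets t 2)" using t by (auto simp: \<G>_def)
    qed
    moreover have fint: "finite t \<and> card (nsets t 2) = 3" if "t \<in> \<G>" for t
      using that F by (auto simp: \<G>_def disjoint_triangles_def numeral_eq_Suc)
    ultimately have "card {e \<in> X - Y. e \<subseteq> A} \<le> card (\<Union>t\<in>\<G>. nsets t 2)"
      using finG by (intro card_mono) (auto intro: finite_imp_finite_nsets)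
    also have "\<dots> \<le> (\<Sum>t\<in>\<G>. card (nsets t 2))" using finG by (rule card_UN_le)
    also have "\<dots> = 3 * card \<G>" using fint by simp
    finally show ?thesis using \<open>card \<G> < x\<close> by linarith
  qed
  ultimately show ?thesis by (intro exI[of _ Y]) (auto simp: Y_def)
qed

text \<open>The base pairs at which a red edge would survive in \<open>K\<close>: one unlinked pair
  of preimages is enough. The red graph does not occur, so this set is fixed once the blue graph has
  been exposed.\<close>

definition open_pairs :: "(nat \<Rightarrow> nat) \<Rightarrow> (nat \<Rightarrow> nat) \<Rightarrow> nat set set \<Rightarrow> nat set \<Rightarrow> nat set set" where
  "open_pairs \<phi> \<psi> B K = {{\<phi> x, \<phi> y} | x y. x \<in> K \<and> y \<in> K \<and> \<phi> x \<noteq> \<phi> y \<and> \<not> linked B (\<psi> x) (\<psi> y)}"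

text \<open>Only the edge itself is taken from the triangle-free part \<open>R'\<close>. Linkage
  refers to the full graph \<open>B\<close> of the other colour, so that open pairs are independent
  of which triangles get deleted.\<close>

definition lifted :: "(nat \<Rightarrow> nat) \<Rightarrow> (nat \<Rightarrow> nat) \<Rightarrow> nat set set \<Rightarrow> nat set set \<Rightarrow> nat \<Rightarrow> nat \<Rightarrow> bool" where
  "lifted \<phi> \<psi> R' B x y \<longleftrightarrow> {\<phi> x, \<phi> y} \<in> R' \<and> \<not> linked B (\<psi> x) (\<psi> y)"

lemma linked_sym: "linked X u v \<longleftrightarrow> linked X v u"
  by (auto simp: linked_def)

lemma lifted_sym: "lifted \<phi> \<psi> R' B x y \<longleftrightarrow> lifted \<phi> \<psi> R' B y x"
  by (simp add: lifted_def insert_commute linked_sym)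

definition two_bite_graph ::
    "nat set \<Rightarrow> (nat \<Rightarrow> nat) \<Rightarrow> (nat \<Rightarrow> nat) \<Rightarrow> nat set set \<Rightarrow> nat set set \<Rightarrow> nat set set \<Rightarrow> nat set set \<Rightarrow> nat set set" where
  "two_bite_graph V \<phi> \<psi> R R' B B' =
     {{x, y} | x y. x \<in> V \<and> y \<in> V \<and> x \<noteq> y \<and> (lifted \<phi> \<psi> R' B x y \<or> lifted \<psi> \<phi> B' R x y)}"

lemma two_bite_graph_iff:
  "{x, y} \<in> two_bite_graph V \<phi> \<psi> R R' B B' \<longleftrightarrow>
     x \<in> V \<and> y \<in> V \<and> x \<noteq> y \<and> (lifted \<phi> \<psi> R' B x y \<or> lifted \<psi> \<phi> B' R x y)"
  unfolding two_bite_graph_def by (auto simp: doubleton_eq_iff lifted_sym)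

text \<open>An edge that closes a path of two edges of the other colour has been dropped, so a triangle
  would have to be monochromatic.\<close>

lemma two_bite_graph_triangle_free:
  assumes "R' \<subseteq> R" "B' \<subseteq> B" "\<not> has_triangle R'" "\<not> has_triangle B'"
    and "R \<subseteq> nsets M 2" "B \<subseteq> nsets M 2"
  shows "\<not> has_triangle (two_bite_graph V \<phi> \<psi> R R' B B')"
proof
  assume "has_triangle (two_bite_graph V \<phi> \<psi> R R' B B')"
  then obtain x y z where e: "lifted \<phi> \<psi> R' B x y \<or> lifted \<psi> \<phi> B' R x y"
    "lifted \<phi> \<psi> R' B y z \<or> lifted \<psi> \<phi> B' R y z" "lifted \<phi> \<psi> R' B x z \<or> lifted \<psi> \<phi> B' R x z"
    unfolding has_triangle_def two_bite_graph_iff by blast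
  have ne: "u \<noteq> v" if "{u, v} \<in> R \<or> {u, v} \<in> B" for u v
  proof -
    have "{u, v} \<in> nsets M 2" using that assms by blast
    then show ?thesis unfolding doubleton_in_nsets_2 by blast
  qed
  have mono: False
    if "lifted f h E' F x y" "lifted f h E' F y z" "lifted f h E' F x z"
      "\<not> has_triangle E'" "E' \<subseteq> R \<or> E' \<subseteq> B" for f h E' F
  proof -
    have "{f x, f y} \<in> E'" "{f y, f z} \<in> E'" "{f x, f z} \<in> E'"
      using that by (simp_all add: lifted_def)
    moreover from this have "f x \<noteq> f y" "f y \<noteq> f z" "f x \<noteq> f z"
      using ne that(5) by blast+
    ultimately show False using that(4) unfolding has_triangle_def by blast
  qed
  have mixed: False
    if "lifted f h E' F u v" "lifted f h E' F v w" "lifted h f F' E u w" "E' \<subseteq> E" for f h E' F F' E u v w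
  proof -
    have "{f u, f v} \<in> E" "{f w, f v} \<in> E"
      using that by (auto simp: lifted_def insert_commute)
    then have "linked E (f u) (f w)" unfolding linked_def by blast
    then show False using that by (simp add: lifted_def)
  qed
  have red: "lifted \<phi> \<psi> R' B u v \<Longrightarrow> lifted \<phi> \<psi> R' B v w \<Longrightarrow> \<not> lifted \<psi> \<phi> B' R u w" for u v w
    using mixed[OF _ _ _ assms(1)] by blast
  have blue: "lifted \<psi> \<phi> B' R u v \<Longrightarrow> lifted \<psi> \<phi> B' R v w \<Longrightarrow> \<not> lifted \<phi> \<psi> R' B u w" for u v w
    using mixed[OF _ _ _ assms(2)] by blast
  show False
    using e mono[of \<phi> \<psi> R' B, OF _ _ _ assms(3)] mono[of \<psi> \<phi> B' R, OF _ _ _ assms(4)] assms(1,2)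
      red[of x y z] red[of y x z] red[of x z y] blue[of x y z] blue[of y x z] blue[of x z y]
      lifted_sym[of \<phi> \<psi> R' B x y] lifted_sym[of \<phi> \<psi> R' B y z]
      lifted_sym[of \<psi> \<phi> B' R x y] lifted_sym[of \<psi> \<phi> B' R y z]
    by argo
qed

text \<open>On a transversal \<open>Q\<close> of the \<phi>-fibres distinct vertices give distinct
  base vertices, so a base pair arises from at most two ordered pairs. The linear term removes the
  diagonal.\<close>

lemma card_open_pairs_ge:
  assumes K: "finite K" and Q: "Q \<subseteq> K" "inj_on \<phi> Q"
  shows "real (card Q) ^ 2 - real (card Q) - real (card {(x, y) \<in> Q \<times> Q. linked B (\<psi> x) (\<psi> y)})
    \<le> 2 * real (card (open_pairs \<phi> \<psi> B K))"
proof -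
  define P where "P = {(x, y) \<in> Q \<times> Q. x \<noteq> y \<and> \<not> linked B (\<psi> x) (\<psi> y)}"
  have finQ: "finite Q" using K Q finite_subset by auto
  have finO: "finite (open_pairs \<phi> \<psi> B K)"
    by (rule finite_subset[of _ "Pow (\<phi> ` K)"]) (use K in \<open>auto simp: open_pairs_def\<close>)
  have Psub: "P \<subseteq> Q \<times> Q" by (auto simp: P_def)
  then have finP: "finite P" using finQ finite_subset by blast
  have "Q \<times> Q = P \<union> ((\<lambda>x. (x, x)) ` Q \<union> {(x, y) \<in> Q \<times> Q. linked B (\<psi> x) (\<psi> y)})"
    by (auto simp: P_def)
  then have "card (Q \<times> Q) = card (P \<union> ((\<lambda>x. (x, x)) ` Q \<union> {(x, y) \<in> Q \<times> Q. linked B (\<psi> x) (\<psi> y)}))"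
    by (rule arg_cong)
  also have "\<dots> \<le> card P + card ((\<lambda>x. (x, x)) ` Q \<union> {(x, y) \<in> Q \<times> Q. linked B (\<psi> x) (\<psi> y)})"
    by (rule card_Un_le)
  also have "card ((\<lambda>x. (x, x)) ` Q \<union> {(x, y) \<in> Q \<times> Q. linked B (\<psi> x) (\<psi> y)})
      \<le> card ((\<lambda>x. (x, x)) ` Q) + card {(x, y) \<in> Q \<times> Q. linked B (\<psi> x) (\<psi> y)}"
    by (rule card_Un_le)
  also have "card ((\<lambda>x. (x, x)) ` Q) \<le> card Q" using finQ by (rule card_image_le)
  finally have 1: "card Q * card Q \<le> card P + (card Q + card {(x, y) \<in> Q \<times> Q. linked B (\<psi> x) (\<psi> y)})"
    by (simp add: card_cartesian_product)
  have inj: "\<phi> x = \<phi> y \<longleftrightarrow> x = y" if "x \<in> Q" "y \<in> Q" for x y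
    using Q(2) that by (auto simp: inj_on_def)
  have img: "(\<lambda>(x, y). {\<phi> x, \<phi> y}) ` P \<subseteq> open_pairs \<phi> \<psi> B K"
  proof
    fix e assume "e \<in> (\<lambda>(x, y). {\<phi> x, \<phi> y}) ` P"
    then obtain x y where "e = {\<phi> x, \<phi> y}" "x \<in> Q" "y \<in> Q" "x \<noteq> y" "\<not> linked B (\<psi> x) (\<psi> y)"
      by (auto simp: P_def)
    then show "e \<in> open_pairs \<phi> \<psi> B K"
      unfolding open_pairs_def using Q(1) inj by blast
  qed
  have "card {z \<in> P. fst z < snd z} \<le> card (open_pairs \<phi> \<psi> B K)"
  proof (rule card_inj_on_le[OF _ _ finO])
    show "inj_on (\<lambda>(x, y). {\<phi> x, \<phi> y}) {z \<in> P. fst z < snd z}"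
      by (auto simp: inj_on_def doubleton_eq_iff P_def inj)
  qed (use img in auto)
  moreover have "card {z \<in> P. snd z < fst z} \<le> card (open_pairs \<phi> \<psi> B K)"
  proof (rule card_inj_on_le[OF _ _ finO])
    show "inj_on (\<lambda>(x, y). {\<phi> x, \<phi> y}) {z \<in> P. snd z < fst z}"
      by (auto simp: inj_on_def doubleton_eq_iff P_def inj)
  qed (use img in auto)
  moreover have "card P \<le> card {z \<in> P. fst z < snd z} + card {z \<in> P. snd z < fst z}"
  proof -
    have "P = {z \<in> P. fst z < snd z} \<union> {z \<in> P. snd z < fst z}"
      by (auto simp: P_def)
    then have "card P = card ({z \<in> P. fst z < snd z} \<union> {z \<in> P. snd z < fst z})"
      by (rule arg_cong)
    also have "\<dots> \<le> card {z \<in> P. fst z < snd z} + card {z \<in> P. snd z < fst z}"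
      by (rule card_Un_le)
    finally show ?thesis .
  qed
  ultimately have "card Q * card Q \<le> 2 * card (open_pairs \<phi> \<psi> B K)
      + (card Q + card {(x, y) \<in> Q \<times> Q. linked B (\<psi> x) (\<psi> y)})"
    using 1 by linarith
  then have "real (card Q * card Q) \<le> real (2 * card (open_pairs \<phi> \<psi> B K)
      + (card Q + card {(x, y) \<in> Q \<times> Q. linked B (\<psi> x) (\<psi> y)}))"
    by (rule of_nat_mono)
  then show ?thesis by (simp add: power2_eq_square)
qed

text \<open>Of 4 x edges in open pairs at most 3 x are lost with the triangles. Each of the others
  is the \<phi>-image of an edge inside \<open>K\<close>. The assumption on \<open>G\<close>
  mentions one colour only, so the lemma applies with the colours exchanged.\<close>

lemma card_edges_within_ge:
  assumes "finite K" "K \<subseteq> V" "R' \<subseteq> R" "R \<subseteq> nsets M 2"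
    and G: "\<And>x y. x \<in> V \<Longrightarrow> y \<in> V \<Longrightarrow> x \<noteq> y \<Longrightarrow> lifted \<phi> \<psi> R' B x y \<Longrightarrow> {x, y} \<in> G"
    and "finite M" "4 * x \<le> card (R \<inter> open_pairs \<phi> \<psi> B K)" "card {e \<in> R - R'. e \<subseteq> \<phi> ` K} \<le> 3 * x"
  shows "x \<le> card {e \<in> G. e \<subseteq> K}"
proof -
  let ?O = "open_pairs \<phi> \<psi> B K"
  have finR: "finite R" using assms finite_subset finite_imp_finite_nsets by metis
  have finE: "finite {e \<in> G. e \<subseteq> K}"
    by (rule finite_subset[of _ "Pow K"]) (use assms in auto)
  have "R \<inter> ?O \<subseteq> (R' \<inter> ?O) \<union> {e \<in> R - R'. e \<subseteq> \<phi> ` K}"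
    by (auto simp: open_pairs_def)
  then have "card (R \<inter> ?O) \<le> card ((R' \<inter> ?O) \<union> {e \<in> R - R'. e \<subseteq> \<phi> ` K})"
    using finR assms(3) by (intro card_mono) (auto intro: finite_subset)
  also have "\<dots> \<le> card (R' \<inter> ?O) + card {e \<in> R - R'. e \<subseteq> \<phi> ` K}" by (rule card_Un_le)
  finally have "x \<le> card (R' \<inter> ?O)" using assms by linarith
  also have "\<dots> \<le> card {e \<in> G. e \<subseteq> K}"
  proof (rule surj_card_le[OF finE])
    show "R' \<inter> ?O \<subseteq> (\<lambda>e. \<phi> ` e) ` {e \<in> G. e \<subseteq> K}"
    proof
      fix e assume "e \<in> R' \<inter> ?O"
      then obtain u v where "e = {\<phi> u, \<phi> v}" "u \<in> K" "v \<in> K" "\<phi> u \<noteq> \<phi> v"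
        "\<not> linked B (\<psi> u) (\<psi> v)" "{\<phi> u, \<phi> v} \<in> R'"
        by (auto simp: open_pairs_def)
      moreover from this have "{u, v} \<in> G"
        using assms(2) by (intro G) (auto simp: lifted_def)
      ultimately show "e \<in> (\<lambda>e. \<phi> ` e) ` {e \<in> G. e \<subseteq> K}"
        by (intro image_eqI[of _ _ "{u, v}"]) auto
    qed
  qed
  finally show ?thesis .
qed

lemma rs_exp_swap:
  "rs_exp p E (\<lambda>X. rs_exp q F (\<lambda>Y. f X Y)) = rs_exp q F (\<lambda>Y. rs_exp p E (\<lambda>X. f X Y))"
  unfolding rs_exp_def sum_distrib_left by (subst sum.swap) (intro sum.cong refl, simp)

text \<open>Lower-tail Chernoff bound. The exponent \<open>l\<close> stays free: a large one brings
  the rate close to p card Z, at a cost of only l y.\<close>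

lemma rs_exp_few_hits:
  assumes "0 \<le> p" "p \<le> 1" "0 \<le> l" "finite E" "Z \<subseteq> E"
  shows "rs_exp p E (\<lambda>X. of_bool (card (X \<inter> Z) < y)) \<le> exp (l * real y - p * (1 - exp (- l)) * real (card Z))"
proof -
  have finZ: "finite Z" using assms finite_subset by auto
  have "rs_exp p E (\<lambda>X. of_bool (card (X \<inter> Z) < y))
      \<le> rs_exp p E (\<lambda>X. of_bool (- real y \<le> - real (card (X \<inter> Z))))"
    using assms by (intro rs_exp_mono) auto
  also have "\<dots> \<le> exp (- l * (- real y)) * rs_exp p E (\<lambda>X. exp (l * (- real (card (X \<inter> Z)))))"
    using assms by (intro rs_exp_markov)
  also have "rs_exp p E (\<lambda>X. exp (l * (- real (card (X \<inter> Z)))))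
      = rs_exp p E (\<lambda>X. \<Prod>u\<in>Z. if id u \<in> X then exp (- l) else 1)"
  proof (rule rs_exp_cong)
    fix X
    have "(\<Prod>u\<in>Z. if id u \<in> X then exp (- l) else 1) = exp (- l) ^ card (X \<inter> Z)"
      using finZ by (simp add: prod.If_cases Int_commute)
    also have "\<dots> = exp (l * (- real (card (X \<inter> Z))))"
      by (simp add: mult.commute flip: exp_of_nat_mult)
    finally show "exp (l * (- real (card (X \<inter> Z)))) = (\<Prod>u\<in>Z. if id u \<in> X then exp (- l) else 1)" ..
  qed
  also have "\<dots> = (\<Prod>u\<in>Z. p * exp (- l) + (1 - p) * 1)"
    using assms by (intro rs_exp_prod_inj) auto
  also have "\<dots> \<le> exp (\<Sum>u\<in>Z. - (p * (1 - exp (- l))))"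
    using assms by (intro prod_le_exp_sum add_nonneg_nonneg mult_nonneg_nonneg) (auto simp: algebra_simps)
  finally show ?thesis by (simp add: mult_exp_exp algebra_simps)
qed

section \<open>The union bound\<close>

lemma rs_exp_disj:
  assumes "0 \<le> p" "p \<le> 1" "rs_exp p E (\<lambda>X. of_bool (P X)) \<le> a" "rs_exp p E (\<lambda>X. of_bool (Q X)) \<le> b"
  shows "rs_exp p E (\<lambda>X. of_bool (P X \<or> Q X)) \<le> a + b"
proof -
  have "rs_exp p E (\<lambda>X. of_bool (P X \<or> Q X)) \<le> rs_exp p E (\<lambda>X. of_bool (P X) + of_bool (Q X))"
    using assms by (intro rs_exp_mono) auto
  then show ?thesis using assms by (simp add: rs_exp_add)
qed

text \<open>Roles of the parameters: \<open>n\<close> vertices are mapped to \<open>m\<close> base vertices with fibres of size at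
  most \<open>F\<close>; base edges have probability \<open>p\<close>; \<open>L\<close> stands for \<open>ln n\<close>; \<open>D\<close> bounds the degrees of a
  blow-up and \<open>s\<close> the codegrees of a base graph; \<open>T\<close> is the threshold for light base vertices;
  \<open>\<mu>\<close> and \<open>l\<close> are the exponents in Chernoff bounds; every \<open>k\<close>-set shall span \<open>x\<close> edges; \<open>W\<close> bounds
  the number of \<open>k\<close>-sets, weighted by the size of their images.\<close>

locale two_bites =
  fixes n m k s x :: nat and p L \<eta> F T D \<mu> l \<omega> W :: real
  assumes p: "0 \<le> p" "p \<le> 1"
    and D_def: "D = (1 + 2 * \<eta>) * (p * real n)"
    and par: "0 < \<eta>" "\<eta> \<le> 1" "0 < T" "T \<le> \<eta> * k" "8 * L * F * T \<le> \<eta> * k" "1 \<le> F"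
      "D \<le> k" "F \<le> \<eta> * k" "2 / \<eta> * (3 * (p * m)) \<le> \<eta> * k" "s * F * (2 * k / T + 1)\<^sup>2 \<le> \<eta> * k"
    and mu: "0 \<le> \<mu>" "\<mu> * T * F \<le> 1" "p * \<mu> * T * k \<le> 1"
    and small: "m * exp (- (p * m)) \<le> 1 / 32"
      "m * exp (- (\<eta>\<^sup>2 * p * n / F)) \<le> 1 / 32"
      "real m ^ 2 * (m * p\<^sup>2) ^ s \<le> 1 / 32"
      "(real n + 1) ^ k * exp (p * real k ^ 2 - 4 * (k * L)) \<le> 1 / 32"
      "(real n + 1) ^ k * exp (\<mu> * (real k ^ 2 * p\<^sup>2 * m * exp 4 - \<eta> * real k ^ 2)) \<le> 1 / 32"
      "(real m + 1) ^ k * ((real k ^ 2 * m * p ^ 3) ^ x / fact x) \<le> 1 / 32"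
    and l0: "0 \<le> l"
    and key: "\<And>a b :: real. 0 \<le> b \<Longrightarrow> b \<le> a \<Longrightarrow> a \<le> real k \<Longrightarrow>
      l * (4 * x) - p * (1 - exp (- l)) * ((a\<^sup>2 - D * (k - b) - 8 * \<eta> * real k ^ 2) / 2)
        \<le> - ((a + b - k) * L / 2) - \<omega> * k * L"
    and weight: "W * exp (k * L / 2 - \<omega> * k * L) \<le> 1 / 8"
begin

text \<open>The two clauses on vertex sets allow fewer than \<open>k\<close> elements because they
  will be applied to a transversal of a \<open>k\<close>-set with respect to the other map.\<close>

definition typical :: "(nat \<Rightarrow> nat) \<Rightarrow> nat set set \<Rightarrow> bool" where
  "typical \<psi> X \<longleftrightarrow>
     (\<forall>w\<in>{..<m}. real (card {u. {w, u} \<in> X}) \<le> 3 * (p * m)) \<and>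
     (\<forall>w\<in>{..<m}. real (card (hits \<psi> X {..<n} w)) \<le> D) \<and>
     (\<forall>w\<in>{..<m}. \<forall>w'\<in>{..<m}. w \<noteq> w' \<longrightarrow> card {u. {w, u} \<in> X \<and> {w', u} \<in> X} \<le> s) \<and>
     (\<forall>Q\<subseteq>{..<n}. card Q \<le> k \<longrightarrow>
        (\<Sum>w\<in>\<psi> ` Q. real (card {u \<in> \<psi> ` Q. {w, u} \<in> X})) \<le> 8 * (k * L)) \<and>
     (\<forall>Q\<subseteq>{..<n}. card Q \<le> k \<longrightarrow>
        (\<Sum>w\<in>{..<m} - \<psi> ` Q. light_pairs T \<psi> X Q w) \<le> \<eta> * real k ^ 2) \<and>
     (\<forall>A\<subseteq>{..<m}. card A \<le> k \<longrightarrow>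
        \<not> (\<exists>\<F>. disjoint_triangles X \<F> \<and> card \<F> = x \<and> (\<forall>t\<in>\<F>. nsets (t \<inter> A) 2 \<noteq> {})))"

lemma typical_sparse:
  assumes "typical \<psi> X" "A \<subseteq> {..<m}" "card A \<le> k" "disjoint_triangles X \<F>" "card \<F> = x"
  shows "\<exists>t\<in>\<F>. nsets (t \<inter> A) 2 = {}"
proof -
  have "\<forall>A\<subseteq>{..<m}. card A \<le> k \<longrightarrow>
        \<not> (\<exists>\<F>. disjoint_triangles X \<F> \<and> card \<F> = x \<and> (\<forall>t\<in>\<F>. nsets (t \<inter> A) 2 \<noteq> {}))"
    using assms(1) unfolding typical_def by (elim conjE)
  then show ?thesis using assms(2-) by blast
qed

lemma typical_imp_triangle_free_subgraph:
  assumes "typical \<psi> X" "X \<subseteq> nsets {..<m} 2"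
  shows "\<exists>Y\<subseteq>X. \<not> has_triangle Y \<and> (\<forall>A\<subseteq>{..<m}. card A \<le> k \<longrightarrow> card {e \<in> X - Y. e \<subseteq> A} \<le> 3 * x)"
  by (rule exists_triangle_free_subgraph[OF finite_lessThan assms(2)]) (rule typical_sparse[OF assms(1)])

definition balanced :: "(nat \<Rightarrow> nat) \<Rightarrow> bool" where
  "balanced \<psi> \<longleftrightarrow> \<psi> ` {..<n} \<subseteq> {..<m} \<and> (\<forall>u. real (card {x\<in>{..<n}. \<psi> x = u}) \<le> F)"

lemma subset_count: "real (card {Q. Q \<subseteq> {..<N} \<and> card Q \<le> k}) \<le> (real N + 1) ^ k"
proof -
  have "real (card {Q. Q \<subseteq> {..<N} \<and> card Q \<le> k}) \<le> real ((card {..<N} + 1) ^ k)"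
    by (intro of_nat_mono card_small_subsets_le) auto
  then show ?thesis by (simp add: add.commute)
qed

lemma finite_small_subsets: "finite {Q. Q \<subseteq> {..<N::nat} \<and> card Q \<le> k}"
  by (rule finite_subset[of _ "Pow {..<N}"]) auto

text \<open>Six failure events, one for each clause, each of probability at most 1 / 32. The last
  three are union bounds over all sets of at most \<open>k\<close> elements.\<close>

lemma atypical_le:
  assumes \<psi>: "balanced \<psi>"
  shows "rs_exp p (nsets {..<m} 2) (\<lambda>X. of_bool (\<not> typical \<psi> X)) \<le> 6 / 32"
proof -
  let ?M = "{..<m}" and ?V = "{..<n}"
  let ?E = "nsets ?M 2"
  have no_loop: "{w, w} \<notin> X" if "X \<subseteq> ?E" for X w
    using that doubleton_in_nsets_2[of w w ?M] by blast
  have \<psi>M: "\<psi> ` Q \<subseteq> ?M" if "Q \<subseteq> ?V" for Q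
    using \<psi> that by (auto simp: balanced_def)
  have fibre: "real (card {x\<in>Q. \<psi> x = u}) \<le> F" if "Q \<subseteq> ?V" for Q u
  proof -
    have "card {x\<in>Q. \<psi> x = u} \<le> card {x\<in>?V. \<psi> x = u}"
      using that by (intro card_mono) auto
    moreover have "real (card {x\<in>?V. \<psi> x = u}) \<le> F" using \<psi> by (simp add: balanced_def)
    ultimately show ?thesis by linarith
  qed
  have deg: "rs_exp p ?E (\<lambda>X. of_bool (\<exists>w\<in>?M. 3 * (p * m) < card {u. {w, u} \<in> X})) \<le> 1 / 32"
  proof (rule order_trans[OF rs_exp_union_bound_const])
    fix w assume w: "w \<in> ?M"
    have "rs_exp p ?E (\<lambda>X. of_bool (3 * (p * m) < card {u. {w, u} \<in> X}))
        \<le> rs_exp p ?E (\<lambda>X. of_bool ((1 + 2 * 1) * (p * m) \<le> (\<Sum>u\<in>?M - {w}. if {w, u} \<in> X then 1 else 0)))"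
    proof (rule rs_exp_mono[OF p])
      fix X assume X: "X \<subseteq> ?E"
      have "{u. {w, u} \<in> X} = (?M - {w}) \<inter> {u. {w, u} \<in> X}"
        using X no_loop[OF X] by auto
      then have "(\<Sum>u\<in>?M - {w}. if {w, u} \<in> X then 1 else (0::real)) = card {u. {w, u} \<in> X}"
        by (simp add: sum.If_cases)
      then show "of_bool (3 * (p * m) < card {u. {w, u} \<in> X})
        \<le> (of_bool ((1 + 2 * 1) * (p * m) \<le> (\<Sum>u\<in>?M - {w}. if {w, u} \<in> X then 1 else 0)) :: real)"
        by simp
    qed
    also have "\<dots> \<le> exp (- (1\<^sup>2 * p * m / 1))"
      using w p by (intro weighted_degree_tail) auto
    finally show "rs_exp p ?E (\<lambda>X. of_bool (3 * (p * m) < card {u. {w, u} \<in> X})) \<le> exp (- (p * m))"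
      by simp
  qed (use p small in auto)
  have wdeg: "rs_exp p ?E (\<lambda>X. of_bool (\<exists>w\<in>?M. D < card (hits \<psi> X ?V w))) \<le> 1 / 32"
  proof (rule order_trans[OF rs_exp_union_bound_const])
    fix w assume w: "w \<in> ?M"
    have "rs_exp p ?E (\<lambda>X. of_bool (D < card (hits \<psi> X ?V w)))
        \<le> rs_exp p ?E (\<lambda>X. of_bool ((1 + 2 * \<eta>) * (p * n)
            \<le> (\<Sum>u\<in>?M - {w}. if {w, u} \<in> X then real (card {x\<in>?V. \<psi> x = u}) else 0)))"
    proof (rule rs_exp_mono[OF p])
      fix X assume X: "X \<subseteq> ?E"
      have "real (card (hits \<psi> X ?V w)) = (\<Sum>u\<in>?M. if {w, u} \<in> X then real (card {x\<in>?V. \<psi> x = u}) else 0)"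
        using \<psi>M[of ?V] by (intro card_hits_eq_sum) auto
      also have "\<dots> = (\<Sum>u\<in>?M - {w}. if {w, u} \<in> X then real (card {x\<in>?V. \<psi> x = u}) else 0)"
        using w no_loop[OF X] by (subst sum.remove[of _ w]) auto
      finally show "of_bool (D < card (hits \<psi> X ?V w))
        \<le> (of_bool ((1 + 2 * \<eta>) * (p * n)
            \<le> (\<Sum>u\<in>?M - {w}. if {w, u} \<in> X then real (card {x\<in>?V. \<psi> x = u}) else 0)) :: real)"
        by (simp add: D_def)
    qed
    also have "\<dots> \<le> exp (- (\<eta>\<^sup>2 * p * n / F))"
    proof (rule weighted_degree_tail)
      show "(\<Sum>u\<in>?M. real (card {x\<in>?V. \<psi> x = u})) \<le> n"
        using \<psi>M[of ?V] by (subst sum_card_fibres) auto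
    qed (use w p par fibre[of ?V] in auto)
    finally show "rs_exp p ?E (\<lambda>X. of_bool (D < card (hits \<psi> X ?V w))) \<le> exp (- (\<eta>\<^sup>2 * p * n / F))" .
  qed (use p small in auto)
  have codeg: "rs_exp p ?E (\<lambda>X. of_bool (\<exists>w\<in>?M. \<exists>w'\<in>?M. w \<noteq> w' \<and> s < card {u. {w, u} \<in> X \<and> {w', u} \<in> X}))
      \<le> 1 / 32"
  proof -
    have "rs_exp p ?E (\<lambda>X. of_bool (\<exists>w\<in>?M. \<exists>w'\<in>?M. w \<noteq> w' \<and> s < card {u. {w, u} \<in> X \<and> {w', u} \<in> X}))
      \<le> rs_exp p ?E (\<lambda>X. of_bool (\<exists>w\<in>?M. \<exists>w'\<in>?M. w \<noteq> w' \<and> s \<le> card {u. {w, u} \<in> X \<and> {w', u} \<in> X}))"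
    proof (rule rs_exp_mono[OF p])
      fix X
      show "of_bool (\<exists>w\<in>?M. \<exists>w'\<in>?M. w \<noteq> w' \<and> s < card {u. {w, u} \<in> X \<and> {w', u} \<in> X})
        \<le> (of_bool (\<exists>w\<in>?M. \<exists>w'\<in>?M. w \<noteq> w' \<and> s \<le> card {u. {w, u} \<in> X \<and> {w', u} \<in> X}) :: real)"
        unfolding of_bool_def using less_imp_le by (smt (verit, best))
    qed
    also have "\<dots> \<le> real (card ?M) ^ 2 * (real (card ?M) * p\<^sup>2) ^ s"
      by (rule codegree_tail[OF _ p]) simp
    finally show ?thesis using small(3) by simp
  qed
  have inner: "rs_exp p ?E (\<lambda>X. of_bool (\<exists>Q\<in>{Q. Q \<subseteq> ?V \<and> card Q \<le> k}.
      8 * (k * L) < (\<Sum>w\<in>\<psi> ` Q. real (card {u \<in> \<psi> ` Q. {w, u} \<in> X})))) \<le> 1 / 32"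
  proof (rule order_trans[OF rs_exp_union_bound_const[OF p finite_small_subsets _ _ subset_count]])
    fix Q assume Q: "Q \<in> {Q. Q \<subseteq> ?V \<and> card Q \<le> k}"
    then have "card (\<psi> ` Q) \<le> k"
      using card_image_le[of Q \<psi>] finite_subset[of Q ?V] by auto
    then show "rs_exp p ?E (\<lambda>X. of_bool (8 * (k * L) < (\<Sum>w\<in>\<psi> ` Q. real (card {u \<in> \<psi> ` Q. {w, u} \<in> X}))))
        \<le> exp (p * real k ^ 2 - 4 * (k * L))"
      using Q \<psi>M p by (intro inner_edges_tail) auto
  qed (use small in auto)
  have light: "rs_exp p ?E (\<lambda>X. of_bool (\<exists>Q\<in>{Q. Q \<subseteq> ?V \<and> card Q \<le> k}.
      \<eta> * real k ^ 2 < (\<Sum>w\<in>?M - \<psi> ` Q. light_pairs T \<psi> X Q w))) \<le> 1 / 32"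
  proof (rule order_trans[OF rs_exp_union_bound_const[OF p finite_small_subsets _ _ subset_count]])
    fix Q assume "Q \<in> {Q. Q \<subseteq> ?V \<and> card Q \<le> k}"
    then have Q: "Q \<subseteq> ?V" "real (card Q) \<le> k" "finite Q" using finite_subset by auto
    have "rs_exp p ?E (\<lambda>X. of_bool (\<eta> * real k ^ 2 < (\<Sum>w\<in>?M - \<psi> ` Q. light_pairs T \<psi> X Q w)))
        \<le> exp (\<mu> * (real k ^ 2 * p\<^sup>2 * real (card ?M) * exp 4 - \<eta> * real k ^ 2))"
      using par by (intro light_pairs_tail[OF _ Q(3) refl \<psi>M[OF Q(1)] p fibre[OF Q(1)] mu(1) _ mu(2,3) Q(2)]) auto
    then show "rs_exp p ?E (\<lambda>X. of_bool (\<eta> * real k ^ 2 < (\<Sum>w\<in>?M - \<psi> ` Q. light_pairs T \<psi> X Q w)))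
        \<le> exp (\<mu> * (real k ^ 2 * p\<^sup>2 * m * exp 4 - \<eta> * real k ^ 2))" by simp
  qed (use small in auto)
  have tri: "rs_exp p ?E (\<lambda>X. of_bool (\<exists>A\<in>{A. A \<subseteq> ?M \<and> card A \<le> k}.
      \<exists>\<F>. disjoint_triangles X \<F> \<and> card \<F> = x \<and> (\<forall>t\<in>\<F>. nsets (t \<inter> A) 2 \<noteq> {}))) \<le> 1 / 32"
  proof (rule order_trans[OF rs_exp_union_bound_const[OF p finite_small_subsets _ _ subset_count]])
    fix A assume A: "A \<in> {A. A \<subseteq> ?M \<and> card A \<le> k}"
    have "rs_exp p ?E (\<lambda>X. of_bool (\<exists>\<F>. disjoint_triangles X \<F> \<and> card \<F> = x \<and> (\<forall>t\<in>\<F>. nsets (t \<inter> A) 2 \<noteq> {})))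
        \<le> (real k ^ 2 * real (card ?M) * p ^ 3) ^ x / fact x"
      using A p by (intro disjoint_triangles_tail) auto
    then show "rs_exp p ?E (\<lambda>X. of_bool (\<exists>\<F>. disjoint_triangles X \<F> \<and> card \<F> = x \<and> (\<forall>t\<in>\<F>. nsets (t \<inter> A) 2 \<noteq> {})))
        \<le> (real k ^ 2 * m * p ^ 3) ^ x / fact x" by simp
  qed (use small p in auto)
  have "rs_exp p ?E (\<lambda>X. of_bool (\<not> typical \<psi> X))
      \<le> 1 / 32 + (1 / 32 + (1 / 32 + (1 / 32 + (1 / 32 + 1 / 32))))"
    by (rule order_trans[OF rs_exp_mono[OF p]
          rs_exp_disj[OF p deg rs_exp_disj[OF p wdeg rs_exp_disj[OF p codeg
            rs_exp_disj[OF p inner rs_exp_disj[OF p light tri]]]]]])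
      (auto simp: typical_def of_bool_def not_le not_less)
  then show ?thesis by simp
qed

lemma linked_pairs_le:
  assumes "balanced \<psi>" "typical \<psi> B" "B \<subseteq> nsets {..<m} 2" "K \<subseteq> {..<n}" "card K = k" "Q \<subseteq> K"
  shows "real (card {(x, y) \<in> Q \<times> Q. linked B (\<psi> x) (\<psi> y)})
    \<le> D * (k - real (card (\<psi> ` K))) + 7 * \<eta> * real k ^ 2"
proof (rule card_linked_pairs_le[where M = "{..<m}" and F = F and s = s and T = T and L = L
      and \<Delta> = "3 * (p * m)"])
  have finK: "finite K" by (rule finite_subset[OF assms(4)]) simp
  have fibK: "card {x\<in>K. \<psi> x = u} \<le> card {x\<in>{..<n}. \<psi> x = u}" for u
    using assms by (intro card_mono) auto
  have Q: "Q \<subseteq> {..<n}" "card Q \<le> k"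
    using assms finK card_mono[OF finK assms(6)] by auto
  show "real (card {x \<in> K. \<psi> x = u}) \<le> F" for u
    using fibK[of u] assms(1) unfolding balanced_def by (meson of_nat_mono order_trans)
  show "real (card (hits \<psi> B K w)) \<le> D" if "w \<in> {..<m}" for w
  proof -
    have "card (hits \<psi> B K w) \<le> card (hits \<psi> B {..<n} w)"
      using assms by (intro card_mono finite_hits) (auto simp: hits_def)
    moreover have "real (card (hits \<psi> B {..<n} w)) \<le> D"
      using assms(2) that by (simp add: typical_def)
    ultimately show ?thesis by linarith
  qed
  show "(\<Sum>w\<in>\<psi> ` Q. real (card {u \<in> \<psi> ` Q. {w, u} \<in> B})) \<le> 8 * real k * L"
    using assms(2) Q by (simp add: typical_def mult.assoc)
  show "(\<Sum>w\<in>{..<m} - \<psi> ` Q. light_pairs T \<psi> B Q w) \<le> \<eta> * (real k)\<^sup>2"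
    using assms(2) Q by (simp add: typical_def)
  show "finite K" by (fact finK)
  show "\<psi> ` K \<subseteq> {..<m}" using assms(1,4) unfolding balanced_def by blast
qed (use assms par in \<open>auto simp: typical_def\<close>)

text \<open>With \<open>B\<close> fixed the open pairs form a fixed set, so a lower-tail bound over
  the random red graph applies. The assumption \<open>key\<close> converts it into a factor
  depending on the two image sizes, which is the weight summed over all \<open>k\<close>-sets, and a
  factor common to all \<open>K\<close>.\<close>

lemma few_open_edges:
  assumes \<psi>: "balanced \<psi>" "typical \<psi> B" "B \<subseteq> nsets {..<m} 2" and \<phi>: "balanced \<phi>"
    and K: "K \<subseteq> {..<n}" "card K = k" and le: "card (\<psi> ` K) \<le> card (\<phi> ` K)"
  shows "rs_exp p (nsets {..<m} 2) (\<lambda>R. of_bool (card (R \<inter> open_pairs \<phi> \<psi> B K) < 4 * x))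
    \<le> exp (- (L / 2) * (real (card (\<phi> ` K)) + real (card (\<psi> ` K)))) * exp (k * L / 2 - \<omega> * k * L)"
proof -
  define a where "a = real (card (\<phi> ` K))"
  define b where "b = real (card (\<psi> ` K))"
  have finK: "finite K" using K finite_subset by auto
  obtain Q where Q: "Q \<subseteq> K" "inj_on \<phi> Q" "\<phi> ` K = \<phi> ` Q"
    using subset_image_inj[of "\<phi> ` K" \<phi> K] by auto
  have a: "a = real (card Q)" using Q by (simp add: a_def card_image)
  have ak: "a \<le> real k" using finK K card_image_le[of K \<phi>] by (simp add: a_def)
  have k1: "1 \<le> \<eta> * k" using par by linarith
  \<comment> \<open>This absorbs the diagonal pairs of \<open>Q\<close> and turns the error 7 \<eta>
    k^2 into the 8 \<eta> k^2 of \<open>key\<close>.\<close>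
  have "real k \<le> \<eta> * real k ^ 2"
    using mult_right_mono[OF k1, of "real k"] by (simp add: power2_eq_square mult.assoc)
  then have "a\<^sup>2 - D * (k - b) - 8 * \<eta> * real k ^ 2 \<le> 2 * real (card (open_pairs \<phi> \<psi> B K))"
    using card_open_pairs_ge[OF finK Q(1,2), of B \<psi>] linked_pairs_le[OF \<psi> K Q(1)] ak
    unfolding a b_def by linarith
  then have N: "p * (1 - exp (- l)) * ((a\<^sup>2 - D * (k - b) - 8 * \<eta> * real k ^ 2) / 2)
      \<le> p * (1 - exp (- l)) * real (card (open_pairs \<phi> \<psi> B K))"
    using p l0 by (intro mult_left_mono) auto
  have "\<phi> ` K \<subseteq> {..<m}" using \<phi> K by (auto simp: balanced_def)
  then have "open_pairs \<phi> \<psi> B K \<subseteq> nsets {..<m} 2"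
    unfolding open_pairs_def by (auto simp: image_subset_iff)
  then have "rs_exp p (nsets {..<m} 2) (\<lambda>R. of_bool (card (R \<inter> open_pairs \<phi> \<psi> B K) < 4 * x))
    \<le> exp (l * real (4 * x) - p * (1 - exp (- l)) * real (card (open_pairs \<phi> \<psi> B K)))"
    using p l0 by (intro rs_exp_few_hits) (auto simp: finite_imp_finite_nsets)
  also have "\<dots> \<le> exp (- ((a + b - k) * L / 2) - \<omega> * k * L)"
    using key[of b a] N ak le by (simp add: a_def b_def)
  also have "- ((a + b - k) * L / 2) - \<omega> * k * L = - (L / 2) * (a + b) + (k * L / 2 - \<omega> * k * L)"
    by (simp add: field_simps)
  finally show ?thesis by (simp only: a_def b_def exp_add)
qed

text \<open>Only one colour is used for each \<open>k\<close>-set: the one whose vertex map has the larger image.\<close>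

lemma exists_no_few_open_edges:
  assumes \<psi>: "balanced \<psi>" "typical \<psi> B" "B \<subseteq> nsets {..<m} 2" and \<phi>: "balanced \<phi>"
    and W: "(\<Sum>K\<in>nsets {..<n} k. exp (- (L / 2) * (real (card (\<phi> ` K)) + real (card (\<psi> ` K))))) \<le> W"
  shows "rs_exp p (nsets {..<m} 2) (\<lambda>R. of_bool (\<exists>K\<in>{K \<in> nsets {..<n} k. card (\<psi> ` K) \<le> card (\<phi> ` K)}.
      card (R \<inter> open_pairs \<phi> \<psi> B K) < 4 * x)) \<le> 1 / 8"
proof -
  let ?I = "{K \<in> nsets {..<n} k. card (\<psi> ` K) \<le> card (\<phi> ` K)}"
  let ?w = "\<lambda>K. exp (- (L / 2) * (real (card (\<phi> ` K)) + real (card (\<psi> ` K))))"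
  let ?c = "exp (k * L / 2 - \<omega> * k * L)"
  have "rs_exp p (nsets {..<m} 2) (\<lambda>R. of_bool (\<exists>K\<in>?I. card (R \<inter> open_pairs \<phi> \<psi> B K) < 4 * x))
      \<le> (\<Sum>K\<in>?I. ?w K * ?c)"
  proof (rule rs_exp_union_bound[OF p])
    fix K assume "K \<in> ?I"
    then show "rs_exp p (nsets {..<m} 2) (\<lambda>R. of_bool (card (R \<inter> open_pairs \<phi> \<psi> B K) < 4 * x)) \<le> ?w K * ?c"
      by (intro few_open_edges assms) (auto simp: nsets_def)
  qed (auto simp: finite_imp_finite_nsets)
  also have "\<dots> \<le> (\<Sum>K\<in>nsets {..<n} k. ?w K * ?c)"
    by (intro sum_mono2) (auto simp: finite_imp_finite_nsets)
  also have "\<dots> = (\<Sum>K\<in>nsets {..<n} k. ?w K) * ?c" by (simp add: sum_distrib_right)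
  also have "\<dots> \<le> W * ?c" using W by (intro mult_right_mono) auto
  finally show ?thesis using weight by linarith
qed

text \<open>First moment over two independent base graphs. For \<open>k\<close>-sets with the larger
  image under \<phi> the blue graph is exposed first and the red one averaged; for the others the
  order is reversed. Every \<open>k\<close>-set falls under one of the two cases.\<close>

lemma exists_locally_dense_triangle_free_graph:
  assumes \<phi>: "balanced \<phi>" and \<psi>: "balanced \<psi>"
    and W: "(\<Sum>K\<in>nsets {..<n} k. exp (- (L / 2) * (real (card (\<phi> ` K)) + real (card (\<psi> ` K))))) \<le> W"
  shows "\<exists>G\<subseteq>nsets {..<n} 2. \<not> has_triangle G \<and> (\<forall>K\<in>nsets {..<n} k. x \<le> card {e \<in> G. e \<subseteq> K})"
proof -
  let ?E = "nsets {..<m} 2"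
  have finE: "finite ?E" by (simp add: finite_imp_finite_nsets)
  have W': "(\<Sum>K\<in>nsets {..<n} k. exp (- (L / 2) * (real (card (\<psi> ` K)) + real (card (\<phi> ` K))))) \<le> W"
    using W by (simp add: add.commute)
  \<comment> \<open>Typicality is part of the event, so that its probability over the averaged graph
    is bounded for every choice of the exposed one.\<close>
  define bad where "bad \<phi> \<psi> R B \<longleftrightarrow> typical \<psi> B \<and>
      (\<exists>K\<in>{K \<in> nsets {..<n} k. card (\<psi> ` K) \<le> card (\<phi> ` K)}. card (R \<inter> open_pairs \<phi> \<psi> B K) < 4 * x)"
    for \<phi> \<psi> and R B :: "nat set set"
  have bad_le: "rs_exp p ?E (\<lambda>R. of_bool (bad f h R B)) \<le> 1 / 8"
    if B: "B \<subseteq> ?E" and f: "balanced f" "balanced h"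
      "(\<Sum>K\<in>nsets {..<n} k. exp (- (L / 2) * (real (card (f ` K)) + real (card (h ` K))))) \<le> W" for f h B
  proof (cases "typical h B")
    case True
    then show ?thesis
      using exists_no_few_open_edges[OF f(2) True B f(1,3)] by (simp add: bad_def)
  next
    case False
    then show ?thesis using finE by (simp add: bad_def)
  qed
  define total where "total R B = of_bool (\<not> typical \<phi> R) + of_bool (\<not> typical \<psi> B)
      + of_bool (bad \<phi> \<psi> R B) + (of_bool (bad \<psi> \<phi> B R) :: real)" for R B
  have "rs_exp p ?E (\<lambda>R. rs_exp p ?E (\<lambda>B. total R B))
      = rs_exp p ?E (\<lambda>R. of_bool (\<not> typical \<phi> R)) + rs_exp p ?E (\<lambda>B. of_bool (\<not> typical \<psi> B))
        + rs_exp p ?E (\<lambda>B. rs_exp p ?E (\<lambda>R. of_bool (bad \<phi> \<psi> R B)))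
        + rs_exp p ?E (\<lambda>R. rs_exp p ?E (\<lambda>B. of_bool (bad \<psi> \<phi> B R)))"
    unfolding total_def rs_exp_add rs_exp_swap[of p ?E p ?E "\<lambda>R B. of_bool (bad \<phi> \<psi> R B)"]
    using finE by simp
  \<comment> \<open>The four expectations add up to at most 3/16 + 3/16 + 1/8 + 1/8 = 5/8.\<close>
  also have "\<dots> \<le> 6 / 32 + 6 / 32 + rs_exp p ?E (\<lambda>B. 1 / 8) + rs_exp p ?E (\<lambda>R. 1 / 8)"
    by (intro add_mono atypical_le rs_exp_mono[OF p] bad_le \<phi> \<psi> W W')
  also have "\<dots> < 1" using finE by simp
  finally have "rs_exp p ?E (\<lambda>R. rs_exp p ?E (\<lambda>B. total R B)) < 1" .
  then obtain R where R: "R \<subseteq> ?E" "rs_exp p ?E (\<lambda>B. total R B) < 1"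
    using rs_exp_less_imp_ex[OF finE p] by blast
  then obtain B where B: "B \<subseteq> ?E" "total R B < 1"
    using rs_exp_less_imp_ex[OF finE p] by blast
  have good: "typical \<phi> R" "typical \<psi> B" "\<not> bad \<phi> \<psi> R B" "\<not> bad \<psi> \<phi> B R"
    using B(2) by (auto simp: total_def of_bool_def split: if_splits)
  obtain R' where R': "R' \<subseteq> R" "\<not> has_triangle R'"
    "\<And>A. A \<subseteq> {..<m} \<Longrightarrow> card A \<le> k \<Longrightarrow> card {e \<in> R - R'. e \<subseteq> A} \<le> 3 * x"
    using typical_imp_triangle_free_subgraph[OF good(1) R(1)] by blast
  obtain B' where B': "B' \<subseteq> B" "\<not> has_triangle B'"
    "\<And>A. A \<subseteq> {..<m} \<Longrightarrow> card A \<le> k \<Longrightarrow> card {e \<in> B - B'. e \<subseteq> A} \<le> 3 * x"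
    using typical_imp_triangle_free_subgraph[OF good(2) B(1)] by blast
  define G where "G = two_bite_graph {..<n} \<phi> \<psi> R R' B B'"
  have "G \<subseteq> nsets {..<n} 2" by (auto simp: G_def two_bite_graph_def)
  moreover have "\<not> has_triangle G"
    unfolding G_def by (rule two_bite_graph_triangle_free) (fact R' B' R B)+
  moreover have "x \<le> card {e \<in> G. e \<subseteq> K}" if K: "K \<in> nsets {..<n} k" for K
  proof -
    have K': "finite K" "K \<subseteq> {..<n}" "card K = k" using K by (auto simp: nsets_def)
    have img: "\<phi> ` K \<subseteq> {..<m}" "card (\<phi> ` K) \<le> k" "\<psi> ` K \<subseteq> {..<m}" "card (\<psi> ` K) \<le> k"
      using K' \<phi> \<psi> card_image_le[of K] by (auto simp: balanced_def image_subset_iff subset_iff)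
    show ?thesis
    proof (cases "card (\<psi> ` K) \<le> card (\<phi> ` K)")
      case True
      then have "4 * x \<le> card (R \<inter> open_pairs \<phi> \<psi> B K)"
        using good(2,3) K unfolding bad_def by (auto simp: not_less)
      then show ?thesis
        using R'(3)[OF img(1,2)]
        by (intro card_edges_within_ge[OF K'(1,2) R'(1) R(1), where \<phi> = \<phi> and \<psi> = \<psi> and B = B])
          (auto simp: G_def two_bite_graph_iff)
    next
      case False
      then have "4 * x \<le> card (B \<inter> open_pairs \<psi> \<phi> R K)"
        using good(1,4) K unfolding bad_def by (auto simp: not_less)
      then show ?thesis
        using B'(3)[OF img(3,4)]
        by (intro card_edges_within_ge[OF K'(1,2) B'(1) B(1), where \<phi> = \<psi> and \<psi> = \<phi> and B = R])
          (auto simp: G_def two_bite_graph_iff)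
    qed
  qed
  ultimately show ?thesis by blast
qed

end

section \<open>Random vertex maps\<close>

lemma sum_PiE_insert:
  assumes "x \<notin> V"
  shows "(\<Sum>\<phi>\<in>PiE (insert x V) (\<lambda>_. M). f \<phi>) = (\<Sum>\<phi>\<in>PiE V (\<lambda>_. M). \<Sum>y\<in>M. f (\<phi>(x := y)))"
proof -
  have "(\<Sum>\<phi>\<in>PiE (insert x V) (\<lambda>_. M). f \<phi>) = (\<Sum>(y, \<phi>)\<in>M \<times> PiE V (\<lambda>_. M). f (\<phi>(x := y)))"
    unfolding PiE_insert_eq
    by (subst sum.reindex[OF inj_combinator[OF assms]]) (simp add: o_def case_prod_beta)
  also have "\<dots> = (\<Sum>y\<in>M. \<Sum>\<phi>\<in>PiE V (\<lambda>_. M). f (\<phi>(x := y)))"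
    by (rule sum.cartesian_product[symmetric])
  finally show ?thesis by (simp add: sum.swap[of _ _ M])
qed

text \<open>Values are assigned one vertex at a time. A new point of \<open>K\<close> either hits
  the current image, in at most \<open>k\<close> ways, or enlarges it, in at most
  \<open>card M\<close> ways with an additional factor \<open>z\<close>. After normalisation the
  expectation of \<open>z\<close> to the image size is at most (z + k / m)^k for a
  \<open>k\<close>-set.\<close>

lemma sum_power_card_image_le:
  fixes z :: real
  assumes "finite V" "finite M" "0 \<le> z" "finite K" "card K \<le> k"
  shows "(\<Sum>\<phi>\<in>PiE V (\<lambda>_. M). z ^ card (\<phi> ` (K \<inter> V)))
    \<le> real (card M) ^ card (V - K) * (card M * z + k) ^ card (K \<inter> V)"
  using assms(1)
proof (induction V rule: finite_induct)
  case (insert x V)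
  let ?P = "PiE V (\<lambda>_. M)"
  have upd: "(\<phi>(x := y)) ` (K \<inter> V) = \<phi> ` (K \<inter> V)" for \<phi> :: "'a \<Rightarrow> 'b" and y
    using insert.hyps by (intro image_cong) auto
  show ?case
  proof (cases "x \<in> K")
    case False
    have "(\<Sum>\<phi>\<in>PiE (insert x V) (\<lambda>_. M). z ^ card (\<phi> ` (K \<inter> insert x V)))
        = card M * (\<Sum>\<phi>\<in>?P. z ^ card (\<phi> ` (K \<inter> V)))"
    proof -
      have "K \<inter> insert x V = K \<inter> V" using False by auto
      then show ?thesis
        unfolding sum_PiE_insert[OF insert.hyps(2)] by (simp only: upd sum_constant sum_distrib_left)
    qed
    also have "\<dots> \<le> card M * (real (card M) ^ card (V - K) * (card M * z + k) ^ card (K \<inter> V))"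
      using insert.IH by (intro mult_left_mono) auto
    also have "\<dots> = real (card M) ^ card (insert x V - K) * (card M * z + k) ^ card (K \<inter> insert x V)"
      using False insert.hyps by (simp add: insert_Diff_if)
    finally show ?thesis .
  next
    case True
    have img: "(\<phi>(x := y)) ` (K \<inter> insert x V) = insert y (\<phi> ` (K \<inter> V))" for \<phi> :: "'a \<Rightarrow> 'b" and y
    proof -
      have "K \<inter> insert x V = insert x (K \<inter> V)" using True by auto
      then show ?thesis by (simp only: image_insert fun_upd_same upd)
    qed
    have step: "(\<Sum>y\<in>M. z ^ card (insert y I)) \<le> (card M * z + k) * z ^ card I"
      if "finite I" "card I \<le> k" for I :: "'b set"
    proof -
      have "(\<Sum>y\<in>M. z ^ card (insert y I))
          = (\<Sum>y\<in>M \<inter> I. z ^ card (insert y I)) + (\<Sum>y\<in>M - I. z ^ card (insert y I))"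
        using assms by (simp add: sum.Int_Diff)
      also have "(\<Sum>y\<in>M \<inter> I. z ^ card (insert y I)) = card (M \<inter> I) * z ^ card I"
        by (simp add: insert_absorb)
      also have "\<dots> \<le> k * z ^ card I"
      proof (rule mult_right_mono)
        have "card (M \<inter> I) \<le> card I" using that by (intro card_mono) auto
        then show "real (card (M \<inter> I)) \<le> k" using that by linarith
      qed (use assms in auto)
      also have "(\<Sum>y\<in>M - I. z ^ card (insert y I)) = card (M - I) * (z * z ^ card I)"
        using that by simp
      also have "\<dots> \<le> card M * (z * z ^ card I)"
        using assms by (intro mult_right_mono of_nat_mono card_mono) auto
      finally show ?thesis by (simp add: algebra_simps)
    qed
    have "(\<Sum>\<phi>\<in>PiE (insert x V) (\<lambda>_. M). z ^ card (\<phi> ` (K \<inter> insert x V)))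
        = (\<Sum>\<phi>\<in>?P. \<Sum>y\<in>M. z ^ card (insert y (\<phi> ` (K \<inter> V))))"
      unfolding sum_PiE_insert[OF insert.hyps(2)] img ..
    also have "\<dots> \<le> (\<Sum>\<phi>\<in>?P. (card M * z + k) * z ^ card (\<phi> ` (K \<inter> V)))"
    proof (intro sum_mono step)
      fix \<phi> :: "'a \<Rightarrow> 'b"
      show "finite (\<phi> ` (K \<inter> V))" using assms by simp
      have "card (\<phi> ` (K \<inter> V)) \<le> card (K \<inter> V)" using assms by (intro card_image_le) auto
      also have "\<dots> \<le> card K" using assms by (intro card_mono) auto
      finally show "card (\<phi> ` (K \<inter> V)) \<le> k" using assms by linarith
    qed
    also have "\<dots> = (card M * z + k) * (\<Sum>\<phi>\<in>?P. z ^ card (\<phi> ` (K \<inter> V)))"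
      by (simp add: sum_distrib_left)
    also have "\<dots> \<le> (card M * z + k) * (real (card M) ^ card (V - K) * (card M * z + k) ^ card (K \<inter> V))"
      using insert.IH assms by (intro mult_left_mono) auto
    also have "\<dots> = real (card M) ^ card (insert x V - K) * (card M * z + k) ^ card (K \<inter> insert x V)"
      using True insert.hyps by (simp add: insert_Diff_if)
    finally show ?thesis .
  qed
qed simp

text \<open>Each vertex independently contributes a factor exp 1 for the value \<open>u\<close> and
  1 for every other value.\<close>

lemma sum_exp_card_fibre:
  assumes "finite V" "finite M" "u \<in> M"
  shows "(\<Sum>\<phi>\<in>PiE V (\<lambda>_. M). exp (real (card {x\<in>V. \<phi> x = u}))) = (real (card M) - 1 + exp 1) ^ card V"
  using assms(1)
proof (induction V rule: finite_induct)
  case (insert x V)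
  have fib: "{v \<in> insert x V. (\<phi>(x := y)) v = u}
      = (if y = u then insert x {v \<in> V. \<phi> v = u} else {v \<in> V. \<phi> v = u})" for \<phi> :: "'a \<Rightarrow> 'b" and y
    using insert.hyps by auto
  have step: "(\<Sum>y\<in>M. exp (real (card {v \<in> insert x V. (\<phi>(x := y)) v = u})))
      = (real (card M) - 1 + exp 1) * exp (real (card {v \<in> V. \<phi> v = u}))" for \<phi> :: "'a \<Rightarrow> 'b"
  proof -
    let ?c = "card {v \<in> V. \<phi> v = u}"
    have "(\<Sum>y\<in>M. exp (real (card {v \<in> insert x V. (\<phi>(x := y)) v = u})))
        = exp (real (?c + 1)) + (\<Sum>y\<in>M - {u}. exp (real ?c))"
      unfolding fib using assms insert.hyps by (subst sum.remove[of _ u]) (auto intro!: sum.cong)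
    also have "\<dots> = exp 1 * exp (real ?c) + (real (card M) - 1) * exp (real ?c)"
    proof -
      have "1 \<le> card M" using assms by (metis Suc_leI One_nat_def card_gt_0_iff empty_iff)
      then show ?thesis using assms by (simp add: exp_add card_Diff_singleton of_nat_diff)
    qed
    finally show ?thesis by (simp add: algebra_simps)
  qed
  have "(\<Sum>\<phi>\<in>PiE (insert x V) (\<lambda>_. M). exp (real (card {v\<in>insert x V. \<phi> v = u})))
      = (\<Sum>\<phi>\<in>PiE V (\<lambda>_. M). (real (card M) - 1 + exp 1) * exp (real (card {v \<in> V. \<phi> v = u})))"
    unfolding sum_PiE_insert[OF insert.hyps(2)] step ..
  also have "\<dots> = (real (card M) - 1 + exp 1) * (real (card M) - 1 + exp 1) ^ card V"
    by (simp add: insert.IH flip: sum_distrib_left)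
  finally show ?case using insert.hyps by simp
qed simp

text \<open>Exponential Markov inequality for each fibre and a union bound over the fibres; the
  moment is controlled by (1 + 2 / m)^n <= exp (2 n / m).\<close>

lemma few_unbalanced_maps:
  fixes n m :: nat and F :: real
  assumes "0 < m" "m * exp (2 * n / m - F) \<le> 1 / 8"
  shows "(\<Sum>\<phi>\<in>PiE {..<n} (\<lambda>_. {..<m}). of_bool (\<exists>u\<in>{..<m}. F < card {x\<in>{..<n}. \<phi> x = u})) \<le> real m ^ n / 8"
proof -
  let ?P = "PiE {..<n} (\<lambda>_. {..<m})"
  let ?c = "\<lambda>\<phi> u. real (card {x\<in>{..<n}. \<phi> x = u})"
  have "(\<Sum>\<phi>\<in>?P. of_bool (\<exists>u\<in>{..<m}. F < ?c \<phi> u))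
      \<le> (\<Sum>\<phi>\<in>?P. \<Sum>u\<in>{..<m}. exp (- F) * exp (?c \<phi> u))"
  proof (rule sum_mono)
    fix \<phi> :: "nat \<Rightarrow> nat"
    show "of_bool (\<exists>u\<in>{..<m}. F < ?c \<phi> u) \<le> (\<Sum>u\<in>{..<m}. exp (- F) * exp (?c \<phi> u))"
    proof (cases "\<exists>u\<in>{..<m}. F < ?c \<phi> u")
      case True
      then obtain u where u: "u \<in> {..<m}" "F < ?c \<phi> u" by blast
      then have "1 \<le> exp (- F) * exp (?c \<phi> u)" by (simp flip: exp_add)
      also have "\<dots> \<le> (\<Sum>u\<in>{..<m}. exp (- F) * exp (?c \<phi> u))"
        using u by (intro member_le_sum) auto
      finally show ?thesis using True by simp
    qed (simp add: sum_nonneg)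
  qed
  also have "\<dots> = (\<Sum>u\<in>{..<m}. exp (- F) * (\<Sum>\<phi>\<in>?P. exp (?c \<phi> u)))"
    by (subst sum.swap) (simp add: sum_distrib_left)
  also have "\<dots> = m * (exp (- F) * (real m - 1 + exp 1) ^ n)"
  proof -
    have "(\<Sum>\<phi>\<in>?P. exp (?c \<phi> u)) = (real m - 1 + exp 1) ^ n" if "u \<in> {..<m}" for u
      using sum_exp_card_fibre[of "{..<n}" "{..<m}" u] that by simp
    then have "(\<Sum>u\<in>{..<m}. exp (- F) * (\<Sum>\<phi>\<in>?P. exp (?c \<phi> u)))
        = (\<Sum>u\<in>{..<m}. exp (- F) * (real m - 1 + exp 1) ^ n)"
      by (intro sum.cong) simp_all
    then show ?thesis by simp
  qed
  also have "(real m - 1 + exp 1) ^ n \<le> real m ^ n * exp (2 * n / m)"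
  proof -
    have "real m - 1 + exp 1 \<le> real m * (1 + 2 / m)"
      using exp_le assms by (simp add: field_simps)
    also have "\<dots> \<le> real m * exp (2 / m)"
      by (intro mult_left_mono exp_ge_add_one_self) auto
    finally have "real m - 1 + exp 1 \<le> real m * exp (2 / m)" .
    then have "(real m - 1 + exp 1) ^ n \<le> (real m * exp (2 / m)) ^ n"
      using assms by (intro power_mono) (auto simp: add_nonneg_nonneg)
    also have "\<dots> = real m ^ n * exp (2 * n / m)"
      by (simp add: power_mult_distrib mult.commute flip: exp_of_nat_mult)
    finally show ?thesis .
  qed
  also have "m * (exp (- F) * (real m ^ n * exp (2 * n / m))) = real m ^ n * (m * exp (2 * n / m - F))"
    by (simp add: exp_diff exp_minus field_simps)
  also have "\<dots> \<le> real m ^ n * (1 / 8)"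
    using assms by (intro mult_left_mono) auto
  finally show ?thesis by (simp add: mult_left_mono)
qed

text \<open>Each map is unbalanced with probability at most 1/8, and the weighted sum exceeds four
  times its expected bound with probability at most 1/4, so some pair avoids all three failures. For
  z = n^(-1/2) the sum controls at once the \<open>k\<close>-sets of all image sizes.\<close>

lemma exists_balanced_maps:
  fixes n m k :: nat and z F :: real
  assumes "0 < m" "0 < z" "k \<le> n" "0 \<le> F" "m * exp (2 * n / m - F) \<le> 1 / 8"
  shows "\<exists>\<phi> \<psi>. \<phi> ` {..<n} \<subseteq> {..<m} \<and> (\<forall>u. real (card {x\<in>{..<n}. \<phi> x = u}) \<le> F) \<and>
      \<psi> ` {..<n} \<subseteq> {..<m} \<and> (\<forall>u. real (card {x\<in>{..<n}. \<psi> x = u}) \<le> F) \<and>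
      (\<Sum>K\<in>nsets {..<n} k. z ^ card (\<phi> ` K) * z ^ card (\<psi> ` K)) \<le> 4 * ((n choose k) * (z + k / m) ^ (2 * k))"
proof -
  let ?P = "PiE {..<n} (\<lambda>_. {..<m})"
  define N where "N = real m ^ n"
  define A where "A = real (n choose k) * (z + k / m) ^ (2 * k)"
  define bad :: "(nat \<Rightarrow> nat) \<Rightarrow> real" where
    "bad \<phi> = of_bool (\<exists>u\<in>{..<m}. F < card {x\<in>{..<n}. \<phi> x = u})" for \<phi>
  define S where "S \<phi> \<psi> = (\<Sum>K\<in>nsets {..<n} k. z ^ card (\<phi> ` K) * z ^ card (\<psi> ` K))"
    for \<phi> \<psi> :: "nat \<Rightarrow> nat"
  have N0: "0 < N" using assms by (simp add: N_def)
  have cP: "real (card ?P) = N" by (simp add: N_def card_PiE)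
  have finP: "finite ?P" by (simp add: finite_PiE)
  have "0 < z + k / m" using assms by (simp add: add_pos_nonneg)
  then have A0: "0 < A" using assms by (simp add: A_def zero_less_mult_iff)
  have bad: "sum bad ?P \<le> N / 8"
    unfolding bad_def N_def using assms by (intro few_unbalanced_maps)
  have "(\<Sum>\<phi>\<in>?P. \<Sum>\<psi>\<in>?P. S \<phi> \<psi>)
      = (\<Sum>K\<in>nsets {..<n} k. (\<Sum>\<phi>\<in>?P. z ^ card (\<phi> ` K)) * (\<Sum>\<psi>\<in>?P. z ^ card (\<psi> ` K)))"
  proof -
    have "(\<Sum>\<phi>\<in>?P. \<Sum>\<psi>\<in>?P. S \<phi> \<psi>)
        = (\<Sum>\<phi>\<in>?P. \<Sum>K\<in>nsets {..<n} k. \<Sum>\<psi>\<in>?P. z ^ card (\<phi> ` K) * z ^ card (\<psi> ` K))"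
      unfolding S_def by (intro sum.cong refl sum.swap)
    also have "\<dots> = (\<Sum>K\<in>nsets {..<n} k. \<Sum>\<phi>\<in>?P. \<Sum>\<psi>\<in>?P. z ^ card (\<phi> ` K) * z ^ card (\<psi> ` K))"
      by (rule sum.swap)
    finally show ?thesis by (simp add: sum_product)
  qed
  also have "\<dots> \<le> (\<Sum>K\<in>nsets {..<n} k. N * (z + k / m) ^ k * (N * (z + k / m) ^ k))"
  proof (rule sum_mono)
    fix K assume "K \<in> nsets {..<n} k"
    then have K: "K \<subseteq> {..<n}" "finite K" "card K = k" by (auto simp: nsets_def)
    have "(\<Sum>\<phi>\<in>?P. z ^ card (\<phi> ` K)) = (\<Sum>\<phi>\<in>?P. z ^ card (\<phi> ` (K \<inter> {..<n})))"
      using K by (simp add: Int_absorb2)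
    also have "\<dots> \<le> real (card {..<m}) ^ card ({..<n} - K) * (card {..<m} * z + k) ^ card (K \<inter> {..<n})"
      using assms K by (intro sum_power_card_image_le) auto
    also have "\<dots> = real m ^ (n - k) * (m * z + k) ^ k"
      using K by (simp add: card_Diff_subset Int_absorb2)
    also have "\<dots> = real m ^ (n - k) * (m * (z + k / m)) ^ k"
    proof -
      have "real m * z + k = m * (z + k / m)" using assms by (simp add: field_simps)
      then show ?thesis by (simp only:)
    qed
    also have "\<dots> = N * (z + k / m) ^ k"
      using assms unfolding N_def power_mult_distrib by (simp flip: power_add)
    finally have le: "(\<Sum>\<phi>\<in>?P. z ^ card (\<phi> ` K)) \<le> N * (z + k / m) ^ k" .
    have "0 \<le> (\<Sum>\<phi>\<in>?P. z ^ card (\<phi> ` K))" using assms by (intro sum_nonneg) simp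
    then show "(\<Sum>\<phi>\<in>?P. z ^ card (\<phi> ` K)) * (\<Sum>\<psi>\<in>?P. z ^ card (\<psi> ` K))
        \<le> N * (z + k / m) ^ k * (N * (z + k / m) ^ k)"
      by (intro mult_mono le order_trans[OF _ le])
  qed
  also have "\<dots> = N\<^sup>2 * A"
    by (simp add: A_def power2_eq_square mult_2 power_add)
  finally have S: "(\<Sum>\<phi>\<in>?P. \<Sum>\<psi>\<in>?P. S \<phi> \<psi>) \<le> N\<^sup>2 * A" .
  have "\<exists>\<phi>\<in>?P. \<exists>\<psi>\<in>?P. bad \<phi> + bad \<psi> + S \<phi> \<psi> / (4 * A) < 1"
  proof (rule ccontr)
    assume neg: "\<not> (\<exists>\<phi>\<in>?P. \<exists>\<psi>\<in>?P. bad \<phi> + bad \<psi> + S \<phi> \<psi> / (4 * A) < 1)"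
    have "1 \<le> bad \<phi> + bad \<psi> + S \<phi> \<psi> / (4 * A)" if "\<phi> \<in> ?P" "\<psi> \<in> ?P" for \<phi> \<psi>
      by (rule leI) (use neg that in blast)
    then have "(\<Sum>\<phi>\<in>?P. \<Sum>\<psi>\<in>?P. 1) \<le> (\<Sum>\<phi>\<in>?P. \<Sum>\<psi>\<in>?P. bad \<phi> + bad \<psi> + S \<phi> \<psi> / (4 * A))"
      by (intro sum_mono)
    also have "\<dots> = (\<Sum>\<phi>\<in>?P. \<Sum>\<psi>\<in>?P. bad \<phi>) + (\<Sum>\<phi>\<in>?P. \<Sum>\<psi>\<in>?P. bad \<psi>)
        + (\<Sum>\<phi>\<in>?P. \<Sum>\<psi>\<in>?P. S \<phi> \<psi>) / (4 * A)"
      by (simp only: sum.distrib sum_divide_distrib)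
    also have "\<dots> = N * sum bad ?P + N * sum bad ?P + (\<Sum>\<phi>\<in>?P. \<Sum>\<psi>\<in>?P. S \<phi> \<psi>) / (4 * A)"
      using cP by (simp add: sum_distrib_left)
    also have "\<dots> \<le> N * (N / 8) + N * (N / 8) + N\<^sup>2 * A / (4 * A)"
      using bad S N0 A0 by (intro add_mono mult_left_mono divide_right_mono) auto
    also have "\<dots> < N\<^sup>2" using N0 A0 by (simp add: power2_eq_square)
    finally show False using cP by (simp add: power2_eq_square)
  qed
  then obtain \<phi> \<psi> where fp: "\<phi> \<in> ?P" "\<psi> \<in> ?P" "bad \<phi> + bad \<psi> + S \<phi> \<psi> / (4 * A) < 1" by blast
  have S0: "0 \<le> S \<phi> \<psi> / (4 * A)" using assms A0 by (auto simp: S_def intro!: sum_nonneg divide_nonneg_pos)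
  then have good: "bad \<phi> = 0" "bad \<psi> = 0"
    using fp(3) by (auto simp: bad_def of_bool_def split: if_splits)
  have *: "real (card {x\<in>{..<n}. f x = u}) \<le> F" if "f \<in> ?P" "bad f = 0" for f u
  proof (cases "u < m")
    case True
    then show ?thesis using that(2) by (auto simp: bad_def of_bool_def not_less split: if_splits)
  next
    case False
    then have "{x\<in>{..<n}. f x = u} = {}" using that(1) by (auto simp: PiE_def Pi_def)
    then show ?thesis using assms by (simp only: card.empty)
  qed
  have "S \<phi> \<psi> \<le> 4 * A" using fp(3) good A0 by (simp add: field_simps)
  then show ?thesis
    using fp(1,2) good * unfolding S_def A_def by (intro exI[of _ \<phi>] exI[of _ \<psi>]) (auto simp: PiE_def Pi_def)
qed

section \<open>Choice of the parameters\<close>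

text \<open>The estimate x^x / x! <= exp x, obtained by keeping a single term of the exponential
  series.\<close>

lemma power_over_fact_le: "c ^ x / fact x \<le> (exp 1 * c / real x) ^ x" if "0 \<le> c" for c :: real
proof (cases "x = 0")
  case False
  have "real x ^ x / fact x \<le> (\<Sum>j. real x ^ j / fact j)"
    using summable_exp[of "real x"]
    by (intro sum_le_suminf[of "\<lambda>j. real x ^ j / fact j" "{x}", simplified]) (auto simp: field_simps)
  also have "\<dots> = exp (real x)" by (simp add: exp_def field_simps)
  also have "\<dots> = exp 1 ^ x" by (simp flip: exp_of_nat_mult)
  finally have "real x ^ x / fact x \<le> exp 1 ^ x" .
  then have "c ^ x / real x ^ x * (real x ^ x / fact x) \<le> c ^ x / real x ^ x * exp 1 ^ x"
    using that by (intro mult_left_mono) auto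
  then show ?thesis using False by (simp add: power_mult_distrib power_divide field_simps)
qed simp

lemma binomial_le_exp_power: "real (n choose k) \<le> (exp 1 * n / k) ^ k"
proof -
  have "real ((n choose k) * fact k) \<le> real (n ^ k)"
    by (intro of_nat_mono binomial_fact_pow)
  then have "real (n choose k) \<le> real n ^ k / fact k" by (simp add: field_simps)
  then show ?thesis using power_over_fact_le[of "real n" k] by simp
qed

text \<open>The lower-tail bound is used with exponent 8: the rate then loses only a thousandth,
  while the cost 32 x stays small because \<open>x\<close> is a tiny multiple of k L.\<close>

lemma exp_neg_8_le: "exp (- 8) \<le> (1 / 1000 :: real)"
proof -
  have "(5 / 2 :: real) \<le> exp 1" using exp_lower_Taylor_quadratic[of "1 :: real"] by simp
  then have "(5 / 2 :: real) ^ 8 \<le> exp 1 ^ 8" by (intro power_mono) auto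
  also have "\<dots> = exp 8" by (simp flip: exp_of_nat_mult)
  finally have "1000 \<le> exp (8 :: real)" by (simp add: power_numeral_reduce)
  then show ?thesis by (simp add: exp_minus field_simps)
qed

text \<open>With \<open>\<alpha> = a / k\<close> and \<open>\<beta> = b / k\<close> this says
  \<open>1.2324 \<alpha>\<^sup>2 - 0.534 (1 - \<beta>) - (\<alpha> + \<beta> - 1) > 0\<close> with room to spare; the left-hand side decreases in
  \<open>\<beta>\<close>, and for \<open>\<beta> = \<alpha>\<close> it is a quadratic of negative discriminant.\<close>

lemma key_inequality:
  fixes a b k L p D \<eta> x :: real
  assumes ab: "0 \<le> b" "b \<le> a" "a \<le> k" and L: "0 < L" and k: "0 < k"
    and pk: "12337 / 10000 * L \<le> p * k" "p * k \<le> 146 / 100 * L"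
    and pD: "p * D \<le> 534 / 1000 * L" and p: "0 \<le> p" and D: "0 \<le> D"
    and x: "x \<le> 11 / 100000 * k * L"
  shows "8 * (4 * x) - p * (1 - exp (- 8)) * ((a\<^sup>2 - D * (k - b) - 8 * (1 / 1000) * k\<^sup>2) / 2)
    \<le> - ((a + b - k) * L / 2) - 1 / 250 * k * L"
proof -
  define e where "e = 1 - exp (- 8 :: real)"
  have e: "999 / 1000 \<le> e" "e \<le> 1" using exp_neg_8_le by (auto simp: e_def)
  \<comment> \<open>The constants in the hypotheses are 1.2337 = 0.73 * 1.69 and 1.46 = 0.73 * 2,
    from density times set size, and 0.534, which rounds up 0.73^2 * 1.002.\<close>
  have "999 / 1000 * (12337 / 10000 * L) \<le> e * (p * k)"
    by (rule mult_mono) (use e pk L in auto)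
  then have epk: "12324 / 10000 * L \<le> e * (p * k)" using L by linarith
  have "e * (p * D) \<le> 1 * (534 / 1000 * L)"
    by (rule mult_mono) (use e pD p D in auto)
  then have epD: "e * (p * D) \<le> 534 / 1000 * L" by simp
  have "e * (p * k) \<le> 1 * (146 / 100 * L)" by (rule mult_mono) (use e pk p k in auto)
  then have epk': "e * (p * k) \<le> 146 / 100 * L" by simp
  have 1: "12324 / 10000 * L * a\<^sup>2 \<le> e * (p * k) * a\<^sup>2" using epk by (intro mult_right_mono) auto
  have 2: "e * (p * D) * (k * (k - b)) \<le> 534 / 1000 * L * (k * (k - b))"
    using epD ab k by (intro mult_right_mono) auto
  have 3: "e * (p * k) * (8 / 1000 * k\<^sup>2) \<le> 146 / 100 * L * (8 / 1000 * k\<^sup>2)"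
    using epk' by (intro mult_right_mono) auto
  have 4: "64 * x * k \<le> 64 * (11 / 100000 * k * L) * k" by (rule mult_right_mono) (use x k in linarith)+
  \<comment> \<open>Here 1.466 = 2 - 0.534 and 0.466 = 1 - 0.534. The three subtracted numbers are
    1.46 * 0.008 for the linked-pair error, 64 * 0.00011 for the edges wanted and 2 / 250 for the
    slack. Completing the square needs only 0.436 of the remaining 0.439.\<close>
  have 5: "0 \<le> 12324 / 10000 * a\<^sup>2 - 1466 / 1000 * (a * k) + (466 / 1000 - 1168 / 100000 - 704 / 100000 - 8 / 1000) * k\<^sup>2"
  proof -
    have "0 \<le> 12324 / 10000 * (a - 733 / 1232.4 * k)\<^sup>2" by simp
    also have "\<dots> = 12324 / 10000 * a\<^sup>2 - 1466 / 1000 * (a * k) + 537289 / 1232400 * k\<^sup>2"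
      by (simp add: power2_eq_square algebra_simps)
    also have "\<dots> \<le> 12324 / 10000 * a\<^sup>2 - 1466 / 1000 * (a * k)
        + (466 / 1000 - 1168 / 100000 - 704 / 100000 - 8 / 1000) * k\<^sup>2"
      by (intro add_left_mono mult_right_mono) auto
    finally show ?thesis .
  qed
  have "0 \<le> 12324 / 10000 * a\<^sup>2 - 534 / 1000 * (k * (k - b)) - 8 / 1000 * (146 / 100) * k\<^sup>2
      - 64 * (11 / 100000) * k\<^sup>2 - (a + b - k) * k - 8 / 1000 * k\<^sup>2"
  proof -
    \<comment> \<open>The coefficient of b k is -(1 - 0.534), so replacing \<open>b\<close> by the
      larger \<open>a\<close> is the worst case.\<close>
    have le: "b * k \<le> a * k" using ab k by (intro mult_right_mono) auto
    have eqs: "(a + b - k) * k = a * k + b * k - k\<^sup>2" "k * (k - b) = k\<^sup>2 - b * k"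
      by (simp_all add: power2_eq_square algebra_simps)
    show ?thesis unfolding eqs using 5 le by (simp add: field_simps)
  qed
  then have "0 \<le> L * (12324 / 10000 * a\<^sup>2 - 534 / 1000 * (k * (k - b)) - 8 / 1000 * (146 / 100) * k\<^sup>2
      - 64 * (11 / 100000) * k\<^sup>2 - (a + b - k) * k - 8 / 1000 * k\<^sup>2)"
    using L by simp
  then have 6: "0 \<le> 12324 / 10000 * L * a\<^sup>2 - 534 / 1000 * L * (k * (k - b)) - 146 / 100 * L * (8 / 1000 * k\<^sup>2)
      - 64 * (11 / 100000 * k * L) * k - (a + b - k) * k * L - 8 / 1000 * L * k\<^sup>2"
    by (simp add: power2_eq_square algebra_simps)
  have "0 \<le> e * (p * k) * a\<^sup>2 - e * (p * D) * (k * (k - b)) - e * (p * k) * (8 / 1000 * k\<^sup>2)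
      - 64 * x * k - (a + b - k) * k * L - 8 / 1000 * L * k\<^sup>2"
    using 1 2 3 4 6 by linarith
  also have "\<dots> = k * (p * e * (a\<^sup>2 - D * (k - b) - 8 * (1 / 1000) * k\<^sup>2)
      - 64 * x - (a + b - k) * L - 8 / 1000 * k * L)"
    by (simp add: power2_eq_square algebra_simps)
  finally have "0 \<le> p * e * (a\<^sup>2 - D * (k - b) - 8 * (1 / 1000) * k\<^sup>2)
      - 64 * x - (a + b - k) * L - 8 / 1000 * k * L"
    using k by (simp add: zero_le_mult_iff)
  then show ?thesis unfolding e_def[symmetric] by (simp add: field_simps)
qed

text \<open>The base density is \<open>0.73 sqrt (L / n)\<close>: a \<open>k\<close>-set with injective images then avoids one colour
  with small enough probability for the union bound, while the neighbourhoods, of size about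
  \<open>0.73 S\<close>, stay well below \<open>k / 2\<close>.\<close>

lemma exists_locally_dense_triangle_free_graph_explicit:
  fixes n k :: nat and L S :: real
  defines "L \<equiv> ln (real n)" and "S \<equiv> sqrt (real n * ln (real n))"
  assumes L: "10000 * exp 30001 \<le> L" and n1: "ln (real n + 1) \<le> 11 / 10 * L"
    and k: "169 / 100 * S \<le> k" "k \<le> 2 * S"
    and e1: "n * exp (- (73 / 100 * sqrt (L / n) * (n / L\<^sup>2 - 1))) \<le> 1 / 32"
    and e2: "n * exp (- (73 / 100000000 * S / (4 * L\<^sup>2))) \<le> 1 / 32"
    and e3: "(real n)\<^sup>2 * exp (- 4 * L) \<le> 1 / 32"
    and e4: "4 * L\<^sup>2 \<le> 169 / 100000 * S"
    and e5: "(4 * L + 1) * (4 * L\<^sup>2) * (64000 * L ^ 3 + 1)\<^sup>2 \<le> 169 / 100000 * S"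
    and e6: "n * exp (2 * n / (n / L\<^sup>2 - 1) - 4 * L\<^sup>2) \<le> 1 / 8"
    and e7: "(exp 1 * n / (169 / 100 * S)) * (exp (- L / 2) + 2 * S / (n / L\<^sup>2 - 1))\<^sup>2 * exp (L / 2 - L / 250) \<le> exp (- 1)"
    and e8: "2 * S \<le> n" and e9: "2 \<le> n / L\<^sup>2"
  shows "\<exists>G\<subseteq>nsets {..<n} 2. \<not> has_triangle G \<and> (\<forall>K\<in>nsets {..<n} k. k * L / 10000 \<le> real (card {e \<in> G. e \<subseteq> K}))"
proof -
  define m where "m = nat \<lfloor>n / L\<^sup>2\<rfloor>"
  define p where "p = 73 / 100 * sqrt (L / n)"
  \<comment> \<open>The small factor 1 / 10000 keeps the cost of demanding \<open>x\<close> edges,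
    rather than one, inside the slack of \<open>key_inequality\<close>.\<close>
  define x where "x = nat \<lceil>k * L / 10000\<rceil>"
  define s where "s = nat \<lceil>4 * L\<rceil>"
  define \<eta> :: real where "\<eta> = 1 / 1000"
  define F where "F = 4 * L\<^sup>2"
  \<comment> \<open>Chosen to give 8 L F T = \<eta> k exactly; the value of \<mu> below then gives
    \<mu> T F = 1.\<close>
  define T where "T = \<eta> * k / (32 * L ^ 3)"
  define \<mu> where "\<mu> = 8 * L / (\<eta> * k)"
  define D where "D = (1 + 2 * \<eta>) * (p * real n)"
  define z where "z = exp (- L / 2)"
  define W where "W = 4 * ((n choose k) * (z + k / m) ^ (2 * k))"
  have L7: "10000000 \<le> L"
  proof -
    have "(1000 :: real) \<le> exp 30001" using exp_ge_add_one_self[of 30001] by linarith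
    then show ?thesis using L by linarith
  qed
  have L0: "0 < L" using L7 by linarith
  have n0: "0 < real n" using L0 by (cases "n = 0") (auto simp: L_def)
  have S0: "0 < S" using L0 n0 by (simp add: S_def L_def)
  have S2: "S * S = n * L" using L0 n0 by (simp add: S_def L_def)
  have k0: "0 < real k" using k S0 by linarith
  have S1: "1 \<le> S"
  proof -
    have "1 * 1 \<le> L * L" using L7 by (intro mult_mono) auto
    then show ?thesis using e4 by (simp add: power2_eq_square)
  qed
  have m: "n / L\<^sup>2 - 1 \<le> m" "m \<le> n / L\<^sup>2" "0 < m"
    using e9 unfolding m_def by linarith+
  have mn: "real m \<le> n"
  proof -
    have "1 \<le> L\<^sup>2" using L7 by (simp add: one_le_power)
    then have "n / L\<^sup>2 \<le> n / 1" using n0 by (intro divide_left_mono) auto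
    then show ?thesis using m by simp
  qed
  have p0: "0 \<le> p" using L0 n0 by (simp add: p_def)
  have pS: "p * S = 73 / 100 * L"
    using L0 n0 by (simp add: p_def S_def L_def real_sqrt_mult real_sqrt_divide)
  have pn: "p * n = 73 / 100 * S"
    using L0 n0 by (simp add: p_def S_def L_def real_sqrt_mult real_sqrt_divide field_simps)
  have p2n: "p\<^sup>2 * n = 5329 / 10000 * L"
    using L0 n0 by (simp add: p_def power_mult_distrib power2_eq_square)
  have pk: "12337 / 10000 * L \<le> p * k" "p * k \<le> 146 / 100 * L"
    using mult_left_mono[OF k(1) p0] mult_left_mono[OF k(2) p0] pS by auto
  have p1: "p \<le> 1"
  proof -
    have "p * S \<le> 1 * S" using pS L7 e4
      by (simp add: power2_eq_square) (smt (verit, best) L0 mult_less_cancel_right1)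
    then show ?thesis using S0 by simp
  qed
  have kS: "169 / 100000 * S \<le> \<eta> * k" using k by (simp add: \<eta>_def)
  have mp2: "m * p\<^sup>2 \<le> 5329 / 10000 / L"
  proof -
    have "m * p\<^sup>2 \<le> n / L\<^sup>2 * p\<^sup>2" using m by (intro mult_right_mono) auto
    also have "\<dots> = (p\<^sup>2 * n) / L\<^sup>2" by simp
    also have "\<dots> = 5329 / 10000 / L" unfolding p2n using L0 by (simp add: power2_eq_square field_simps)
    finally show ?thesis .
  qed
  have kL: "10000000 \<le> k * L"
  proof -
    have "1 * 10000000 \<le> k * L" using k S1 L7 by (intro mult_mono) auto
    then show ?thesis by simp
  qed
  have x: "k * L / 10000 \<le> x" "x \<le> 11 / 100000 * k * L"
    using kL unfolding x_def by linarith+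
  have n1k: "(real n + 1) ^ k \<le> exp (11 / 10 * (k * L))"
  proof -
    have "(real n + 1) ^ k = exp (k * ln (real n + 1))"
      using n0 by (simp add: exp_of_nat_mult)
    also have "\<dots> \<le> exp (k * (11 / 10 * L))" using mult_left_mono[OF n1, of "real k"] by simp
    finally show ?thesis by (simp add: mult_ac)
  qed
  have exp32: "exp y \<le> 1 / 32" if "y \<le> - 5" for y :: real
  proof -
    have "(2 :: real) ^ 5 \<le> exp 1 ^ 5" using exp_ge_add_one_self[of 1] by (intro power_mono) auto
    also have "\<dots> = exp 5" by (simp flip: exp_of_nat_mult)
    finally have "32 \<le> exp (5 :: real)" by simp
    then have "exp (- 5 :: real) \<le> 1 / 32" by (simp add: exp_minus field_simps)
    moreover have "exp y \<le> exp (- 5)" using that by simp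
    ultimately show ?thesis by linarith
  qed
  interpret two_bites n m k s x p L \<eta> F T D \<mu> 8 "1 / 250" W
  proof
    show "0 \<le> p" "p \<le> 1" by fact+
    show "D = (1 + 2 * \<eta>) * (p * real n)" by (rule D_def)
    show "0 < \<eta>" "\<eta> \<le> 1" by (auto simp: \<eta>_def)
    show "0 < T" using k0 L0 by (simp add: T_def \<eta>_def)
    have L3: "1 \<le> 32 * L ^ 3" using L7 one_le_power[of L 3] by linarith
    show "T \<le> \<eta> * k"
    proof -
      have "\<eta> * k / (32 * L ^ 3) \<le> \<eta> * k / 1"
        by (rule divide_left_mono[OF L3]) (use L3 L0 k0 in \<open>auto simp: \<eta>_def\<close>)
      then show ?thesis by (simp add: T_def)
    qed
    show "8 * L * F * T \<le> \<eta> * k"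
      unfolding T_def F_def using L0 by (simp add: power2_eq_square power3_eq_cube)
    have L2: "1 \<le> L\<^sup>2" using L7 by (simp add: one_le_power)
    then show "1 \<le> F" by (simp add: F_def)
    show "D \<le> k" using k S0 unfolding D_def pn by (simp add: \<eta>_def)
    show "F \<le> \<eta> * k" using e4 kS by (simp add: F_def)
    show "2 / \<eta> * (3 * (p * m)) \<le> \<eta> * k"
    proof -
      have "p * m \<le> p * (n / L\<^sup>2)" using m p0 by (intro mult_left_mono)
      also have "\<dots> = (p * n) / L\<^sup>2" by simp
      also have "\<dots> = 73 / 100 * S / L\<^sup>2" by (simp only: pn)
      also have "\<dots> \<le> 73 / 100 * S / 10000000"
      proof (intro divide_left_mono)
        have "10000000 * 1 \<le> L * L" using L7 by (intro mult_mono) auto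
        then show "10000000 \<le> L\<^sup>2" by (simp add: power2_eq_square)
      qed (use S0 L0 in auto)
      finally have "6000 * (p * m) \<le> 169 / 100000 * S" using S0 by linarith
      then show ?thesis using kS by (simp add: \<eta>_def)
    qed
    show "s * F * (2 * k / T + 1)\<^sup>2 \<le> \<eta> * k"
    proof -
      have eq: "2 * k / T = 64000 * L ^ 3" using k0 L0 by (simp add: T_def \<eta>_def field_simps)
      moreover have "s \<le> 4 * L + 1" using L0 unfolding s_def by linarith
      ultimately have "s * F * (2 * k / T + 1)\<^sup>2 \<le> (4 * L + 1) * (4 * L\<^sup>2) * (64000 * L ^ 3 + 1)\<^sup>2"
        unfolding F_def eq by (intro mult_right_mono) auto
      then show ?thesis using e5 kS by linarith
    qed
    show "0 \<le> \<mu>" using L0 k0 by (simp add: \<mu>_def \<eta>_def)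
    show "\<mu> * T * F \<le> 1"
      unfolding \<mu>_def T_def F_def using k0 L0 by (simp add: \<eta>_def field_simps power2_eq_square power3_eq_cube)
    show "p * \<mu> * T * k \<le> 1"
    proof -
      have "p * \<mu> * T * k = p * k / (4 * L\<^sup>2)"
        unfolding \<mu>_def T_def using k0 L0 by (simp add: \<eta>_def field_simps power2_eq_square power3_eq_cube)
      also have "\<dots> \<le> 146 / 100 * L / (4 * L\<^sup>2)" using pk by (intro divide_right_mono) auto
      also have "\<dots> \<le> 1" using L0 L7 by (simp add: field_simps power2_eq_square)
      finally show ?thesis .
    qed
    show "m * exp (- (p * m)) \<le> 1 / 32"
    proof -
      have "p * (n / L\<^sup>2 - 1) \<le> p * m" using m p0 by (intro mult_left_mono)
      then have "m * exp (- (p * m)) \<le> n * exp (- (p * (n / L\<^sup>2 - 1)))"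
        using mn by (intro mult_mono) auto
      then show ?thesis using e1 by (simp add: p_def)
    qed
    show "m * exp (- (\<eta>\<^sup>2 * p * n / F)) \<le> 1 / 32"
    proof -
      have eq: "\<eta>\<^sup>2 * p * n / F = 73 / 100000000 * S / (4 * L\<^sup>2)"
      proof -
        have "\<eta>\<^sup>2 * p * n / F = (1 / 1000)\<^sup>2 * (p * n) / (4 * L\<^sup>2)"
          by (simp only: \<eta>_def F_def mult.assoc)
        then show ?thesis unfolding pn by (simp add: power2_eq_square)
      qed
      have "m * exp (- (73 / 100000000 * S / (4 * L\<^sup>2))) \<le> n * exp (- (73 / 100000000 * S / (4 * L\<^sup>2)))"
        using mn by (intro mult_right_mono) auto
      then show ?thesis unfolding eq using e2 by linarith
    qed
    show "real m ^ 2 * (m * p\<^sup>2) ^ s \<le> 1 / 32"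
    proof -
      \<comment> \<open>The expected codegree is O(1 / L); already a bound exp (-1) suffices, as
        \<open>s\<close> >= 4 L such factors beat the m^2 pairs.\<close>
      have "m * p\<^sup>2 \<le> exp (- 1)"
      proof -
        have "5329 / 10000 / L \<le> 1 / 3" using L7 by (simp add: field_simps)
        also have "1 / 3 \<le> exp (- 1 :: real)" using exp_le by (simp add: exp_minus field_simps)
        finally show ?thesis using mp2 by linarith
      qed
      then have "(m * p\<^sup>2) ^ s \<le> exp (- 1) ^ s" by (intro power_mono) auto
      also have "\<dots> = exp (- real s)" by (simp flip: exp_of_nat_mult)
      also have "\<dots> \<le> exp (- 4 * L)" unfolding s_def by simp linarith
      finally have "(m * p\<^sup>2) ^ s \<le> exp (- 4 * L)" .
      then have "real m ^ 2 * (m * p\<^sup>2) ^ s \<le> real n ^ 2 * exp (- 4 * L)"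
        using mn by (intro mult_mono power_mono) auto
      then show ?thesis using e3 by linarith
    qed
    show "(real n + 1) ^ k * exp (p * real k ^ 2 - 4 * (k * L)) \<le> 1 / 32"
    proof -
      have "(real n + 1) ^ k * exp (p * real k ^ 2 - 4 * (k * L))
          \<le> exp (11 / 10 * (k * L)) * exp (p * real k ^ 2 - 4 * (k * L))"
        using n1k by (intro mult_right_mono) auto
      also have "\<dots> = exp (11 / 10 * (k * L) + k * (p * k) - 4 * (k * L))"
        by (simp add: mult_exp_exp power2_eq_square mult_ac add_diff_eq)
      also have "\<dots> \<le> 1 / 32"
      proof (rule exp32)
        have "k * (p * k) \<le> k * (146 / 100 * L)" using pk by (intro mult_left_mono) auto
        also have "k * (146 / 100 * L) = 146 / 100 * (k * L)" by simp
        finally show "11 / 10 * (k * L) + k * (p * k) - 4 * (k * L) \<le> - 5" using kL by linarith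
      qed
      finally show ?thesis .
    qed
    show "(real n + 1) ^ k * exp (\<mu> * (real k ^ 2 * p\<^sup>2 * m * exp 4 - \<eta> * real k ^ 2)) \<le> 1 / 32"
    proof -
      have e4: "exp 4 \<le> (81 :: real)"
      proof -
        have "exp 1 ^ 4 \<le> (3 :: real) ^ 4" using exp_le by (intro power_mono) auto
        then show ?thesis by (simp flip: exp_of_nat_mult)
      qed
      \<comment> \<open>The moment term uses up at most half of the allowance \<eta> k^2. The other
        half, multiplied by \<mu>, is 4 k L, which outweighs the number of sets.\<close>
      have "m * p\<^sup>2 * exp 4 \<le> 5329 / 10000 / L * 81"
        using mp2 e4 L0 by (intro mult_mono) auto
      also have "\<dots> \<le> \<eta> / 2" using L7 by (simp add: \<eta>_def field_simps)
      finally have "real k ^ 2 * (m * p\<^sup>2 * exp 4 - \<eta>) \<le> real k ^ 2 * (- \<eta> / 2)"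
        by (intro mult_left_mono) auto
      then have "\<mu> * (real k ^ 2 * (m * p\<^sup>2 * exp 4 - \<eta>)) \<le> \<mu> * (real k ^ 2 * (- \<eta> / 2))"
        by (rule mult_left_mono) (use L0 k0 in \<open>auto simp: \<mu>_def \<eta>_def\<close>)
      also have "\<dots> = - 4 * (k * L)" using k0 by (simp add: \<mu>_def \<eta>_def power2_eq_square field_simps)
      finally have "\<mu> * (real k ^ 2 * p\<^sup>2 * m * exp 4 - \<eta> * real k ^ 2) \<le> - 4 * (k * L)"
        by (simp add: algebra_simps)
      then have "(real n + 1) ^ k * exp (\<mu> * (real k ^ 2 * p\<^sup>2 * m * exp 4 - \<eta> * real k ^ 2))
          \<le> exp (11 / 10 * (k * L)) * exp (- 4 * (k * L))"
        using n1k by (intro mult_mono) auto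
      also have "\<dots> = exp (11 / 10 * (k * L) + (- 4 * (k * L)))" by (simp only: exp_add)
      also have "\<dots> \<le> 1 / 32" using kL by (intro exp32) linarith
      finally show ?thesis .
    qed
    show "(real m + 1) ^ k * ((real k ^ 2 * m * p ^ 3) ^ x / fact x) \<le> 1 / 32"
    proof -
      have x0: "0 < real x" using x(1) kL by linarith
      have "real k ^ 2 * m * p ^ 3 = (p * k) * (m * p\<^sup>2) * k"
        by (simp add: power2_eq_square power3_eq_cube)
      also have "\<dots> \<le> (146 / 100 * L) * (5329 / 10000 / L) * k"
        by (rule mult_right_mono[OF mult_mono[OF pk(2) mp2]]) (use L0 in auto)
      also have "\<dots> \<le> k" using L0 by simp
      finally have base: "real k ^ 2 * m * p ^ 3 \<le> k" .
      have base0: "0 \<le> real k ^ 2 * m * p ^ 3" using p0 by simp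
      have "(real k ^ 2 * m * p ^ 3) ^ x / fact x \<le> real k ^ x / fact x"
        using base base0 by (intro divide_right_mono power_mono) auto
      also have "\<dots> \<le> (exp 1 * real k / real x) ^ x" by (rule power_over_fact_le) simp
      \<comment> \<open>Since x >= k L / 10000, a base of exp (-30000) is what yields exp (-3 k L);
        this dictates the lower bound 10000 exp 30001 on \<open>L\<close>.\<close>
      also have "\<dots> \<le> exp (- 30000) ^ x"
      proof (intro power_mono)
        have "exp 1 * real k / real x \<le> exp 1 * real k / (k * L / 10000)"
          using x(1) x0 k0 L0 by (intro divide_left_mono) auto
        also have "\<dots> = exp 1 * 10000 / L" using k0 by (simp add: field_simps)
        also have "\<dots> \<le> exp 1 * 10000 / (10000 * exp 30001)"
          using L L0 by (intro divide_left_mono) auto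
        also have "\<dots> = exp (- 30000)" by (simp add: field_simps flip: exp_add)
        finally show "exp 1 * real k / real x \<le> exp (- 30000)" .
      qed auto
      also have "\<dots> = exp (- 30000 * real x)" by (simp add: mult.commute flip: exp_of_nat_mult)
      also have "\<dots> \<le> exp (- 3 * (k * L))" unfolding exp_le_cancel_iff using x(1) by linarith
      finally have 1: "(real k ^ 2 * m * p ^ 3) ^ x / fact x \<le> exp (- 3 * (k * L))" .
      have "(real m + 1) ^ k \<le> (real n + 1) ^ k" using mn by (intro power_mono) auto
      then have "(real m + 1) ^ k \<le> exp (11 / 10 * (k * L))" using n1k by linarith
      then have "(real m + 1) ^ k * ((real k ^ 2 * m * p ^ 3) ^ x / fact x)
          \<le> exp (11 / 10 * (k * L)) * exp (- 3 * (k * L))"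
        using 1 base0 by (intro mult_mono) auto
      also have "\<dots> = exp (11 / 10 * (k * L) + (- 3 * (k * L)))" by (simp only: exp_add)
      also have "\<dots> \<le> 1 / 32" using kL by (intro exp32) linarith
      finally show ?thesis .
    qed
    show "0 \<le> (8 :: real)" by simp
    show "8 * real (4 * x) - p * (1 - exp (- 8)) * ((a\<^sup>2 - D * (real k - b) - 8 * \<eta> * real k ^ 2) / 2)
        \<le> - ((a + b - real k) * L / 2) - 1 / 250 * real k * L"
      if "0 \<le> b" "b \<le> a" "a \<le> real k" for a b :: real
    proof -
      have "p * D = (1 + 2 * \<eta>) * (p\<^sup>2 * n)" by (simp add: D_def power2_eq_square)
      then have pD: "p * D \<le> 534 / 1000 * L" using L0 unfolding p2n by (simp add: \<eta>_def)
      have D0: "0 \<le> D" using p0 by (simp add: D_def \<eta>_def)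
      show ?thesis
        using key_inequality[OF that L0 k0 pk pD p0 D0 x(2)] by (simp add: \<eta>_def)
    qed
    show "W * exp (k * L / 2 - 1 / 250 * k * L) \<le> 1 / 8"
    proof -
      \<comment> \<open>Up to powers of \<open>L\<close> this is n^(-1/2): the factor n / k is of
        order sqrt n, and z + k / m of order 1 / sqrt n. Against exp (L / 2) the slack exp (-L /
        250) decides.\<close>
      define A where "A = (exp 1 * n / (169 / 100 * S)) * (exp (- L / 2) + 2 * S / (n / L\<^sup>2 - 1))\<^sup>2"
      have A0: "0 \<le> A" using S0 by (simp add: A_def)
      have "real (n choose k) * (z + k / m) ^ (2 * k) \<le> (exp 1 * n / k) ^ k * ((z + k / m)\<^sup>2) ^ k"
        unfolding power_mult by (intro mult_right_mono binomial_le_exp_power) auto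
      also have "\<dots> = (exp 1 * n / k * (z + k / m)\<^sup>2) ^ k" by (simp only: power_mult_distrib)
      also have "\<dots> \<le> A ^ k"
      proof (intro power_mono)
        have "exp 1 * n / k \<le> exp 1 * n / (169 / 100 * S)"
          using k S0 k0 by (intro divide_left_mono) auto
        moreover have "k / m \<le> 2 * S / (n / L\<^sup>2 - 1)"
          using k m e9 S0 by (intro frac_le) auto
        then have "(z + k / m)\<^sup>2 \<le> (exp (- L / 2) + 2 * S / (n / L\<^sup>2 - 1))\<^sup>2"
          by (intro power_mono add_mono) (auto simp: z_def)
        ultimately show "exp 1 * n / k * (z + k / m)\<^sup>2 \<le> A"
          unfolding A_def using S0 by (intro mult_mono) auto
      qed simp
      finally have "W \<le> 4 * A ^ k" by (simp add: W_def)
      moreover have "k * L / 2 - 1 / 250 * k * L = k * (L / 2 - L / 250)" by (simp add: algebra_simps)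
      ultimately have "W * exp (k * L / 2 - 1 / 250 * k * L) \<le> 4 * A ^ k * exp (k * (L / 2 - L / 250))"
        by (simp only: mult_right_mono exp_ge_zero)
      also have "\<dots> = 4 * (A * exp (L / 2 - L / 250)) ^ k"
        by (simp only: power_mult_distrib exp_of_nat_mult mult.assoc)
      also have "\<dots> \<le> 4 * exp (- 1) ^ k"
      proof (intro mult_left_mono power_mono)
        show "A * exp (L / 2 - L / 250) \<le> exp (- 1)" using e7 by (simp only: A_def)
        show "0 \<le> A * exp (L / 2 - L / 250)" using A0 by simp
      qed simp
      also have "\<dots> = 4 * exp (- real k)" by (simp flip: exp_of_nat_mult)
      also have "\<dots> \<le> 4 * (1 / 32)"
      proof (intro mult_left_mono exp32)
        have "1 * 1 \<le> L * L" using L7 by (intro mult_mono) auto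
        then have "4 \<le> \<eta> * k" using e4 kS by (simp add: power2_eq_square)
        then show "- real k \<le> - 5" by (simp add: \<eta>_def)
      qed simp
      finally show ?thesis by simp
    qed
  qed
  have "real k \<le> real n" using k e8 by linarith
  then have kn: "k \<le> n" by simp
  \<comment> \<open>A fibre has mean size about L^2, so 2 n / m is about 2 L^2; taking F = 4 L^2
    leaves roughly exp (-2 L^2) against the number of fibres.\<close>
  have fib: "m * exp (2 * n / m - F) \<le> 1 / 8"
  proof -
    have "2 * n / m \<le> 2 * n / (n / L\<^sup>2 - 1)" using m e9 by (intro divide_left_mono) auto
    then have "m * exp (2 * n / m - F) \<le> n * exp (2 * n / (n / L\<^sup>2 - 1) - F)"
      using mn by (intro mult_mono) auto
    then show ?thesis using e6 by (simp add: F_def)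
  qed
  have zz: "z ^ i * z ^ j = exp (- (L / 2) * (real i + real j))" for i j
    by (simp add: z_def algebra_simps flip: exp_of_nat_mult exp_add)
  obtain \<phi> \<psi> where \<phi>: "balanced \<phi>" and \<psi>: "balanced \<psi>"
    and w: "(\<Sum>K\<in>nsets {..<n} k. exp (- (L / 2) * (real (card (\<phi> ` K)) + real (card (\<psi> ` K))))) \<le> W"
    using exists_balanced_maps[OF m(3) _ kn _ fib, of z] unfolding balanced_def W_def zz
    by (auto simp: z_def F_def)
  obtain G where G: "G \<subseteq> nsets {..<n} 2" "\<not> has_triangle G" "\<forall>K\<in>nsets {..<n} k. x \<le> card {e \<in> G. e \<subseteq> K}"
    using exists_locally_dense_triangle_free_graph[OF \<phi> \<psi> w] by blast
  have "k * L / 10000 \<le> real (card {e \<in> G. e \<subseteq> K})" if "K \<in> nsets {..<n} k" for K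
    using G(3) that x(1) by (meson of_nat_le_iff order_trans)
  then show ?thesis using G by blast
qed

section \<open>Extracting the purple edges\<close>

text \<open>The delicate side condition is \<open>e7\<close>, where powers of ln n are beaten by
  n^(-1/250) alone.\<close>

lemma eventually_locally_dense_triangle_free_graph:
  fixes k :: "nat \<Rightarrow> nat"
  assumes "\<forall>\<^sub>F n in sequentially. 169 / 100 * sqrt (real n * ln (real n)) \<le> k n \<and> k n \<le> 2 * sqrt (real n * ln (real n))"
  shows "\<forall>\<^sub>F n in sequentially. \<exists>G\<subseteq>nsets {..<n} 2. \<not> has_triangle G \<and>
      (\<forall>K\<in>nsets {..<n} (k n). k n * ln (real n) / 10000 \<le> real (card {e \<in> G. e \<subseteq> K}))"
proof -
  have 0: "\<forall>\<^sub>F n in sequentially. C \<le> ln (real n)" for C :: real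
    by real_asymp
  have n1: "\<forall>\<^sub>F n in sequentially. ln (real n + 1) \<le> 11 / 10 * ln (real n)"
    by real_asymp
  have e1: "\<forall>\<^sub>F n in sequentially. n * exp (- (73 / 100 * sqrt (ln n / n) * (n / (ln n)\<^sup>2 - 1))) \<le> 1 / 32"
    by real_asymp
  have e2: "\<forall>\<^sub>F n in sequentially.
      n * exp (- (73 / 100000000 * sqrt (real n * ln (real n)) / (4 * (ln (real n))\<^sup>2))) \<le> 1 / 32"
    by real_asymp
  have e3: "\<forall>\<^sub>F n in sequentially. (real n)\<^sup>2 * exp (- 4 * ln (real n)) \<le> 1 / 32"
    by real_asymp
  have e4: "\<forall>\<^sub>F n in sequentially. 4 * (ln (real n))\<^sup>2 \<le> 169 / 100000 * sqrt (real n * ln (real n))"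
    by real_asymp
  have e5: "\<forall>\<^sub>F n in sequentially. (4 * ln (real n) + 1) * (4 * (ln (real n))\<^sup>2) * (64000 * ln (real n) ^ 3 + 1)\<^sup>2
      \<le> 169 / 100000 * sqrt (real n * ln (real n))"
    by real_asymp
  have e6: "\<forall>\<^sub>F n in sequentially. n * exp (real (2 * n) / (n / (ln (real n))\<^sup>2 - 1) - 4 * (ln (real n))\<^sup>2) \<le> 1 / 8"
    unfolding of_nat_mult by real_asymp
  have e7: "\<forall>\<^sub>F n in sequentially. (exp 1 * n / (169 / 100 * sqrt (real n * ln (real n))))
        * (exp (- ln (real n) / 2) + 2 * sqrt (real n * ln (real n)) / (n / (ln (real n))\<^sup>2 - 1))\<^sup>2
        * exp (ln (real n) / 2 - ln (real n) / 250) \<le> exp (- 1)"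
    by real_asymp
  have e8: "\<forall>\<^sub>F n in sequentially. 2 * sqrt (real n * ln (real n)) \<le> n"
    by real_asymp
  have e9: "\<forall>\<^sub>F n in sequentially. 2 \<le> n / (ln (real n))\<^sup>2"
    by real_asymp
  show ?thesis
    using assms 0[of "10000 * exp 30001"] n1 e1 e2 e3 e4 e5 e6 e7 e8 e9
  proof eventually_elim
    case (elim n)
    then show ?case
      by (intro exists_locally_dense_triangle_free_graph_explicit) simp_all
  qed
qed

text \<open>Averaging over all \<open>k\<close>-sets: an edge lies in
  \<open>(n - 2) choose (k - 2)\<close> of them, and the proportion k (k - 1) / (n (n - 1)) is at
  most (k / n)^2.\<close>

lemma card_edges_ge:
  fixes G :: "nat set set" and x :: real
  assumes G: "G \<subseteq> nsets {..<n} 2" and k: "2 \<le> k" "k \<le> n"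
    and dense: "\<And>K. K \<in> nsets {..<n} k \<Longrightarrow> x \<le> real (card {e \<in> G. e \<subseteq> K})" and x: "0 \<le> x"
  shows "x * (n / k)\<^sup>2 \<le> real (card G)"
proof -
  have finG: "finite G" using G finite_subset finite_imp_finite_nsets by blast
  have cover: "card {K \<in> nsets {..<n} k. e \<subseteq> K} = (n - 2) choose (k - 2)" if "e \<in> G" for e
  proof -
    have e: "e \<subseteq> {..<n}" "finite e" "card e = 2" using that G by (auto simp: nsets_def)
    have "bij_betw (\<lambda>K. K - e) {K \<in> nsets {..<n} k. e \<subseteq> K} (nsets ({..<n} - e) (k - 2))"
    proof (rule bij_betwI[where g = "\<lambda>K. K \<union> e"])
      show "(\<lambda>K. K - e) \<in> {K \<in> nsets {..<n} k. e \<subseteq> K} \<rightarrow> nsets ({..<n} - e) (k - 2)"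
        using e by (auto simp: nsets_def card_Diff_subset)
      show "(\<lambda>K. K \<union> e) \<in> nsets ({..<n} - e) (k - 2) \<rightarrow> {K \<in> nsets {..<n} k. e \<subseteq> K}"
        using e k by (auto simp: nsets_def card_Un_disjoint disjoint_iff subset_iff)
    qed (auto simp: nsets_def)
    then have "card {K \<in> nsets {..<n} k. e \<subseteq> K} = card (nsets ({..<n} - e) (k - 2))"
      by (rule bij_betw_same_card)
    then show ?thesis using e by (simp add: card_Diff_subset)
  qed
  have "x * (n choose k) = (\<Sum>K\<in>nsets {..<n} k. x)" by simp
  also have "\<dots> \<le> (\<Sum>K\<in>nsets {..<n} k. real (card {e \<in> G. e \<subseteq> K}))"
    using dense by (rule sum_mono)
  also have "\<dots> = real (\<Sum>e\<in>G. card {K \<in> nsets {..<n} k. e \<subseteq> K})"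
    using sum_multicount_gen[of "nsets {..<n} k" G "\<lambda>K e. e \<subseteq> K" "\<lambda>e. card {K \<in> nsets {..<n} k. e \<subseteq> K}"] finG
    by (simp add: finite_imp_finite_nsets flip: of_nat_sum)
  also have "\<dots> = real (card G) * ((n - 2) choose (k - 2))" using cover by simp
  finally have 1: "x * (n choose k) \<le> real (card G) * ((n - 2) choose (k - 2))" .
  have pos: "0 < real ((n - 2) choose (k - 2))" using k by simp
  have "real k * (real k - 1) * (n choose k) = real n * (real n - 1) * ((n - 2) choose (k - 2))"
  proof -
    define k' n' where "k' = k - 2" and "n' = n - 2"
    then have kn: "k = Suc (Suc k')" "n = Suc (Suc n')"
      using k by simp_all
    have "Suc k' * (Suc (Suc k') * (Suc (Suc n') choose Suc (Suc k')))
        = Suc (Suc n') * (Suc n' * (n' choose k'))"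
      using Suc_times_binomial_eq[of "Suc n'" "Suc k'"] Suc_times_binomial_eq[of n' k']
      by (metis (no_types, lifting) mult.commute mult.left_commute)
    then have "real (Suc k' * (Suc (Suc k') * (Suc (Suc n') choose Suc (Suc k'))))
        = real (Suc (Suc n') * (Suc n' * (n' choose k')))" by (rule arg_cong)
    then show ?thesis by (simp only: kn of_nat_mult of_nat_Suc diff_Suc_Suc numeral_2_eq_2 diff_zero) (simp add: algebra_simps)
  qed
  then have eq: "real (n choose k) = real n * (real n - 1) / (real k * (real k - 1)) * ((n - 2) choose (k - 2))"
    using k by (simp add: field_simps)
  have "x * (n / k)\<^sup>2 \<le> x * (real n * (real n - 1) / (real k * (real k - 1)))"
  proof (rule mult_left_mono[OF _ x])
    have "real n / real k \<le> (real n - 1) / (real k - 1)"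
      using k by (simp add: field_simps)
    then have "real n / real k * (real n / real k) \<le> real n / real k * ((real n - 1) / (real k - 1))"
      by (intro mult_left_mono) auto
    then show "(n / k)\<^sup>2 \<le> real n * (real n - 1) / (real k * (real k - 1))"
      by (simp add: power2_eq_square)
  qed
  also have "\<dots> \<le> real (card G)"
  proof -
    have "x * (real n * (real n - 1) / (real k * (real k - 1))) * ((n - 2) choose (k - 2))
        \<le> real (card G) * ((n - 2) choose (k - 2))"
      using 1 unfolding eq by (simp add: mult.assoc)
    then show ?thesis using pos by (simp only: mult_le_cancel_right)
  qed
  finally show ?thesis .
qed

text \<open>Label the edges uniformly at random with \<open>h\<close> labels; no \<open>k\<close>-set is expected to be monochromatic,
  so the most frequent label can be coloured purple.\<close>

lemma exists_large_purple_class: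
  fixes G :: "nat set set"
  assumes finG: "finite G" and h: "0 < h"
    and few: "real (n choose k) * h < real h powr x"
    and dense: "\<And>K. K \<in> nsets {..<n} k \<Longrightarrow> x \<le> real (card {e \<in> G. e \<subseteq> K})"
  shows "\<exists>P\<subseteq>G. real (card G) / h \<le> real (card P) \<and> (\<forall>K\<in>nsets {..<n} k. \<exists>e\<in>G - P. e \<subseteq> K)"
proof -
  let ?\<Omega> = "PiE G (\<lambda>_. {..<h})"
  define Bad where "Bad K i = {f \<in> ?\<Omega>. \<forall>e\<in>G. e \<subseteq> K \<longrightarrow> f e = i}" for K i
  have fin\<Omega>: "finite ?\<Omega>" using finG by (simp add: finite_PiE)
  have card\<Omega>: "real (card ?\<Omega>) = real h ^ card G" using finG by (simp add: card_PiE)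
  have bad: "real (card (Bad K i)) * real h powr x \<le> real h ^ card G" if K: "K \<in> nsets {..<n} k" for K i
  proof -
    let ?E = "{e \<in> G. e \<subseteq> K}"
    have "Bad K i \<subseteq> PiE G (\<lambda>e. if e \<in> ?E then {i} else {..<h})"
      by (auto simp: Bad_def PiE_def Pi_def)
    then have "card (Bad K i) \<le> card (PiE G (\<lambda>e. if e \<in> ?E then {i} else {..<h}))"
      using finG by (intro card_mono finite_PiE) auto
    also have "\<dots> = (\<Prod>e\<in>G. if e \<in> ?E then 1 else h)"
      using finG by (simp add: card_PiE) (intro prod.cong, auto)
    also have "\<dots> = h ^ card (G - ?E)"
    proof -
      have "G \<inter> - ?E = G - ?E" by auto
      then show ?thesis using finG by (simp only: prod.If_cases[OF finG] Collect_mem_eq) simp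
    qed
    also have "card (G - ?E) = card G - card ?E"
      using finG by (intro card_Diff_subset) auto
    finally have "real (card (Bad K i)) \<le> real h ^ (card G - card ?E)"
      by (metis of_nat_mono of_nat_power)
    moreover have "real h powr x \<le> real h ^ card ?E"
      using dense[OF K] h by (simp add: powr_mono flip: powr_realpow)
    ultimately have "real (card (Bad K i)) * real h powr x \<le> real h ^ (card G - card ?E) * real h ^ card ?E"
      by (intro mult_mono) auto
    also have "\<dots> = real h ^ card G"
      using finG by (simp add: card_mono flip: power_add)
    finally show ?thesis .
  qed
  \<comment> \<open>There are (n choose k) h events, a set together with a label, each of
    probability at most h^(-x); \<open>few\<close> makes the sum less than 1.\<close>
  have "\<exists>f\<in>?\<Omega>. \<forall>K\<in>nsets {..<n} k. \<forall>i<h. f \<notin> Bad K i"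
  proof (rule ccontr)
    assume "\<not> ?thesis"
    then have sub: "?\<Omega> \<subseteq> (\<Union>(K, i)\<in>nsets {..<n} k \<times> {..<h}. Bad K i)" by blast
    have "card ?\<Omega> \<le> card (\<Union>(K, i)\<in>nsets {..<n} k \<times> {..<h}. Bad K i)"
      using fin\<Omega> by (intro card_mono[OF _ sub] finite_UN_I) (auto simp: finite_imp_finite_nsets Bad_def)
    also have "\<dots> \<le> (\<Sum>(K, i)\<in>nsets {..<n} k \<times> {..<h}. card (Bad K i))"
      using card_UN_le[of "nsets {..<n} k \<times> {..<h}" "\<lambda>(K, i). Bad K i"]
      by (simp add: finite_imp_finite_nsets case_prod_beta)
    finally have "real (card ?\<Omega>) \<le> real (\<Sum>(K, i)\<in>nsets {..<n} k \<times> {..<h}. card (Bad K i))"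
      by (rule of_nat_mono)
    then have "real h ^ card G * real h powr x
        \<le> (\<Sum>(K, i)\<in>nsets {..<n} k \<times> {..<h}. real (card (Bad K i)) * real h powr x)"
      unfolding card\<Omega> by (simp add: case_prod_beta mult_right_mono flip: sum_distrib_right)
    also have "\<dots> \<le> (\<Sum>(K, i)\<in>nsets {..<n} k \<times> {..<h}. real h ^ card G)"
      using bad by (intro sum_mono) auto
    also have "\<dots> = real (n choose k) * h * real h ^ card G" by (simp add: card_cartesian_product)
    also have "\<dots> < real h powr x * real h ^ card G"
      using few h by (intro mult_strict_right_mono) auto
    finally show False by (simp add: mult.commute)
  qed
  then obtain f where f: "f \<in> ?\<Omega>" "\<And>K i. K \<in> nsets {..<n} k \<Longrightarrow> i < h \<Longrightarrow> f \<notin> Bad K i" by blast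
  define P where "P i = {e \<in> G. f e = i}" for i
  have "\<exists>i<h. real (card G) / h \<le> real (card (P i))"
  proof (rule ccontr)
    assume neg: "\<not> (\<exists>i<h. real (card G) / h \<le> real (card (P i)))"
    have "G = (\<Union>i\<in>{..<h}. P i)" using f(1) by (auto simp: P_def PiE_def Pi_def)
    then have "card G = card (\<Union>i\<in>{..<h}. P i)" by (rule arg_cong)
    also have "\<dots> \<le> (\<Sum>i<h. card (P i))" by (rule card_UN_le) simp
    finally have "real (card G) \<le> (\<Sum>i<h. real (card (P i)))" by (simp flip: of_nat_sum)
    also have "\<dots> < (\<Sum>i<h. real (card G) / h)"
      using neg h by (intro sum_strict_mono) (auto simp: not_le)
    also have "\<dots> = real (card G)" using h by simp
    finally show False by simp
  qed
  then obtain i where i: "i < h" "real (card G) / h \<le> real (card (P i))" by blast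
  have "\<exists>e\<in>G - P i. e \<subseteq> K" if "K \<in> nsets {..<n} k" for K
    using f(2)[OF that i(1)] f(1) by (auto simp: Bad_def P_def)
  moreover have "P i \<subseteq> G" by (auto simp: P_def)
  ultimately show ?thesis using i(2) by blast
qed

section \<open>From edge colourings to the Ramsey number and to \<open>g\<close>\<close>

lemma less_ramsey_number:
  fixes n s t :: nat
  assumes "\<not> partn_lst {..<n} [s, t] 2"
  shows "n < ramsey_number s t"
proof (rule ccontr)
  assume "\<not> n < ramsey_number s t"
  then have le: "ramsey_number s t \<le> n" by simp
  \<comment> \<open>Some witness is required before the \<open>LEAST\<close> in
    \<open>ramsey_number\<close> can be known to have the partition property.\<close>
  have "partn_lst {..<ES 2 s t} [s, t] 2" by (rule ramsey2_full)
  then have "partn_lst {..<ramsey_number s t} [s, t] 2"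
    unfolding ramsey_number_def by (rule LeastI)
  then have "partn_lst {..<n} [s, t] 2"
    using le by (rule partn_lst_greater_resource)
  then show False using assms by blast
qed

text \<open>Merging purple into red gives a two-colouring without a forbidden clique; the other
  class is then blue alone, which is contained in \<open>B \<union> P\<close>.\<close>

lemma rbp_colouring_imp_less_ramsey_number:
  assumes "rbp_colouring n R B P" "clique_free n s (R \<union> P)" "clique_free n t (B \<union> P)"
  shows "n < ramsey_number s t"
proof (rule less_ramsey_number)
  define f :: "nat set \<Rightarrow> nat" where "f e = (if e \<in> R \<union> P then 0 else 1)" for e
  have mono: "\<exists>V\<subseteq>{..<n}. card V = q \<and> clique V E"
    if M: "monochromatic {..<n} q 2 f i" and E: "\<And>e. e \<in> nsets {..<n} 2 \<Longrightarrow> f e = i \<Longrightarrow> e \<in> E" for q i E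
  proof -
    obtain H where H: "H \<in> nsets {..<n} q" "f ` nsets H 2 \<subseteq> {i}"
      using M unfolding monochromatic_def by blast
    have HV: "H \<subseteq> {..<n}" "card H = q" using H(1) by (auto simp: nsets_def)
    have "{u, v} \<in> E" if "u \<in> H" "v \<in> H" "u \<noteq> v" for u v
    proof (rule E)
      have "{u, v} \<in> nsets H 2" using that by simp
      then show "f {u, v} = i" using H(2) by blast
      show "{u, v} \<in> nsets {..<n} 2" using that HV by auto
    qed
    then show ?thesis using HV unfolding clique_def by blast
  qed
  show "\<not> partn_lst {..<n} [s, t] 2"
  proof
    assume "partn_lst {..<n} [s, t] 2"
    moreover have "f \<in> nsets {..<n} 2 \<rightarrow> {..<2}" by (simp add: f_def)
    ultimately obtain i where i: "i < 2" "monochromatic {..<n} ([s, t] ! i) 2 f i"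
      by (auto simp: partn_lst_def numeral_2_eq_2)
    then consider "i = 0" | "i = 1" by linarith
    then show False
    proof cases
      case 1
      have "\<exists>V\<subseteq>{..<n}. card V = s \<and> clique V (R \<union> P)"
        using i(2) unfolding 1 by (intro mono[where i = 0]) (auto simp: f_def split: if_splits)
      then show False using assms(2) by (simp add: clique_free_def)
    next
      case 2
      have "e \<in> B \<union> P" if "e \<in> nsets {..<n} 2" "f e = 1" for e
        using that assms(1) unfolding f_def rbp_colouring_def by (auto split: if_splits)
      then have "\<exists>V\<subseteq>{..<n}. card V = t \<and> clique V (B \<union> P)"
        using i(2) unfolding 2 by (intro mono[where i = 1]) simp_all
      then show False using assms(3) by (simp add: clique_free_def)
    qed
  qed
qed

lemma g_ge_card_purple:
  assumes "rbp_colouring n R B P" "clique_free n 3 (R \<union> P)" "clique_free n (nat \<lceil>t\<rceil>) (B \<union> P)"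
  shows "card P \<le> g n 3 t"
proof -
  have "card P \<in> purple_sizes n 3 (nat \<lceil>t\<rceil>)"
    using assms unfolding purple_sizes_def by blast
  then show ?thesis
    by (simp add: g_def g_nat_def finite_purple_sizes)
qed

text \<open>Blue is the complement of \<open>G\<close>, and red consists of the edges of
  \<open>G\<close> that are not purple. A clique of size \<open>t\<close> in blue and purple would
  contain a \<open>k\<close>-set, which spans a red edge.\<close>

lemma rbp_colouring_of_triangle_free_graph:
  assumes G: "G \<subseteq> nsets {..<n} 2" "\<not> has_triangle G" and P: "P \<subseteq> G"
    and edge: "\<And>K. K \<in> nsets {..<n} k \<Longrightarrow> \<exists>e\<in>G - P. e \<subseteq> K" and k: "k \<le> t"
  shows "rbp_colouring n (G - P) (nsets {..<n} 2 - G) P"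
    and "clique_free n 3 (G - P \<union> P)" "clique_free n t (nsets {..<n} 2 - G \<union> P)"
proof -
  let ?R = "G - P" and ?B = "nsets {..<n} 2 - G"
  show "rbp_colouring n ?R ?B P" using G P by (auto simp: rbp_colouring_def)
  show "clique_free n 3 (?R \<union> P)"
    unfolding clique_free_def
  proof
    assume "\<exists>V\<subseteq>{..<n}. card V = 3 \<and> clique V (?R \<union> P)"
    then obtain V where V: "card V = 3" "clique V G" using P by (auto simp: Un_absorb2)
    then obtain a b c where "V = {a, b, c}" "a \<noteq> b" "a \<noteq> c" "b \<noteq> c" by (auto simp: card_3_iff)
    then show False using V(2) G(2) unfolding clique_def has_triangle_def by blast
  qed
  show "clique_free n t (?B \<union> P)"
    unfolding clique_free_def
  proof
    assume "\<exists>V\<subseteq>{..<n}. card V = t \<and> clique V (?B \<union> P)"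
    then obtain V where V: "V \<subseteq> {..<n}" "card V = t" "clique V (?B \<union> P)" by blast
    obtain K where K: "K \<subseteq> V" "card K = k" using V(2) k by (meson obtain_subset_with_card_n)
    have "K \<in> nsets {..<n} k" using K V(1) finite_subset[of K "{..<n}"] by (auto simp: nsets_def)
    then obtain e where e: "e \<in> G" "e \<notin> P" "e \<subseteq> K" using edge by blast
    then obtain u v where "e = {u, v}" "u \<noteq> v" using G(1) by (blast elim: nsets2_E)
    then show False using e K V(3) unfolding clique_def by blast
  qed
qed

text \<open>Just precise enough for 1.69 <= sqrt (2 / ln 2) <= 7/4, as 1.69^2 = 2.8561 lies narrowly
  below 2 / 0.7. Taking eighth powers brings the arguments close enough to 0 for quadratic
  approximation.\<close>

lemma ln_2_bounds: "66 / 100 \<le> ln (2 :: real)" "ln (2 :: real) \<le> 7 / 10"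
proof -
  have "exp (66 / 100 :: real) = exp (33 / 400) ^ 8" by (simp flip: exp_of_nat_mult)
  also have "\<dots> \<le> (1 + 33 / 400 + (33 / 400)\<^sup>2) ^ 8" by (intro power_mono exp_bound) auto
  also have "\<dots> \<le> (2 :: real)" by (simp add: power_numeral_reduce power_divide)
  finally show "66 / 100 \<le> ln (2 :: real)" by (subst ln_ge_iff) auto
  have "(2 :: real) \<le> (1 + 7 / 80 + (7 / 80)\<^sup>2 / 2) ^ 8" by (simp add: power_numeral_reduce power_divide)
  also have "\<dots> \<le> exp (7 / 80) ^ 8"
    using exp_lower_Taylor_quadratic[of "7 / 80 :: real"] by (intro power_mono) auto
  also have "\<dots> = exp (7 / 10)" by (simp flip: exp_of_nat_mult)
  finally show "ln (2 :: real) \<le> 7 / 10" using ln_le_cancel_iff[of 2 "exp (7 / 10)"] by simp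
qed

text \<open>The conjunct on \<open>ramsey_number\<close> certifies that \<open>g\<close> is
  evaluated where its maximum exists; it follows from the same colouring as the lower bound.\<close>

theorem theorem4p4:
  fixes \<epsilon> :: real
  assumes "\<epsilon> > 0"
  shows "\<exists>\<delta>::real. \<delta> > 0 \<and>
    (\<forall>\<^sub>F n::nat in sequentially. \<forall>t::real.
      t = (sqrt 2 + \<epsilon>) * sqrt (real n * log 2 (real n)) \<longrightarrow>
        n < ramsey_number 3 (nat \<lceil>t\<rceil>) \<and> real (g n 3 t) \<ge> \<delta> * (real n * t / 2))"
proof -
  \<comment> \<open>The set size belonging to the constant sqrt 2; it is at most the rounded-up
    \<open>t\<close> because \<epsilon> is positive. Base 2 logarithms make it about 1.6986 sqrt (n
    ln n).\<close>
  define k where "k n = nat \<lceil>sqrt 2 * sqrt (real n * log 2 (real n))\<rceil>" for n :: nat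
  \<comment> \<open>With x = k L / 10000 edges in each \<open>k\<close>-set, ln h >= 20000 makes h^x
    at least exp (2 k L).\<close>
  define h where "h = nat \<lceil>exp 20000 :: real\<rceil>"
  define c where "c = sqrt 2 + \<epsilon>"
  \<comment> \<open>Fitted so that \<delta> n t / 2 equals n S / (20000 h), with S = sqrt (n ln n),
    as t = c S / sqrt (ln 2).\<close>
  define \<delta> where "\<delta> = sqrt (ln 2) / (c * (10000 * h))"
  have h: "exp 20000 \<le> real h" "0 < h" unfolding h_def by (simp_all add: real_nat_ceiling_ge)
  have c0: "0 < c" using assms by (simp add: c_def add_nonneg_pos)
  have \<delta>0: "0 < \<delta>" using c0 h by (simp add: \<delta>_def)
  have log_eq: "sqrt (real n * log 2 (real n)) = sqrt (real n * ln (real n)) / sqrt (ln 2)" for n :: nat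
    by (simp add: log_def real_sqrt_divide)
  have kb: "169 / 100 * sqrt (real n * ln (real n)) \<le> k n \<and> k n \<le> 2 * sqrt (real n * ln (real n))"
    if S: "4 \<le> sqrt (real n * ln (real n))" for n
  proof -
    define S where "S = sqrt (real n * ln (real n))"
    have "sqrt 2 * sqrt (real n * log 2 (real n)) = sqrt (2 / ln 2) * S"
      by (simp add: log_eq S_def real_sqrt_divide)
    moreover have "169 / 100 \<le> sqrt (2 / ln 2 :: real)"
      using ln_2_bounds by (intro real_le_rsqrt) (simp add: power2_eq_square field_simps)
    moreover have "sqrt (2 / ln 2 :: real) \<le> 7 / 4"
      using ln_2_bounds by (intro real_le_lsqrt) (simp_all add: power2_eq_square field_simps)
    moreover have "0 \<le> S" using S unfolding S_def by linarith
    ultimately have "169 / 100 * S \<le> sqrt 2 * sqrt (real n * log 2 (real n))"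
      "sqrt 2 * sqrt (real n * log 2 (real n)) \<le> 7 / 4 * S"
      by (auto simp only: intro!: mult_right_mono)
    \<comment> \<open>Rounding up adds at most 1 <= S / 4, which takes 7/4 S to 2 S.\<close>
    then show ?thesis using S unfolding k_def S_def[symmetric] by linarith
  qed
  have S4: "\<forall>\<^sub>F n in sequentially. 4 \<le> sqrt (real n * ln (real n))" by real_asymp
  then have "\<forall>\<^sub>F n in sequentially. \<exists>G\<subseteq>nsets {..<n} 2. \<not> has_triangle G \<and>
      (\<forall>K\<in>nsets {..<n} (k n). k n * ln (real n) / 10000 \<le> real (card {e \<in> G. e \<subseteq> K}))"
    by (intro eventually_locally_dense_triangle_free_graph) (rule eventually_mono, rule S4, rule kb)
  moreover have "\<forall>\<^sub>F n in sequentially. 2 * sqrt (real n * ln (real n)) \<le> n" by real_asymp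
  moreover have "\<forall>\<^sub>F n in sequentially. ln (real h) < ln (real n)" by real_asymp
  ultimately have "\<forall>\<^sub>F n in sequentially. \<forall>t. t = (sqrt 2 + \<epsilon>) * sqrt (real n * log 2 (real n)) \<longrightarrow>
      n < ramsey_number 3 (nat \<lceil>t\<rceil>) \<and> real (g n 3 t) \<ge> \<delta> * (real n * t / 2)"
    using S4
  proof eventually_elim
    case (elim n)
    define L where "L = ln (real n)"
    define S where "S = sqrt (real n * L)"
    obtain G where G: "G \<subseteq> nsets {..<n} 2" "\<not> has_triangle G"
      "\<And>K. K \<in> nsets {..<n} (k n) \<Longrightarrow> k n * L / 10000 \<le> real (card {e \<in> G. e \<subseteq> K})"
      using elim(1) unfolding L_def by blast
    have S: "169 / 100 * S \<le> k n" "k n \<le> 2 * S" "4 \<le> S"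
      using kb[OF elim(4)] elim(4) by (auto simp: S_def L_def)
    have k2: "2 \<le> k n" using S by linarith
    have kn: "k n \<le> n" using S elim(2) unfolding S_def L_def by linarith
    have "1 \<le> real h" using h(2) by simp
    then have lnh: "0 \<le> ln (real h)" by simp
    have L0: "0 < L" using elim(3) lnh by (simp add: L_def)
    have n0: "0 < real n" using kn k2 by linarith
    have nL: "real n * L = S * S" using n0 L0 by (simp add: S_def)
    define x where "x = k n * L / 10000"
    have few: "real (n choose k n) * h < real h powr x"
    proof -
      have "real (n choose k n) \<le> real (n ^ k n)" by (intro of_nat_mono binomial_le_power)
      also have "\<dots> = exp (k n * L)" using n0 by (simp add: L_def exp_of_nat_mult)
      finally have 1: "real (n choose k n) \<le> exp (k n * L)" .
      have "1 * L \<le> k n * L" using k2 L0 by (intro mult_right_mono) auto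
      then have "ln (real h) < k n * L" using elim(3) by (simp add: L_def)
      then have 2: "real h < exp (k n * L)"
        using h(2) exp_less_cancel_iff[of "ln (real h)" "k n * L"] by simp
      have "real (n choose k n) * h \<le> exp (k n * L) * h" using 1 by (intro mult_right_mono) auto
      also have "\<dots> < exp (k n * L) * exp (k n * L)" using 2 by simp
      \<comment> \<open>One factor exp (k L) accounts for the number of \<open>k\<close>-sets, the
        other for the choice of the label.\<close>
      also have "\<dots> = exp (x * 20000)" by (simp add: x_def flip: exp_add)
      also have "\<dots> \<le> exp (x * ln (real h))"
      proof -
        have "20000 \<le> ln (real h)" using h by (simp add: ln_ge_iff)
        moreover have "0 \<le> x" using L0 by (simp add: x_def)
        ultimately show ?thesis by (simp add: mult_left_mono)
      qed
      also have "\<dots> = real h powr x" using h(2) by (simp add: powr_def)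
      finally show ?thesis .
    qed
    have finG: "finite G" using G(1) finite_subset finite_imp_finite_nsets by blast
    obtain P where P: "P \<subseteq> G" "real (card G) / h \<le> real (card P)"
      "\<And>K. K \<in> nsets {..<n} (k n) \<Longrightarrow> \<exists>e\<in>G - P. e \<subseteq> K"
      using exists_large_purple_class[OF finG h(2) few] G(3) unfolding x_def by blast
    have size: "n * S / (20000 * h) \<le> real (card P)"
    proof -
      have "n * S / 20000 = (S * S) * n / (20000 * S)" using S(3) by simp
      also have "\<dots> = L * (real n)\<^sup>2 / (10000 * (2 * S))" by (simp flip: nL add: power2_eq_square)
      also have "\<dots> \<le> L * (real n)\<^sup>2 / (10000 * k n)"
        using S L0 k2 by (intro divide_left_mono) auto
      also have "\<dots> = x * (n / k n)\<^sup>2" using k2 by (simp add: x_def power2_eq_square field_simps)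
      also have "\<dots> \<le> real (card G)"
        using L0 G(3) unfolding x_def by (intro card_edges_ge[OF G(1) k2 kn]) auto
      finally have "n * S / 20000 / h \<le> real (card G) / h" by (intro divide_right_mono) auto
      then show ?thesis using P(2) by simp
    qed
    show ?case
    proof (intro allI impI)
      fix t assume t: "t = (sqrt 2 + \<epsilon>) * sqrt (real n * log 2 (real n))"
      have "sqrt 2 * sqrt (real n * log 2 (real n)) \<le> t"
        unfolding t using assms L0 n0 by (intro mult_right_mono) (auto simp: log_eq L_def)
      then have kt: "k n \<le> nat \<lceil>t\<rceil>" unfolding k_def by (intro nat_mono ceiling_mono)
      note col = rbp_colouring_of_triangle_free_graph[OF G(1,2) P(1) P(3) kt]
      have "\<delta> * (real n * t / 2) = n * S / (20000 * h)"
        unfolding t log_eq \<delta>_def c_def[symmetric] using c0 by (simp add: S_def L_def field_simps)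
      then have "\<delta> * (real n * t / 2) \<le> real (g n 3 t)"
        using size g_ge_card_purple[OF col] by linarith
      then show "n < ramsey_number 3 (nat \<lceil>t\<rceil>) \<and> real (g n 3 t) \<ge> \<delta> * (real n * t / 2)"
        using rbp_colouring_imp_less_ramsey_number[OF col] by simp
    qed
  qed
  then show ?thesis using \<delta>0 by blast
qed

end
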